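(* Let $Z=(X,Y)\in\Omega$ satisfy $X_i(\mathbf 0)Y_i(\mathbf 0)>0$ and $X_j(\mathbf 0)Y_j(\mathbf 0)<0$ for some $i,j\in\{1,2\}$ with $i\neq j$, $X_1(\mathbf 0)X_2(\mathbf 0)<0$, and $\alpha_Z\neq-1$, where $\alpha_Z=\dfrac{X_1(\mathbf 0)Y_2(\mathbf 0)}{X_2(\mathbf 0)Y_1(\mathbf 0)}$. Then $Z$ is locally $\Sigma$-equivalent to $$\tilde Z(p)=\begin{cases}(a,-a), & p\in\mathcal U^+,\\ \big(b(1+\delta_{1,c}),\,b(1+\delta_{-1,c})\big), & p\in\mathcal U^-,\end{cases}$$ where $a=\operatorname{sgn}(X_1(\mathbf 0))$, $b=\operatorname{sgn}(Y_1(\mathbf 0))$, $c=\operatorname{sgn}(\alpha_Z+1)$ and $\delta_{m,n}$ is the Kronecker delta.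
   Context: Setting. Fix $r\ge 1$ and a bounded open neighborhood $\mathcal U$ of the origin $\mathbf 0$ in $\mathbb R^2$. Let $\Sigma=\{(x_1,x_2)\in\mathcal U: x_1x_2=0\}$, $\mathcal U^+=\{x_1x_2>0\}$, $\mathcal U^-=\{x_1x_2<0\}$. Write $\Sigma=\Sigma_1\cup\Sigma_2$ with $\Sigma_1=\{x_1=0\}$, $\Sigma_2=\{x_2=0\}$; $\Sigma_1^{\pm}=\{(0,x_2):\pm x_2>0\}$ and $\Sigma_2^{\pm}=\{(x_1,0):\pm x_1>0\}$. $\Omega$ is the set of piecewise smooth vector fields $Z=(X,Y)$, where $X=(X_1,X_2)$, $Y=(Y_1,Y_2)$ are $C^r$ vector fields on $\overline{\mathcal U}$, with $Z=X$ on $\mathcal U^+$ and $Z=Y$ on $\mathcal U^-$. Regions of $\Sigma$. For $i=1,2$: crossing region $\Sigma_i^c=\{p\in\Sigma_i: X_iY_i(p)>0\}$; sliding region $\Sigma_i^s=\{p\in\Sigma_i^+:X_i(p)<0,Y_i(p)>0\}\cup\{p\in\Sigma_i^-:X_i(p)>0,Y_i(p)<0\}$; escaping region $\Sigma_i^e=\{p\in\Sigma_i^+:X_i(p)>0,Y_i(p)<0\}\cup\{p\in\Sigma_i^-:X_i(p)<0,Y_i(p)>0\}$. $\Sigma^{c},\Sigma^s,\Sigma^e$ are the unions over $i=1,2$. On $\Sigma_i^{s}\cup\Sigma_i^e$ the sliding vector field is the one-dimensional vector field $Z_i^s=\dfrac{Y_iX_j-X_iY_j}{Y_i-X_i}\Big|_{\Sigma_i}$,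 $j\neq i$. Trajectories of $Z$. For $p\neq\mathbf 0$: if $p\in\mathcal U^{+}$ (resp. $\mathcal U^-$) follow the trajectory of $X$ (resp. $Y$), where trajectories meeting $\Sigma^s\cup\Sigma^e$ transversally are regarded as relatively open (they do not reach $\Sigma^s\cup\Sigma^e$ in finite time); if $p\in\Sigma^c$ concatenate the trajectories of $X$ and $Y$ through $p$; if $p\in\Sigma_i^s\cup\Sigma_i^e$ follow the trajectory of $Z_i^s$; if $p\in\partial\Sigma_i^e\cup\partial\Sigma_i^s\cup\partial\Sigma_i^c$ and the one-sided limits $\lim_{q\to p^\pm}\varphi_Z(t;q)$ along $\Sigma_i$ coincide, the trajectory is this limit; for other such boundary points it is $\{p\}$. For $\mathbf 0$: if $\Sigma=\overline{\Sigma^c}$, it is the unique trajectory of $X$ or $Y$ that crosses the origin; if $\mathbf 0\in\overline{\Sigma_i^e\cup\Sigma_i^s}\cap\overline{\Sigma_j^c}$, $i\ne j$, it is the trajectory of $Z_i^s$; if $\mathbf 0\in\bigcap_{i=1,2}\overline{\Sigma_i^e\cup\Sigma_i^s}$, it is $\{\mathbf 0\}$. Equivalence. $Z,\tilde Z\in\Omega$ are locally $\Sigma$-equivalent if there are neighborhoods $\mathcal U_0,\tilde{\mathcal U}_0$ of the origin and an orientation preserving homeomorphism $h:\mathcal U_0\to\tilde{\mathcal U}_0$ mapping trajectories of $Z$ to trajectories of $\tilde Z$ and $\Sigma$ to $\Sigma$. *)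

theory Defs
  imports "HOL-Analysis.Analysis" "HOL-Complex_Analysis.Winding_Numbers"
begin

type_synonym plane = "real^2"

text \<open>A piecewise smooth field is the pair \<open>Z = (X, Y)\<close>, with \<open>X\<close> acting on \<open>x\<^sub>1 x\<^sub>2 > 0\<close> and \<open>Y\<close>
  on \<open>x\<^sub>1 x\<^sub>2 < 0\<close>; it is multivalued on \<open>\<Sigma>\<close>.\<close>

type_synonym pwfield = "(plane \<Rightarrow> plane) \<times> (plane \<Rightarrow> plane)"

text \<open>\<open>Ck_on\<close> is meant for open \<open>W\<close>, where the derivatives depend only on the values on \<open>W\<close>.\<close>

primrec Ck_on :: "nat \<Rightarrow> ('a::real_normed_vector \<Rightarrow> 'b::real_normed_vector) \<Rightarrow> 'a set \<Rightarrow> bool" where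
  "Ck_on 0 f W \<longleftrightarrow> continuous_on W f"
| "Ck_on (Suc k) f W \<longleftrightarrow>
     (\<forall>x\<in>W. f differentiable (at x)) \<and> (\<forall>v. Ck_on k (\<lambda>x. frechet_derivative f (at x) v) W)"

text \<open>\<open>C\<^sup>k\<close> on a closed set means \<open>C\<^sup>k\<close>-extendable to an open neighbourhood of it.\<close>

definition Ck_on_closed :: "nat \<Rightarrow> (plane \<Rightarrow> plane) \<Rightarrow> plane set \<Rightarrow> bool" where
  "Ck_on_closed k F K \<longleftrightarrow> (\<exists>W G. open W \<and> K \<subseteq> W \<and> Ck_on k G W \<and> (\<forall>p\<in>K. F p = G p))"

definition Omega :: "nat \<Rightarrow> plane set \<Rightarrow> pwfield set" where
  "Omega r U = {(X, Y). Ck_on_closed r X (closure U) \<and> Ck_on_closed r Y (closure U)}"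

text \<open>Everything takes the domain \<open>U\<close> as a parameter, since local equivalence restricts the
  fields to smaller neighbourhoods of the origin.\<close>

definition other :: "2 \<Rightarrow> 2" where
  "other i = (if i = 1 then 2 else 1)"

definition Upos :: "plane set \<Rightarrow> plane set" where
  "Upos U = {p\<in>U. p $ 1 * p $ 2 > 0}"

definition Uneg :: "plane set \<Rightarrow> plane set" where
  "Uneg U = {p\<in>U. p $ 1 * p $ 2 < 0}"

definition Sigma_set :: "plane set \<Rightarrow> plane set" where
  "Sigma_set U = {p\<in>U. p $ 1 * p $ 2 = 0}"

definition Sigma_axis :: "plane set \<Rightarrow> 2 \<Rightarrow> plane set" where
  "Sigma_axis U i = {p\<in>U. p $ i = 0}"

definition Sigma_plus :: "plane set \<Rightarrow> 2 \<Rightarrow> plane set" where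
  "Sigma_plus U i = {p\<in>Sigma_axis U i. p $ other i > 0}"

definition Sigma_minus :: "plane set \<Rightarrow> 2 \<Rightarrow> plane set" where
  "Sigma_minus U i = {p\<in>Sigma_axis U i. p $ other i < 0}"

definition crossing :: "pwfield \<Rightarrow> plane set \<Rightarrow> 2 \<Rightarrow> plane set" where
  "crossing Z U i = {p\<in>Sigma_axis U i. fst Z p $ i * snd Z p $ i > 0}"

definition sliding :: "pwfield \<Rightarrow> plane set \<Rightarrow> 2 \<Rightarrow> plane set" where
  "sliding Z U i = {p\<in>Sigma_plus U i. fst Z p $ i < 0 \<and> snd Z p $ i > 0} \<union>
                   {p\<in>Sigma_minus U i. fst Z p $ i > 0 \<and> snd Z p $ i < 0}"

definition escaping :: "pwfield \<Rightarrow> plane set \<Rightarrow> 2 \<Rightarrow> plane set" where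
  "escaping Z U i = {p\<in>Sigma_plus U i. fst Z p $ i > 0 \<and> snd Z p $ i < 0} \<union>
                    {p\<in>Sigma_minus U i. fst Z p $ i < 0 \<and> snd Z p $ i > 0}"

text \<open>The one-dimensional sliding field, as a planar vector tangent to the line \<open>x\<^sub>i = 0\<close>.\<close>

definition sliding_field :: "pwfield \<Rightarrow> 2 \<Rightarrow> plane \<Rightarrow> plane" where
  "sliding_field Z i p = (let j = other i; X = fst Z p; Y = snd Z p in
     axis j ((Y $ i * X $ j - X $ i * Y $ j) / (Y $ i - X $ i)))"

text \<open>\<open>follows_at Z U I \<gamma> t\<close> says that the curve \<open>\<gamma>\<close> on the interval \<open>I\<close> obeys \<open>Z\<close> near time \<open>t\<close>, for
  all positions \<open>\<gamma> t\<close> other than boundary points of the regions of \<open>\<Sigma>\<close>. A curve arriving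
  transversally at a sliding or escaping point violates the second clause there, so that point
  does not belong to it.\<close>

definition crosses_at ::
    "(plane \<Rightarrow> plane) \<Rightarrow> plane set \<Rightarrow> (plane \<Rightarrow> plane) \<Rightarrow> plane set \<Rightarrow> real set \<Rightarrow> (real \<Rightarrow> plane) \<Rightarrow> real \<Rightarrow> bool" where
  "crosses_at F A G B I \<gamma> t \<longleftrightarrow>
     (\<gamma> has_vector_derivative F (\<gamma> t)) (at t within (I \<inter> {..t})) \<and>
     (\<forall>\<^sub>F s in at t within (I \<inter> {..t}). \<gamma> s \<in> A) \<and>
     (\<gamma> has_vector_derivative G (\<gamma> t)) (at t within (I \<inter> {t..})) \<and>
     (\<forall>\<^sub>F s in at t within (I \<inter> {t..}). \<gamma> s \<in> B)"

definition follows_off_origin_at ::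
    "pwfield \<Rightarrow> plane set \<Rightarrow> real set \<Rightarrow> (real \<Rightarrow> plane) \<Rightarrow> real \<Rightarrow> bool" where
  "follows_off_origin_at Z U I \<gamma> t \<longleftrightarrow> \<gamma> t \<noteq> 0 \<and>
     (\<gamma> t \<in> Upos U \<and> (\<gamma> has_vector_derivative fst Z (\<gamma> t)) (at t within I) \<or>
      \<gamma> t \<in> Uneg U \<and> (\<gamma> has_vector_derivative snd Z (\<gamma> t)) (at t within I) \<or>
      (\<exists>i. \<gamma> t \<in> sliding Z U i \<union> escaping Z U i \<and>
         (\<gamma> has_vector_derivative sliding_field Z i (\<gamma> t)) (at t within I) \<and>
         (\<forall>\<^sub>F s in at t within I. \<gamma> s \<in> Sigma_axis U i)) \<or>
      (\<exists>i. \<gamma> t \<in> crossing Z U i \<and>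
         (crosses_at (fst Z) (Upos U) (snd Z) (Uneg U) I \<gamma> t \<or>
          crosses_at (snd Z) (Uneg U) (fst Z) (Upos U) I \<gamma> t)))"

text \<open>At the origin no derivative is imposed in the sliding case: \<open>\<gamma>\<close> is continuous and solves the
  sliding field at the neighbouring times, and the formula for the sliding field may be the
  meaningless quotient \<open>0 / 0\<close> at the origin itself. If sliding or escaping points accumulate at
  the origin along both axes, no curve passes through it.\<close>

definition follows_at_origin ::
    "pwfield \<Rightarrow> plane set \<Rightarrow> real set \<Rightarrow> (real \<Rightarrow> plane) \<Rightarrow> real \<Rightarrow> bool" where
  "follows_at_origin Z U I \<gamma> t \<longleftrightarrow> \<gamma> t = 0 \<and>
     (Sigma_set U = U \<inter> closure (\<Union>i. crossing Z U i) \<and>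
        ((\<gamma> has_vector_derivative fst Z 0) (at t within I) \<and>
         (\<forall>\<^sub>F s in at t within I. \<gamma> s \<in> Upos U) \<or>
         (\<gamma> has_vector_derivative snd Z 0) (at t within I) \<and>
         (\<forall>\<^sub>F s in at t within I. \<gamma> s \<in> Uneg U)) \<or>
      (\<exists>i. 0 \<in> closure (escaping Z U i \<union> sliding Z U i) \<and>
           0 \<in> closure (crossing Z U (other i)) \<and>
           0 \<notin> closure (escaping Z U (other i) \<union> sliding Z U (other i)) \<and>
           (\<forall>\<^sub>F s in at t within I. \<gamma> s \<in> escaping Z U i \<union> sliding Z U i)))"

definition follows_at :: "pwfield \<Rightarrow> plane set \<Rightarrow> real set \<Rightarrow> (real \<Rightarrow> plane) \<Rightarrow> real \<Rightarrow> bool" where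
  "follows_at Z U I \<gamma> t \<longleftrightarrow> follows_off_origin_at Z U I \<gamma> t \<or> follows_at_origin Z U I \<gamma> t"

text \<open>The boundary is taken inside the line \<open>\<Sigma>\<^sub>i\<close>; in the plane it would contain the regions themselves.\<close>

definition region_boundary :: "pwfield \<Rightarrow> plane set \<Rightarrow> 2 \<Rightarrow> plane set" where
  "region_boundary Z U i =
     (top_of_set (Sigma_axis U i)) frontier_of (escaping Z U i) \<union>
     (top_of_set (Sigma_axis U i)) frontier_of (sliding Z U i) \<union>
     (top_of_set (Sigma_axis U i)) frontier_of (crossing Z U i)"

text \<open>The curves that follow \<open>Z\<close> at all times. At a boundary point \<open>p\<close> the curve must be the limit
  \<open>L\<close> of the trajectories \<open>\<Phi> q\<close> through the points \<open>q\<close> of \<open>\<Sigma>\<^sub>i\<close> on either side of \<open>p\<close>. Those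
  trajectories may themselves pass through \<open>p\<close> (for instance when \<open>\<Sigma>\<^sub>i\<close> is sliding on both sides
  of \<open>p\<close>), so the definition is circular, and the greatest solution is the intended one.\<close>

coinductive regular_curve ::
    "pwfield \<Rightarrow> plane set \<Rightarrow> real set \<Rightarrow> (real \<Rightarrow> plane) \<Rightarrow> bool" for Z U where
  "\<lbrakk>is_interval I; interior I \<noteq> {}; continuous_on I \<gamma>; \<gamma> ` I \<subseteq> U;
    \<forall>t\<in>I. follows_at Z U I \<gamma> t \<or>
      (\<exists>i \<epsilon> \<delta> \<Phi> L. \<gamma> t \<in> region_boundary Z U i - {0} \<and> \<epsilon> > 0 \<and> \<delta> > 0 \<and>
         (\<forall>q\<in>Sigma_axis U i. q \<noteq> \<gamma> t \<and> dist q (\<gamma> t) < \<delta> \<longrightarrow>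
            \<Phi> q (0::real) = q \<and> regular_curve Z U {-\<epsilon><..<\<epsilon>} (\<Phi> q)) \<and>
         (\<forall>s\<in>{-\<epsilon><..<\<epsilon>}. ((\<lambda>q. \<Phi> q s) \<longlongrightarrow> L s) (at (\<gamma> t) within Sigma_axis U i)) \<and>
         (\<forall>s\<in>I. \<bar>s - t\<bar> < \<epsilon> \<longrightarrow> \<gamma> s = L (s - t)))\<rbrakk>
   \<Longrightarrow> regular_curve Z U I \<gamma>"

text \<open>Every remaining point is a trajectory \<open>{p}\<close> of its own. Trajectories are not required to be
  maximal: each arc of a trajectory counts as one.\<close>

definition trajectory :: "pwfield \<Rightarrow> plane set \<Rightarrow> real set \<Rightarrow> (real \<Rightarrow> plane) \<Rightarrow> bool" where
  "trajectory Z U I \<gamma> \<longleftrightarrow> regular_curve Z U I \<gamma> \<or>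
     (is_interval I \<and> interior I \<noteq> {} \<and>
      (\<exists>p\<in>U. (\<forall>t\<in>I. \<gamma> t = p) \<and> (\<forall>J \<eta>. regular_curve Z U J \<eta> \<longrightarrow> p \<notin> \<eta> ` J)))"

definition to_complex :: "plane \<Rightarrow> complex" where
  "to_complex p = Complex (p $ 1) (p $ 2)"

definition of_complex_plane :: "complex \<Rightarrow> plane" where
  "of_complex_plane z = vector [Re z, Im z]"

text \<open>A homeomorphism between open subsets of the plane preserves orientation if its local degree is
  \<open>1\<close> everywhere, i.e. small positively oriented circles have image of winding number \<open>1\<close> around
  the image of the centre (the radius does not matter, by homotopy invariance).\<close>

definition orientation_preserving_on :: "plane set \<Rightarrow> (plane \<Rightarrow> plane) \<Rightarrow> bool" where
  "orientation_preserving_on S h \<longleftrightarrow>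
     (\<forall>p\<in>S. \<exists>\<rho>>0. cball p \<rho> \<subseteq> S \<and>
        winding_number (to_complex \<circ> h \<circ> of_complex_plane \<circ> circlepath (to_complex p) \<rho>)
          (to_complex (h p)) = 1)"

text \<open>Trajectories are oriented by time, and matter only up to increasing reparametrization. As
  arcs count as trajectories, imposing this on \<open>h\<close> and on its inverse makes maximal trajectories
  correspond to maximal trajectories.\<close>

definition maps_trajectories ::
    "(plane \<Rightarrow> plane) \<Rightarrow> pwfield \<Rightarrow> plane set \<Rightarrow> pwfield \<Rightarrow> plane set \<Rightarrow> bool" where
  "maps_trajectories h Z V Z' V' \<longleftrightarrow>
     (\<forall>I \<gamma>. trajectory Z V I \<gamma> \<longrightarrow>
        (\<exists>J \<tau>. strict_mono_on J \<tau> \<and> \<tau> ` J = I \<and> trajectory Z' V' J (h \<circ> \<gamma> \<circ> \<tau>)))"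

definition locally_Sigma_equivalent ::
    "nat \<Rightarrow> plane set \<Rightarrow> pwfield \<Rightarrow> pwfield \<Rightarrow> bool" where
  "locally_Sigma_equivalent r U Z Z' \<longleftrightarrow> Z \<in> Omega r U \<and> Z' \<in> Omega r U \<and>
     (\<exists>V V' h g. open V \<and> 0 \<in> V \<and> V \<subseteq> U \<and> open V' \<and> 0 \<in> V' \<and> V' \<subseteq> U \<and>
        homeomorphism V V' h g \<and> orientation_preserving_on V h \<and>
        h ` Sigma_set V = Sigma_set V' \<and>
        maps_trajectories h Z V Z' V' \<and> maps_trajectories g Z' V' Z V)"

definition alpha :: "pwfield \<Rightarrow> real" where
  "alpha Z = (fst Z 0 $ 1 * snd Z 0 $ 2) / (fst Z 0 $ 2 * snd Z 0 $ 1)"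

definition kronecker :: "real \<Rightarrow> real \<Rightarrow> real" where
  "kronecker m n = (if m = n then 1 else 0)"

definition normal_form :: "real \<Rightarrow> real \<Rightarrow> real \<Rightarrow> pwfield" where
  "normal_form a b c =
     ((\<lambda>p. vector [a, - a]),
      (\<lambda>p. vector [b * (1 + kronecker 1 c), b * (1 + kronecker (-1) c)]))"

end

theory Submission
  imports Defs
begin

text \<open>
  The picture behind the equivalence is a picture of leaves. Near the origin put \<open>x = p $ i\<close> and
  \<open>y = p $ j\<close>, so that the axis \<open>y = 0\<close> is the sliding and escaping axis and \<open>x = 0\<close> is crossed. The
  sign hypotheses say that, with \<open>e\<close> the sign of \<open>X 0 $ i\<close>, every velocity, including the sliding one,
  has an \<open>x\<close>-component of sign \<open>e\<close>; the slope \<open>y'/x'\<close> is negative for \<open>X\<close> and positive for \<open>Y\<close>. Hence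
  a regular curve is, up to the parametrization by time, a graph over the \<open>x\<close>-axis traversed in
  direction \<open>e\<close>: either an arc of \<open>y = 0\<close>, or an arc with \<open>y \<noteq> 0\<close> along a leaf of \<open>X\<close> on one side of
  \<open>x = 0\<close> and the leaf of \<open>Y\<close> with the same \<open>y\<close>-intercept on the other side. Labelling a point by this
  intercept turns the dynamics into the statement that \<open>y\<close> vanishes identically, or never vanishes and the
  label is constant (\<open>regular_curve_imp_leaf_curve\<close> and \<open>leaf_curve_imp_regular_curve\<close>).

  It remains to find a homeomorphism which preserves the two axes and the order of the
  \<open>x\<close>-coordinates, and matches labels. Each point \<open>(x, 0)\<close> is the foot of two
  leaves: one of \<open>X\<close>, with label \<open>A x\<close>, and one of \<open>Y\<close>, with
  label \<open>B x\<close>. Here \<open>A\<close> is increasing and \<open>B\<close> decreasing. In the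
  normal form the two labels are \<open>x\<close> and \<open>- \<sigma> x\<close>, where
  \<open>\<sigma>\<close> is \<open>1/2\<close> or \<open>2\<close>. So if the homeomorphism acts on the
  \<open>y\<close>-axis by \<open>\<kappa>\<close>, then it acts on the \<open>x\<close>-axis by
  \<open>\<kappa> \<circ> A\<close>, and \<open>\<kappa>\<close> has to satisfy \<open>\<kappa> \<circ>
  B = - \<sigma> \<cdot> (\<kappa> \<circ> A)\<close>: it conjugates the transition \<open>B \<circ> inv
  A\<close>, from a leaf of \<open>X\<close> to the leaf of \<open>Y\<close> with the same foot, to a
  linear map. The hypothesis on \<open>\<alpha>\<close> makes the slopes of \<open>X\<close> and
  \<open>Y\<close> at the origin different in absolute value, so that this transition, or its inverse,
  is a decreasing contraction, and such maps are all conjugate to multiplication by \<open>- 1/2\<close>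
  (\<open>decreasing_contraction_conjugacy\<close>).

  Given \<open>\<kappa>\<close>, the homeomorphism is \<open>(x, y) \<mapsto> (\<kappa> (A x), \<kappa> (label (x, y)) - \<kappa> (label (x, 0)))\<close>, where both labels
  belong to the field of the quadrant of \<open>(x, y)\<close>. Its first component is an increasing function of \<open>x\<close> alone,
  and its second one increases with \<open>y\<close> for fixed \<open>x\<close>. This makes it injective, hence open by
  invariance of domain, and it makes the orientation visible: the chord \<open>h q - h p\<close> never points opposite to
  \<open>q - p\<close>, so straight segments deform the image of a small circle into a circle without touching its centre.

  The leaves are global solutions of a scalar equation \<open>y' = f x y\<close> with \<open>f\<close> bounded and Lipschitz in
  \<open>y\<close>; the fields are extended from a small box to the plane by clamping the coordinates. The index
  \<open>i\<close> stays a variable throughout, so that the cases \<open>i = 1\<close> and \<open>i = 2\<close> separate only in the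
  comparison with the normal form.
\<close>

section \<open>Scalar slope fields and their leaves\<close>

lemma antiderivative_real:
  fixes \<phi> :: "real \<Rightarrow> real"
  assumes "continuous_on UNIV \<phi>"
  obtains F where "F x0 = 0" "\<And>u. (F has_real_derivative \<phi> u) (at u)"
proof -
  define F where "F u = (if x0 \<le> u then integral {x0..u} \<phi> else - integral {u..x0} \<phi>)" for u
  have cont: "continuous_on S \<phi>" for S
    using assms continuous_on_subset by blast
  have int: "\<phi> integrable_on {a..b}" for a b
    using cont integrable_continuous_real by blast
  have "(F has_real_derivative \<phi> u) (at u)" for u
  proof -
    define l r where "l = min u x0 - 1" and "r = max u x0 + 1"
    have eq: "F v = integral {l..v} \<phi> - integral {l..x0} \<phi>" if "v \<in> {l..r}" for v
    proof (cases "x0 \<le> v")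
      case True
      have "integral {l..x0} \<phi> + integral {x0..v} \<phi> = integral {l..v} \<phi>"
        by (rule Henstock_Kurzweil_Integration.integral_combine) (use True int in \<open>auto simp: l_def\<close>)
      with True show ?thesis by (simp add: F_def)
    next
      case False
      have "integral {l..v} \<phi> + integral {v..x0} \<phi> = integral {l..x0} \<phi>"
        by (rule Henstock_Kurzweil_Integration.integral_combine) (use False int that in \<open>auto simp: l_def\<close>)
      with False show ?thesis by (simp add: F_def)
    qed
    have u: "u \<in> {l<..<r}" by (auto simp: l_def r_def)
    have "((\<lambda>v. integral {l..v} \<phi>) has_real_derivative \<phi> u) (at u within {l..r})"
      using integral_has_real_derivative[OF cont] u by auto
    then have "((\<lambda>v. integral {l..v} \<phi> - integral {l..x0} \<phi>) has_real_derivative \<phi> u) (at u within {l..r})"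
      by (auto intro!: derivative_eq_intros)
    then have "(F has_real_derivative \<phi> u) (at u within {l..r})"
      by (rule has_field_derivative_transform_within[where d=1]) (use u eq in auto)
    moreover have "at u within {l..r} = at u"
      using u by (simp add: at_within_Icc_at)
    ultimately show ?thesis by simp
  qed
  moreover have "F x0 = 0" by (simp add: F_def)
  ultimately show ?thesis using that by blast
qed

text \<open>Both \<open>H - g\<close> and \<open>H + g\<close> are nondecreasing and vanish at \<open>x0\<close>. Stated for both directions of
  time at once, which is why \<open>H\<close> may be negative to the left of \<open>x0\<close>.\<close>

lemma abs_le_of_deriv_dominated:
  fixes g H :: "real \<Rightarrow> real"
  assumes g: "\<And>x. (g has_real_derivative g' x) (at x)" and H: "\<And>x. (H has_real_derivative H' x) (at x)"
    and dom: "\<And>x. \<bar>g' x\<bar> \<le> H' x" and "g x0 = 0" "H x0 = 0"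
  shows "\<bar>g x\<bar> \<le> \<bar>H x\<bar>"
proof -
  have mono: "H a - g a \<le> H b - g b \<and> H a + g a \<le> H b + g b" if "a \<le> b" for a b
  proof
    show "H a - g a \<le> H b - g b"
      by (rule DERIV_nonneg_imp_nondecreasing[where f="\<lambda>x. H x - g x"])
         (use that dom in \<open>auto intro!: exI derivative_eq_intros g H simp: abs_le_iff\<close>)
    have "\<exists>y. ((\<lambda>x. H x + g x) has_real_derivative y) (at x) \<and> 0 \<le> y" for x
      by (rule exI[of _ "H' x + g' x"], use dom[of x] in \<open>auto intro!: derivative_eq_intros g H\<close>)
    then show "H a + g a \<le> H b + g b"
      using DERIV_nonneg_imp_nondecreasing[where f="\<lambda>x. H x + g x"] that by blast
  qed
  show ?thesis
    using mono[of x x0] mono[of x0 x] assms(4,5) by (cases "x \<le> x0") auto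
qed

text \<open>The derivative of \<open>(d s)\<^sup>2\<close> is at most \<open>2 * K * (d s)\<^sup>2\<close> in absolute value, so \<open>exp (- 2 K s) (d s)\<^sup>2\<close> falls and
  \<open>exp (2 K s) (d s)\<^sup>2\<close> rises. Derivatives are required in the open interval only, because curves will
  be compared up to the time at which they hit a discontinuity of the piecewise field.\<close>

lemma Gronwall_both:
  fixes d :: "real \<Rightarrow> real"
  assumes "a \<le> b" and cont: "continuous_on {a..b} d"
    and der: "\<And>s. a < s \<Longrightarrow> s < b \<Longrightarrow> (d has_real_derivative d' s) (at s)"
    and bd: "\<And>s. a < s \<Longrightarrow> s < b \<Longrightarrow> \<bar>d' s\<bar> \<le> K * \<bar>d s\<bar>"
  shows "\<bar>d b\<bar> \<le> exp (K * (b - a)) * \<bar>d a\<bar>" "\<bar>d a\<bar> \<le> exp (K * (b - a)) * \<bar>d b\<bar>"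
proof -
  have key: "\<bar>d s * d' s\<bar> \<le> K * (d s)\<^sup>2" if "a < s" "s < b" for s
    using mult_left_mono[OF bd[OF that], of "\<bar>d s\<bar>"]
    by (simp add: abs_mult power2_eq_square mult.assoc mult.left_commute)
  have dec: "exp (- (2 * K * (b - a))) * (d b)\<^sup>2 \<le> (d a)\<^sup>2"
  proof -
    have "exp (- (2 * K * (b - a))) * (d b)\<^sup>2 \<le> exp (- (2 * K * (a - a))) * (d a)\<^sup>2"
    proof (rule DERIV_nonpos_imp_decreasing_open[where f="\<lambda>s. exp (- (2 * K * (s - a))) * (d s)\<^sup>2"])
      fix s assume s: "a < s" "s < b"
      have "((\<lambda>s. exp (- (2 * K * (s - a))) * (d s)\<^sup>2) has_real_derivative
              exp (- (2 * K * (s - a))) * (2 * (d s * d' s - K * (d s)\<^sup>2))) (at s)"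
        by (auto intro!: derivative_eq_intros der s simp: algebra_simps)
      moreover have "exp (- (2 * K * (s - a))) * (2 * (d s * d' s - K * (d s)\<^sup>2)) \<le> 0"
        using key[OF s] by (intro mult_nonneg_nonpos) (auto simp: abs_le_iff)
      ultimately show "\<exists>y. ((\<lambda>s. exp (- (2 * K * (s - a))) * (d s)\<^sup>2) has_real_derivative y) (at s) \<and> y \<le> 0"
        by blast
    qed (use assms in \<open>auto intro!: continuous_intros\<close>)
    then show ?thesis by simp
  qed
  have inc: "(d a)\<^sup>2 \<le> exp (2 * K * (b - a)) * (d b)\<^sup>2"
  proof -
    have "exp (2 * K * (a - a)) * (d a)\<^sup>2 \<le> exp (2 * K * (b - a)) * (d b)\<^sup>2"
    proof (rule DERIV_nonneg_imp_increasing_open[where f="\<lambda>s. exp (2 * K * (s - a)) * (d s)\<^sup>2"])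
      fix s assume s: "a < s" "s < b"
      have "((\<lambda>s. exp (2 * K * (s - a)) * (d s)\<^sup>2) has_real_derivative
              exp (2 * K * (s - a)) * (2 * (d s * d' s + K * (d s)\<^sup>2))) (at s)"
        by (auto intro!: derivative_eq_intros der s simp: algebra_simps)
      moreover have "0 \<le> exp (2 * K * (s - a)) * (2 * (d s * d' s + K * (d s)\<^sup>2))"
        using key[OF s] by (intro mult_nonneg_nonneg) (auto simp: abs_le_iff)
      ultimately show "\<exists>y. ((\<lambda>s. exp (2 * K * (s - a)) * (d s)\<^sup>2) has_real_derivative y) (at s) \<and> 0 \<le> y"
        by blast
    qed (use assms in \<open>auto intro!: continuous_intros\<close>)
    then show ?thesis by simp
  qed
  have sq: "exp (2 * K * (b - a)) = (exp (K * (b - a)))\<^sup>2"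
    by (simp add: power2_eq_square mult_exp_exp)
  have "(d b)\<^sup>2 \<le> (exp (K * (b - a)))\<^sup>2 * (d a)\<^sup>2"
    using mult_left_mono[OF dec, of "exp (2 * K * (b - a))"]
    unfolding sq[symmetric] by (simp add: mult_exp_exp flip: mult.assoc)
  then show "\<bar>d b\<bar> \<le> exp (K * (b - a)) * \<bar>d a\<bar>"
    by (metis abs_exp_cancel abs_le_square_iff abs_mult abs_idempotent power_mult_distrib)
  show "\<bar>d a\<bar> \<le> exp (K * (b - a)) * \<bar>d b\<bar>"
    using inc unfolding sq
    by (metis abs_exp_cancel abs_le_square_iff abs_mult abs_idempotent power_mult_distrib)
qed

text \<open>Continuity in the base variable and a Lipschitz condition in the fibre are all that
  the leaves need; boundedness makes them global.\<close>

locale slope_field =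
  fixes f :: "real \<Rightarrow> real \<Rightarrow> real" and L M :: real
  assumes slope_cont: "continuous_on UNIV (\<lambda>z. f (fst z) (snd z))"
    and slope_lip: "\<And>x y y'. \<bar>f x y - f x y'\<bar> \<le> L * \<bar>y - y'\<bar>"
    and slope_bound: "\<And>x y. \<bar>f x y\<bar> \<le> M"
    and L_pos: "L > 0"
begin

definition solution :: "(real \<Rightarrow> real) \<Rightarrow> bool" where
  "solution y \<longleftrightarrow> (\<forall>x. (y has_real_derivative f x (y x)) (at x))"

lemma M_nonneg: "M \<ge> 0"
  using slope_bound[of 0 0] by linarith

lemma slope_cont_comp:
  assumes "continuous_on S u" "continuous_on S v"
  shows "continuous_on S (\<lambda>x. f (u x) (v x))"
  using continuous_on_compose2[OF slope_cont, of S "\<lambda>x. (u x, v x)"] assms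
  by (auto intro!: continuous_intros)

text \<open>Picard iteration for all times in one step: writing a solution as \<open>y0 + cosh (2 L (x - x0)) z x\<close> with
  \<open>z\<close> bounded, the integral operator contracts the sup norm of \<open>z\<close> by the factor \<open>1/2\<close>, since the
  weight grows twice as fast as solutions can separate.\<close>

lemma solution_exists: "\<exists>y. y x0 = y0 \<and> solution y"
proof -
  define c where "c x = cosh (2 * L * (x - x0))" for x
  define sh where "sh x = sinh (2 * L * (x - x0))" for x
  have c1: "c x \<ge> 1" for x by (simp add: c_def cosh_real_ge_1)
  have sh_le: "\<bar>sh x\<bar> \<le> c x" for x
    using sinh_le_cosh_real[of "\<bar>2 * L * (x - x0)\<bar>"]
    by (simp add: c_def sh_def)
  have sh_der: "(sh has_real_derivative 2 * L * c x) (at x)" for x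
    unfolding sh_def c_def by (auto intro!: derivative_eq_intros)
  have c_cont: "continuous_on S c" for S
    unfolding c_def by (auto intro!: continuous_intros)
  define Y where "Y z x = y0 + c x * apply_bcontfun z x" for z :: "real \<Rightarrow>\<^sub>C real" and x
  have Y_cont: "continuous_on S (Y z)" for S z
    unfolding Y_def by (auto intro!: continuous_intros c_cont)
  have "\<exists>F. F x0 = 0 \<and> (\<forall>u. (F has_real_derivative f u (Y z u)) (at u))" for z
    using antiderivative_real[OF slope_cont_comp[OF continuous_on_id Y_cont[of UNIV z]], of x0]
    by auto
  then obtain F where F0: "\<And>z. F z x0 = 0"
      and FD: "\<And>z u. (F z has_real_derivative f u (Y z u)) (at u)" by metis
  define T where "T z x = F z x / c x" for z x
  have TT: "T z \<in> bcontfun" for z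
  proof -
    have "\<bar>F z x\<bar> \<le> \<bar>M / (2 * L) * sh x\<bar>" for x
    proof (rule abs_le_of_deriv_dominated[OF FD])
      show "((\<lambda>x. M / (2 * L) * sh x) has_real_derivative M * c x) (at x)" for x
        using L_pos by (auto intro!: derivative_eq_intros sh_der)
      show "\<bar>f x (Y z x)\<bar> \<le> M * c x" for x
        using slope_bound[of x "Y z x"] mult_left_mono[OF c1[of x] M_nonneg] by simp
    qed (auto simp: F0 sh_def)
    also have "\<bar>M / (2 * L) * sh x\<bar> \<le> M / (2 * L) * c x" for x
      using L_pos M_nonneg sh_le[of x] by (simp add: abs_mult divide_right_mono mult_left_mono)
    finally have "\<bar>T z x\<bar> \<le> M / (2 * L)" for x
      using c1[of x] L_pos by (simp add: T_def field_simps)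
    moreover have "continuous_on UNIV (F z)"
      using FD DERIV_isCont continuous_at_imp_continuous_on by blast
    then have "continuous_on UNIV (T z)"
      unfolding T_def using c1 by (auto intro!: continuous_intros c_cont) (metis not_one_le_zero)
    ultimately show ?thesis
      by (intro bcontfun_normI[where b="M / (2 * L)"]) (simp_all only: real_norm_def)
  qed
  define \<Theta> where "\<Theta> z = Bcontfun (T z)" for z
  have \<Theta>: "apply_bcontfun (\<Theta> z) = T z" for z
    unfolding \<Theta>_def using TT Bcontfun_inverse by blast
  have "\<exists>!z. \<Theta> z = z"
  proof (rule banach_fix_type[of "1/2"])
    show "\<forall>z w. dist (\<Theta> z) (\<Theta> w) \<le> 1 / 2 * dist z w"
    proof (intro allI dist_bound)
      fix z w x
      have "\<bar>F z x - F w x\<bar> \<le> \<bar>dist z w / 2 * sh x\<bar>"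
      proof (rule abs_le_of_deriv_dominated[where g="\<lambda>x. F z x - F w x" and H="\<lambda>x. dist z w / 2 * sh x"])
        show "((\<lambda>x. F z x - F w x) has_real_derivative f x (Y z x) - f x (Y w x)) (at x)" for x
          by (auto intro!: derivative_eq_intros FD)
        show "((\<lambda>x. dist z w / 2 * sh x) has_real_derivative L * (c x * dist z w)) (at x)" for x
          by (auto intro!: derivative_eq_intros sh_der)
        show "\<bar>f x (Y z x) - f x (Y w x)\<bar> \<le> L * (c x * dist z w)" for x
        proof -
          have "\<bar>Y z x - Y w x\<bar> = c x * dist (z x) (w x)"
            using c1[of x] by (simp add: Y_def dist_real_def abs_mult flip: right_diff_distrib)
          also have "\<dots> \<le> c x * dist z w"
            using c1[of x] dist_bounded[of z x w] by (intro mult_left_mono) auto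
          finally show ?thesis
            using slope_lip[of x "Y z x" "Y w x"] L_pos by (meson mult_left_mono order_trans less_imp_le)
        qed
      qed (auto simp: F0 sh_def)
      also have "\<dots> \<le> dist z w / 2 * c x"
        using sh_le[of x] by (simp add: abs_mult mult_left_mono)
      finally have "\<bar>F z x - F w x\<bar> \<le> dist z w / 2 * c x" .
      then show "dist (\<Theta> z x) (\<Theta> w x) \<le> 1 / 2 * dist z w"
        using c1[of x] by (simp add: \<Theta> T_def dist_real_def field_simps flip: diff_divide_distrib)
    qed
  qed auto
  then obtain z where z: "\<Theta> z = z" by blast
  have "Y z x = y0 + F z x" for x
    using \<Theta>[of z] c1[of x] unfolding z by (auto simp: Y_def T_def)
  then have Yeq: "Y z = (\<lambda>x. y0 + F z x)" by auto
  have "solution (Y z)"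
    unfolding solution_def
  proof
    fix x
    have "((\<lambda>x. y0 + F z x) has_real_derivative f x (Y z x)) (at x)"
      by (auto intro!: derivative_eq_intros FD)
    then show "(Y z has_real_derivative f x (Y z x)) (at x)" using Yeq by simp
  qed
  moreover have "Y z x0 = y0" by (simp add: Yeq F0)
  ultimately show ?thesis by blast
qed

lemma solution_cont: "solution y \<Longrightarrow> continuous_on S y"
  unfolding solution_def using DERIV_isCont continuous_at_imp_continuous_on by blast

lemma solutions_close:
  assumes "solution u" "solution v"
  shows "\<bar>u b - v b\<bar> \<le> exp (L * \<bar>b - a\<bar>) * \<bar>u a - v a\<bar>"
proof -
  have cont: "continuous_on S (\<lambda>x. u x - v x)" for S
    using assms by (intro continuous_intros solution_cont)
  have der: "((\<lambda>x. u x - v x) has_real_derivative f x (u x) - f x (v x)) (at x)" for x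
    using assms by (auto simp: solution_def intro!: derivative_eq_intros)
  show ?thesis
    using Gronwall_both(1)[of a b, OF _ cont der slope_lip] Gronwall_both(2)[of b a, OF _ cont der slope_lip]
    by (cases "a \<le> b") auto
qed

lemma solution_unique: "solution u \<Longrightarrow> solution v \<Longrightarrow> u a = v a \<Longrightarrow> u = v"
  using solutions_close[of u v _ a] by (intro ext) simp

text \<open>Two solutions that change their order meet, and then they coincide.\<close>

lemma solutions_ordered:
  assumes "solution u" "solution v" "u a < v a"
  shows "u b < v b"
proof (rule ccontr)
  assume "\<not> u b < v b"
  let ?d = "\<lambda>x. v x - u x"
  have cont: "continuous_on S ?d" for S
    using assms by (intro continuous_intros solution_cont)
  have "\<exists>c. ?d c = 0"
    using IVT'[of ?d b 0 a] IVT2'[of ?d b 0 a] cont \<open>\<not> u b < v b\<close> \<open>u a < v a\<close>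
    by (cases "a \<le> b") (auto simp: not_less)
  then obtain c where "u c = v c" by (metis eq_iff_diff_eq_0)
  then have "u = v" using solution_unique[OF assms(1,2)] by blast
  then show False using assms(3) by simp
qed

definition leaf :: "real \<Rightarrow> real \<Rightarrow> real \<Rightarrow> real" where
  "leaf x0 y0 = (SOME y. y x0 = y0 \<and> solution y)"

text \<open>The label is the ordinate at which the leaf through \<open>(x, y)\<close> crosses the line \<open>x = 0\<close>; it is a
  continuous first integral of the slope field.\<close>

definition label :: "real \<Rightarrow> real \<Rightarrow> real" where
  "label x y = leaf x y 0"

lemma leaf: "leaf x0 y0 x0 = y0" "solution (leaf x0 y0)"
  using someI_ex[OF solution_exists[of x0 y0]] by (auto simp: leaf_def)

lemma leaf_unique: "solution u \<Longrightarrow> u x0 = y0 \<Longrightarrow> leaf x0 y0 = u"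
  using solution_unique leaf by blast

lemma label_solution: "solution u \<Longrightarrow> label x (u x) = u 0"
  by (simp add: label_def leaf_unique)

lemma leaf_label: "leaf 0 (label x y) x = y"
  by (metis label_def leaf(1) leaf(2) leaf_unique)

lemma label_0: "label 0 y = y"
  by (simp add: label_def leaf)

lemma label_less: "y < y' \<Longrightarrow> label x y < label x y'"
  unfolding label_def by (rule solutions_ordered[of _ _ x]) (auto simp: leaf)

lemma solution_lipschitz:
  assumes "solution u"
  shows "\<bar>u b - u a\<bar> \<le> M * \<bar>b - a\<bar>"
proof -
  have "\<bar>u b - u a\<bar> \<le> \<bar>M * (b - a)\<bar>"
    by (rule abs_le_of_deriv_dominated[where g="\<lambda>x. u x - u a" and g'="\<lambda>x. f x (u x)"
          and H="\<lambda>x. M * (x - a)" and H'="\<lambda>_. M" and ?x0.0=a])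
       (use assms slope_bound in \<open>auto simp: solution_def intro!: derivative_eq_intros\<close>)
  then show ?thesis using M_nonneg by (simp add: abs_mult)
qed

text \<open>The leaf through \<open>(x, y)\<close> meets the vertical line over \<open>x'\<close> at height within \<open>M \<bar>x - x'\<bar>\<close> of \<open>y\<close>; from there on
  Gronwall's bound applies.\<close>

lemma label_close: "\<bar>label x y - label x' y'\<bar> \<le> exp (L * \<bar>x'\<bar>) * (\<bar>y - y'\<bar> + M * \<bar>x - x'\<bar>)"
proof -
  have "\<bar>label x y - label x' y'\<bar> \<le> exp (L * \<bar>0 - x'\<bar>) * \<bar>leaf x y x' - leaf x' y' x'\<bar>"
    unfolding label_def by (rule solutions_close) (auto simp: leaf)
  also have "\<bar>leaf x y x' - leaf x' y' x'\<bar> \<le> \<bar>y - y'\<bar> + M * \<bar>x - x'\<bar>"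
    using solution_lipschitz[OF leaf(2), of x y x' x] by (simp add: leaf abs_minus_commute)
  finally show ?thesis by (simp add: mult_left_mono)
qed

lemma label_cont: "continuous_on UNIV (\<lambda>z. label (fst z) (snd z))"
proof -
  have "((\<lambda>z. label (fst z) (snd z)) \<longlongrightarrow> label x' y') (at (x', y'))" for x' y'
  proof (rule LIM_zero_cancel, rule Lim_null_comparison)
    show "\<forall>\<^sub>F z in at (x', y'). norm (label (fst z) (snd z) - label x' y')
        \<le> exp (L * \<bar>x'\<bar>) * (\<bar>snd z - y'\<bar> + M * \<bar>fst z - x'\<bar>)"
      using label_close by (simp add: always_eventually)
    show "((\<lambda>z. exp (L * \<bar>x'\<bar>) * (\<bar>snd z - y'\<bar> + M * \<bar>fst z - x'\<bar>)) \<longlongrightarrow> 0) (at (x', y'))"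
      by (auto intro!: tendsto_eq_intros)
  qed
  then show ?thesis by (auto simp: continuous_on_def)
qed

text \<open>A tangent curve is compared with the leaf through its starting point. The vertical distance
  \<open>d\<close> satisfies \<open>\<bar>d'\<bar> \<le> L B \<bar>d\<bar>\<close> and starts at \<open>0\<close>. This replaces the differentiability of the label,
  which would require differentiable dependence on initial values.\<close>

lemma label_const_along_curve:
  assumes "a \<le> b" and cx: "continuous_on {a..b} x" and cy: "continuous_on {a..b} y"
    and dx: "\<And>s. a < s \<Longrightarrow> s < b \<Longrightarrow> (x has_real_derivative x' s) (at s)"
    and dy: "\<And>s. a < s \<Longrightarrow> s < b \<Longrightarrow> (y has_real_derivative f (x s) (y s) * x' s) (at s)"
    and bd: "\<And>s. a < s \<Longrightarrow> s < b \<Longrightarrow> \<bar>x' s\<bar> \<le> B"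
  shows "label (x a) (y a) = label (x b) (y b)"
proof -
  define u where "u = leaf (x a) (y a)"
  have u: "solution u" "u (x a) = y a" by (auto simp: u_def leaf)
  have ucont: "continuous_on S u" for S using u solution_cont by blast
  have "\<bar>y b - u (x b)\<bar> \<le> exp (L * B * (b - a)) * \<bar>y a - u (x a)\<bar>"
  proof (rule Gronwall_both(1)[OF \<open>a \<le> b\<close>, where d="\<lambda>s. y s - u (x s)"
          and d'="\<lambda>s. f (x s) (y s) * x' s - f (x s) (u (x s)) * x' s"])
    show "continuous_on {a..b} (\<lambda>s. y s - u (x s))"
      by (intro continuous_intros cy continuous_on_compose2[OF ucont[of UNIV] cx]) auto
    fix s assume s: "a < s" "s < b"
    show "((\<lambda>s. y s - u (x s)) has_real_derivative f (x s) (y s) * x' s - f (x s) (u (x s)) * x' s) (at s)"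
      using u(1) by (intro DERIV_diff dy s DERIV_chain2[OF _ dx[OF s]]) (auto simp: solution_def)
    have "\<bar>f (x s) (y s) * x' s - f (x s) (u (x s)) * x' s\<bar> = \<bar>f (x s) (y s) - f (x s) (u (x s))\<bar> * \<bar>x' s\<bar>"
      by (simp add: abs_mult left_diff_distrib flip: abs_mult)
    also have "\<dots> \<le> (L * \<bar>y s - u (x s)\<bar>) * B"
      using slope_lip bd[OF s] L_pos by (intro mult_mono) auto
    finally show "\<bar>f (x s) (y s) * x' s - f (x s) (u (x s)) * x' s\<bar> \<le> L * B * \<bar>y s - u (x s)\<bar>"
      by (simp add: mult_ac)
  qed
  then have "y b = u (x b)" using u(2) by simp
  then show ?thesis using label_solution[OF u(1)] u(2) by metis
qed

text \<open>Feet on the line \<open>y = 0\<close>: the function \<open>x \<mapsto> label x 0\<close> inherits from the slopes bounds on its growth and,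
  if they have a sign, its monotonicity.\<close>

lemma foot_bounds:
  assumes f: "\<And>x y. m1 \<le> f x y \<and> f x y \<le> m2"
  shows "x \<ge> 0 \<Longrightarrow> - m2 * x \<le> label x 0 \<and> label x 0 \<le> - m1 * x"
    and "x \<le> 0 \<Longrightarrow> - m1 * x \<le> label x 0 \<and> label x 0 \<le> - m2 * x"
proof -
  define u where "u = leaf x 0"
  have u: "solution u" "u x = 0" by (auto simp: u_def leaf)
  have inc: "u b - m1 * b \<ge> u a - m1 * a" "u b - m2 * b \<le> u a - m2 * a" if "a \<le> b" for a b
  proof -
    have D: "((\<lambda>x. u x - m * x) has_real_derivative f x (u x) - m) (at x)" for m x
      using u(1) by (auto simp: solution_def intro!: derivative_eq_intros)
    show "u b - m1 * b \<ge> u a - m1 * a"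
      by (rule DERIV_nonneg_imp_nondecreasing[OF that, where f="\<lambda>x. u x - m1 * x"])
         (use D f in fastforce)
    show "u b - m2 * b \<le> u a - m2 * a"
      by (rule DERIV_nonpos_imp_nonincreasing[OF that, where f="\<lambda>x. u x - m2 * x"])
         (use D f in fastforce)
  qed
  show "x \<ge> 0 \<Longrightarrow> - m2 * x \<le> label x 0 \<and> label x 0 \<le> - m1 * x"
    using inc[of 0 x] u(2) by (simp add: label_def flip: u_def)
  show "x \<le> 0 \<Longrightarrow> - m1 * x \<le> label x 0 \<and> label x 0 \<le> - m2 * x"
    using inc[of x 0] u(2) by (simp add: label_def flip: u_def)
qed

lemma foot_less:
  assumes "\<And>x y. f x y < 0" "x1 < x2"
  shows "label x1 0 < label x2 0"
proof -
  define u where "u = leaf x1 0"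
  have u: "solution u" "u x1 = 0" by (auto simp: u_def leaf)
  have "u x2 < u x1"
    by (rule DERIV_neg_imp_decreasing[OF \<open>x1 < x2\<close>]) (use u assms in \<open>auto simp: solution_def\<close>)
  then have "label x2 (u x2) < label x2 0" using u label_less by simp
  moreover have "label x2 (u x2) = label x1 0" using label_solution[OF u(1)] u(2) by metis
  ultimately show ?thesis by simp
qed

lemma foot_greater:
  assumes "\<And>x y. f x y > 0" "x1 < x2"
  shows "label x1 0 > label x2 0"
proof -
  define u where "u = leaf x1 0"
  have u: "solution u" "u x1 = 0" by (auto simp: u_def leaf)
  have "u x2 > u x1"
    by (rule DERIV_pos_imp_increasing[OF \<open>x1 < x2\<close>]) (use u assms in \<open>auto simp: solution_def\<close>)
  then have "label x2 (u x2) > label x2 0" using u label_less by simp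
  moreover have "label x2 (u x2) = label x1 0" using label_solution[OF u(1)] u(2) by metis
  ultimately show ?thesis by simp
qed

lemma label_cont_comp:
  assumes "continuous_on S u" "continuous_on S v"
  shows "continuous_on S (\<lambda>x. label (u x) (v x))"
  using continuous_on_compose2[OF label_cont, of S "\<lambda>x. (u x, v x)"] assms
  by (auto intro!: continuous_intros)

end

section \<open>Time parametrizations and local-to-global principles on an interval\<close>

text \<open>The time needed to reach \<open>u\<close> is an antiderivative of \<open>1 / \<psi>\<close>; the motion is its inverse.\<close>

lemma autonomous_flow:
  fixes \<psi> :: "real \<Rightarrow> real"
  assumes cont: "continuous_on UNIV \<psi>" and "m > 0" and bd: "\<And>u. m \<le> \<psi> u \<and> \<psi> u \<le> M"
  obtains R where "R 0 = 0" "\<And>s. (R has_real_derivative \<psi> (R s)) (at s)" "strict_mono R" "surj R"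
proof -
  have pos: "\<psi> u > 0" for u using bd[of u] \<open>m > 0\<close> by linarith
  have M: "M > 0" using bd[of 0] \<open>m > 0\<close> by linarith
  have "continuous_on UNIV (\<lambda>u. 1 / \<psi> u)"
    using pos by (intro continuous_intros cont) (metis less_irrefl)
  then obtain F where F0: "F 0 = 0" and FD: "\<And>u. (F has_real_derivative 1 / \<psi> u) (at u)"
    using antiderivative_real[of "\<lambda>u. 1 / \<psi> u" 0] by blast
  have F_mono: "F a < F b" if "a < b" for a b
    by (rule DERIV_pos_imp_increasing[OF that]) (use FD pos in \<open>blast intro: divide_pos_pos zero_less_one\<close>)
  then have sm: "strict_mono F" by (simp add: strict_mono_def)
  have F_cont: "continuous_on S F" for S
    using FD DERIV_isCont continuous_at_imp_continuous_on by blast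
  have grow: "b / M - F b \<le> a / M - F a" if "a \<le> b" for a b
  proof (rule DERIV_nonpos_imp_nonincreasing[OF that, where f="\<lambda>u. u / M - F u"])
    fix x
    have "((\<lambda>u. u / M - F u) has_real_derivative 1 / M - 1 / \<psi> x) (at x)"
      using M by (auto intro!: derivative_eq_intros FD)
    moreover have "1 / M - 1 / \<psi> x \<le> 0"
      using bd[of x] pos[of x] M by (simp add: frac_le)
    ultimately show "\<exists>y. ((\<lambda>u. u / M - F u) has_real_derivative y) (at x) \<and> y \<le> 0" by blast
  qed
  have "\<exists>u. F u = s" for s
  proof -
    have 1: "s \<le> F (M * \<bar>s\<bar>)" using grow[of 0 "M * \<bar>s\<bar>"] F0 M by simp
    have 2: "F (- (M * \<bar>s\<bar>)) \<le> s" using grow[of "- (M * \<bar>s\<bar>)" 0] F0 M by simp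
    show ?thesis
      using IVT'[of F "- (M * \<bar>s\<bar>)" s "M * \<bar>s\<bar>", OF 2 1 _ F_cont] M by auto
  qed
  then have "surj F" by (metis surjI surj_def)
  then have bij: "bij F" using sm strict_mono_imp_inj_on by (auto simp: bij_def)
  define R where "R = inv F"
  have FR: "F (R s) = s" and RF: "R (F u) = u" for s u
    using bij by (auto simp: R_def bij_is_surj bij_is_inj surj_f_inv_f)
  have R_mono: "strict_mono R"
    unfolding strict_mono_def by (metis FR sm strict_mono_less)
  have surjR: "surj R" by (metis RF surjI)
  have R_cont: "continuous_on UNIV R"
    using R_mono surjR by (intro continuous_onI_mono) (auto simp: strict_mono_less_eq)
  have RD: "(R has_real_derivative \<psi> (R s)) (at s)" for s
  proof -
    have "DERIV R s :> inverse (1 / \<psi> (R s))"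
      by (rule DERIV_inverse_function[OF FD, where a="s - 1" and b="s + 1"])
         (use FR R_cont pos[of "R s"] in \<open>auto simp: continuous_on_eq_continuous_at\<close>)
    then show ?thesis by simp
  qed
  show ?thesis
    using that[of R] RD R_mono surjR F0 RF[of 0] by simp
qed

lemma interval_subset:
  fixes I :: "real set"
  assumes "is_interval I" "a \<in> I" "b \<in> I"
  shows "{a..b} \<subseteq> I"
  using assms unfolding is_interval_1 by (meson atLeastAtMost_iff subsetI)

lemma strict_mono_on_if_locally_increasing:
  fixes u :: "real \<Rightarrow> real"
  assumes I: "is_interval I"
    and loc: "\<And>t. t \<in> I \<Longrightarrow> \<forall>\<^sub>F s in at t within I. (t < s \<longrightarrow> u t < u s) \<and> (s < t \<longrightarrow> u s < u t)"
  shows "strict_mono_on I u"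
proof (rule strict_mono_onI)
  fix a b assume ab: "a \<in> I" "b \<in> I" "a < b"
  have sub: "{a..b} \<subseteq> I"
    using interval_subset[OF I] ab by blast
  have "a \<le> b" using ab by simp
  then have "{a..b} \<subseteq> {a..b} \<longrightarrow> a < b \<longrightarrow> u a < u b"
  proof (induction rule: Bolzano[where P="\<lambda>c d. {c..d} \<subseteq> {a..b} \<longrightarrow> c < d \<longrightarrow> u c < u d"])
    case (trans p q r)
    show ?case
    proof (intro impI)
      assume h: "{p..r} \<subseteq> {a..b}" "p < r"
      have "{p..q} \<subseteq> {a..b}" "{q..r} \<subseteq> {a..b}"
        using h(1) trans(3,4) by (meson atLeastatMost_subset_iff order_refl order_trans)+
      then have "p < q \<longrightarrow> u p < u q" "q < r \<longrightarrow> u q < u r"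
        using trans(1,2) by blast+
      then show "u p < u r" using h trans(3,4) by (cases "p = q"; cases "q = r") auto
    qed
  next
    case (local x)
    then have "x \<in> I" using sub by auto
    then obtain d where d: "d > 0"
      and D: "\<And>s. s \<in> I \<Longrightarrow> s \<noteq> x \<Longrightarrow> dist s x < d \<Longrightarrow> (x < s \<longrightarrow> u x < u s) \<and> (s < x \<longrightarrow> u s < u x)"
      using loc[of x] unfolding eventually_at by blast
    have "u c < u e" if h: "c \<le> x" "x \<le> e" "e - c < d" "{c..e} \<subseteq> {a..b}" "c < e" for c e
    proof -
      have "c \<in> I" "e \<in> I" using h sub by auto
      moreover have "dist c x < d" "dist e x < d" using h by (auto simp: dist_real_def)
      ultimately have "c = x \<or> u c < u x" "e = x \<or> u x < u e"
        using D[of c] D[of e] h by fastforce+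
      then show ?thesis using h by auto
    qed
    with d show ?case by blast
  qed
  then show "u a < u b" using ab by simp
qed

lemma constant_on_if_locally_constant:
  fixes u :: "real \<Rightarrow> 'a"
  assumes I: "is_interval I"
    and loc: "\<And>t. t \<in> I \<Longrightarrow> \<forall>\<^sub>F s in at t within I. u s = u t"
    and ab: "a \<in> I" "b \<in> I"
  shows "u a = u b"
proof -
  have *: "u a = u b" if ab: "a \<in> I" "b \<in> I" "a \<le> b" for a b
  proof -
    have sub: "{a..b} \<subseteq> I"
      using interval_subset[OF I] ab by blast
    have "{a..b} \<subseteq> {a..b} \<longrightarrow> u a = u b"
      using \<open>a \<le> b\<close>
    proof (induction rule: Bolzano[where P="\<lambda>c d. {c..d} \<subseteq> {a..b} \<longrightarrow> u c = u d"])
      case (trans p q r)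
      show ?case
      proof
        assume h: "{p..r} \<subseteq> {a..b}"
        have "{p..q} \<subseteq> {a..b}" "{q..r} \<subseteq> {a..b}"
          using h trans(3,4) by (meson atLeastatMost_subset_iff order_refl order_trans)+
        then show "u p = u r" using trans(1,2) by metis
      qed
    next
      case (local x)
      then have "x \<in> I" using sub by auto
      then obtain d where d: "d > 0"
        and D: "\<And>s. s \<in> I \<Longrightarrow> s \<noteq> x \<Longrightarrow> dist s x < d \<Longrightarrow> u s = u x"
        using loc[of x] unfolding eventually_at by blast
      have "u c = u e" if h: "c \<le> x" "x \<le> e" "e - c < d" "{c..e} \<subseteq> {a..b}" for c e
      proof -
        have "c \<in> I" "e \<in> I" using h sub by auto
        moreover have "dist c x < d" "dist e x < d" using h by (auto simp: dist_real_def)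
        ultimately show ?thesis using D[of c] D[of e] by metis
      qed
      with d show ?case by blast
    qed
    then show ?thesis by simp
  qed
  then show ?thesis using ab by (metis linear)
qed

text \<open>For one-sided derivatives one of the two implications is vacuous near \<open>t\<close>.\<close>

lemma eventually_increasing_if_deriv_pos:
  fixes u :: "real \<Rightarrow> real"
  assumes "(u has_real_derivative l) (at t within S)" "l > 0"
  shows "\<forall>\<^sub>F s in at t within S. (t < s \<longrightarrow> u t < u s) \<and> (s < t \<longrightarrow> u s < u t)"
proof -
  obtain d1 where d1: "d1 > 0" "\<And>h. h > 0 \<Longrightarrow> t + h \<in> S \<Longrightarrow> h < d1 \<Longrightarrow> u t < u (t + h)"
    using has_real_derivative_pos_inc_right[OF assms] by blast
  obtain d2 where d2: "d2 > 0" "\<And>h. h > 0 \<Longrightarrow> t - h \<in> S \<Longrightarrow> h < d2 \<Longrightarrow> u (t - h) < u t"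
    using has_real_derivative_pos_inc_left[OF assms] by blast
  have "(t < s \<longrightarrow> u t < u s) \<and> (s < t \<longrightarrow> u s < u t)" if "s \<in> S" "dist s t < min d1 d2" for s
    using d1(2)[of "s - t"] d2(2)[of "t - s"] that by (auto simp: dist_real_def)
  then show ?thesis
    unfolding eventually_at using d1(1) d2(1) by (intro exI[of _ "min d1 d2"]) auto
qed

section \<open>Linearizing a decreasing contraction\<close>

text \<open>An odd increasing homeomorphism onto \<open>(-1, 1)\<close> that lies below the identity in absolute value.\<close>

definition squash :: "real \<Rightarrow> real" where
  "squash u = u / (1 + \<bar>u\<bar>)"

lemma squash_props:
  "squash (- u) = - squash u" "\<bar>squash u\<bar> \<le> 1" "\<bar>squash u\<bar> \<le> \<bar>u\<bar>" "u < v \<Longrightarrow> squash u < squash v"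
  "continuous_on S squash"
proof -
  show "squash (- u) = - squash u" by (simp add: squash_def)
  show "\<bar>squash u\<bar> \<le> 1" by (simp add: squash_def field_simps)
  show "\<bar>squash u\<bar> \<le> \<bar>u\<bar>" by (simp add: squash_def field_simps)
  show "continuous_on S squash"
  proof -
    have "1 + \<bar>x\<bar> \<noteq> 0" for x :: real using abs_ge_zero[of x] by linarith
    then show ?thesis unfolding squash_def by (intro continuous_intros) auto
  qed
  assume "u < v"
  then have "u * (1 + \<bar>v\<bar>) < v * (1 + \<bar>u\<bar>)"
  proof (cases "0 \<le> u \<or> v \<le> 0")
    case True
    then show ?thesis using \<open>u < v\<close> by (auto simp: algebra_simps abs_if)
  next
    case False
    then have "u * (1 + \<bar>v\<bar>) < 0" "0 < v * (1 + \<bar>u\<bar>)"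
      by (auto simp: mult_less_0_iff zero_less_mult_iff)
    then show ?thesis by linarith
  qed
  then show "squash u < squash v" by (simp add: squash_def pos_divide_less_eq pos_less_divide_eq add_pos_nonneg)
qed

text \<open>Averaging over the orbit: the two-sided series \<open>\<Sum>n. (-2)\<^sup>n \<phi> (D\<^sup>n w)\<close>, with \<open>n\<close> running through the integers,
  is multiplied by \<open>-1/2\<close> under \<open>D\<close>. Both \<open>D\<^sup>n\<close> and \<open>(-2)\<^sup>n\<close> reverse the order for odd \<open>n\<close>, so every term
  is increasing when \<open>\<phi>\<close> is, and the term \<open>n = 0\<close> makes the sum strictly increasing. The series
  converges for negative \<open>n\<close> because \<open>\<phi>\<close> is bounded, and for positive \<open>n\<close> because \<open>\<phi>\<close> vanishes at \<open>0\<close> to an order \<open>p\<close> with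
  \<open>2 q\<^sup>p < 1\<close>.\<close>

lemma decreasing_contraction_conjugacy:
  fixes D C :: "real \<Rightarrow> real"
  assumes D_dec: "\<And>x y. x < y \<Longrightarrow> D y < D x" and CD: "\<And>x. C (D x) = x" and DC: "\<And>x. D (C x) = x"
    and q: "0 \<le> q" "q < 1" and contr: "\<And>w. \<bar>D w\<bar> \<le> q * \<bar>w\<bar>"
  obtains \<kappa> :: "real \<Rightarrow> real" where "continuous_on UNIV \<kappa>" "strict_mono \<kappa>" "\<kappa> 0 = 0" "\<And>w. \<kappa> (D w) = - \<kappa> w / 2"
proof -
  have C_dec: "C y < C x" if "x < y" for x y
    using D_dec[of "C x" "C y"] DC that by (metis D_dec less_asym not_less_iff_gr_or_eq)
  have D_cont: "continuous_on UNIV D"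
  proof -
    have "surj (\<lambda>x. - D x)" by (rule surjI[of _ "\<lambda>x. C (- x)"]) (simp add: DC)
    moreover have "- D x \<le> - D y" if "x \<le> y" for x y using D_dec[of x y] that by (cases "x = y") auto
    ultimately have "continuous_on UNIV (\<lambda>x. - D x)" by (intro continuous_onI_mono) auto
    from continuous_on_minus[OF this] show ?thesis by simp
  qed
  have C_cont: "continuous_on UNIV C"
  proof -
    have "surj (\<lambda>x. - C x)" by (rule surjI[of _ "\<lambda>x. D (- x)"]) (simp add: CD)
    moreover have "- C x \<le> - C y" if "x \<le> y" for x y using C_dec[of x y] that by (cases "x = y") auto
    ultimately have "continuous_on UNIV (\<lambda>x. - C x)" by (intro continuous_onI_mono) auto
    from continuous_on_minus[OF this] show ?thesis by simp
  qed
  have D0: "D 0 = 0" using contr[of 0] by simp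
  have C0: "C 0 = 0" using CD[of 0] D0 by simp
  obtain p0 where "q ^ p0 < 1 / 2" using real_arch_pow_inv[of "1/2" q] q by auto
  \<comment> \<open>An odd exponent, so that \<open>w ^ p\<close> is odd and increasing.\<close>
  define p where "p = 2 * p0 + 1"
  have p: "odd p" "2 * q ^ p < 1"
  proof -
    have "q ^ p \<le> q ^ p0" using q by (intro power_decreasing) (auto simp: p_def)
    with \<open>q ^ p0 < 1/2\<close> show "2 * q ^ p < 1" by simp
  qed (simp add: p_def)
  define \<phi> where "\<phi> w = squash (w ^ p)" for w :: real
  have \<phi>_odd: "\<phi> (- w) = - \<phi> w" for w
    using p(1) by (simp add: \<phi>_def squash_props)
  have \<phi>_mono: "\<phi> v < \<phi> w" if "v < w" for v w
  proof -
    have "v ^ p \<le> w ^ p" using power_mono_odd[OF p(1), of v w] that by linarith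
    moreover have "v ^ p \<noteq> w ^ p" using odd_real_root_power_cancel[OF p(1)] that by (metis less_irrefl)
    ultimately show ?thesis unfolding \<phi>_def by (intro squash_props) simp
  qed
  have \<phi>_le: "\<phi> v \<le> \<phi> w" if "v \<le> w" for v w using \<phi>_mono that by (metis le_less)
  have \<phi>0: "\<phi> 0 = 0" using \<phi>_odd[of 0] by simp
  have \<phi>_cont: "continuous_on S \<phi>" for S
    unfolding \<phi>_def by (intro continuous_on_compose2[OF squash_props(5)[of UNIV]] continuous_intros) auto
  have D_pow: "\<bar>(D ^^ n) w\<bar> \<le> q ^ n * \<bar>w\<bar>" for n w
  proof (induction n)
    case (Suc n)
    then show ?case using contr[of "(D ^^ n) w"] mult_left_mono[OF Suc q(1)] by (simp add: mult.assoc)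
  qed simp
  have pow_cont: "continuous_on UNIV (D ^^ n)" "continuous_on UNIV (C ^^ n)" for n
  proof (induction n)
    case (Suc n)
    { case 1 show ?case using continuous_on_compose2[OF D_cont Suc(1)] by (simp add: o_def) }
    { case 2 show ?case using continuous_on_compose2[OF C_cont Suc(2)] by (simp add: o_def) }
  qed (auto simp: id_def)
  define a where "a n w = (-2) ^ n * \<phi> ((D ^^ n) w)" for n w
  \<comment> \<open>The terms with index \<open>-n\<close>.\<close>
  define b where "b n w = (-1/2) ^ n * \<phi> ((C ^^ n) w)" for n w
  have a_cont: "continuous_on UNIV (a n)" for n
    unfolding a_def by (intro continuous_intros continuous_on_compose2[OF \<phi>_cont[of UNIV] pow_cont(1)]) auto
  have b_cont: "continuous_on UNIV (b n)" for n
    unfolding b_def by (intro continuous_intros continuous_on_compose2[OF \<phi>_cont[of UNIV] pow_cont(2)]) auto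
  have a_bd: "\<bar>a n w\<bar> \<le> (2 * q ^ p) ^ n * \<bar>w\<bar> ^ p" for n w
  proof -
    have "\<bar>\<phi> ((D ^^ n) w)\<bar> \<le> \<bar>(D ^^ n) w\<bar> ^ p"
      unfolding \<phi>_def by (metis power_abs squash_props(3))
    also have "\<dots> \<le> (q ^ n * \<bar>w\<bar>) ^ p" using D_pow by (intro power_mono) auto
    finally have "2 ^ n * \<bar>\<phi> ((D ^^ n) w)\<bar> \<le> 2 ^ n * (q ^ n * \<bar>w\<bar>) ^ p" by simp
    also have "\<dots> = (2 * q ^ p) ^ n * \<bar>w\<bar> ^ p"
      by (simp add: power_mult_distrib mult.commute flip: power_mult)
    finally show ?thesis by (simp add: a_def abs_mult power_abs)
  qed
  have b_bd: "\<bar>b n w\<bar> \<le> (1/2) ^ n" for n w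
    using squash_props(2) by (simp add: b_def \<phi>_def abs_mult power_abs mult_left_le)
  have a_sum: "summable (\<lambda>n. a n w)" for w
  proof (rule summable_comparison_test')
    show "summable (\<lambda>n. (2 * q ^ p) ^ n * \<bar>w\<bar> ^ p)"
      using p(2) q by (intro summable_mult2 summable_geometric) auto
    show "norm (a n w) \<le> (2 * q ^ p) ^ n * \<bar>w\<bar> ^ p" for n using a_bd by simp
  qed
  have b_sum: "summable (\<lambda>n. b n w)" for w
  proof (rule summable_comparison_test')
    show "summable (\<lambda>n. (1/2::real) ^ n)" by (rule summable_geometric) auto
    show "norm (b n w) \<le> (1/2) ^ n" for n using b_bd by simp
  qed
  have a_inc: "a n v \<le> a n w" if "v \<le> w" for n v w
  proof -
    have "(even n \<longrightarrow> (D ^^ n) v \<le> (D ^^ n) w) \<and> (odd n \<longrightarrow> (D ^^ n) w \<le> (D ^^ n) v)"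
    proof (induction n)
      case (Suc n)
      have "D y \<le> D x" if "x \<le> y" for x y using D_dec[of x y] that by (cases "x = y") auto
      with Suc show ?case by simp
    qed (use that in simp)
    then show ?thesis
      using \<phi>_le by (cases "even n") (auto simp: a_def)
  qed
  have b_inc: "b n v \<le> b n w" if "v \<le> w" for n v w
  proof -
    have "(even n \<longrightarrow> (C ^^ n) v \<le> (C ^^ n) w) \<and> (odd n \<longrightarrow> (C ^^ n) w \<le> (C ^^ n) v)"
    proof (induction n)
      case (Suc n)
      have "C y \<le> C x" if "x \<le> y" for x y using C_dec[of x y] that by (cases "x = y") auto
      with Suc show ?case by simp
    qed (use that in simp)
    then show ?thesis
      using \<phi>_le by (cases "even n") (auto simp: b_def mult_left_mono mult_left_mono_neg)
  qed
  define \<kappa> where "\<kappa> w = (\<Sum>n. a n w) + (\<Sum>n. b (Suc n) w)" for w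
  have bS_sum: "summable (\<lambda>n. b (Suc n) w)" for w using b_sum summable_Suc_iff[of "\<lambda>n. b n w"] by simp
  have "\<kappa> v < \<kappa> w" if "v < w" for v w
  proof -
    have "(\<Sum>n. a (Suc n) v) \<le> (\<Sum>n. a (Suc n) w)"
      using that by (intro suminf_le a_inc) (auto simp: summable_Suc_iff[of "\<lambda>n. a n _"] a_sum)
    moreover have "(\<Sum>n. b (Suc n) v) \<le> (\<Sum>n. b (Suc n) w)"
      using that by (intro suminf_le b_inc bS_sum) auto
    moreover have "a 0 v < a 0 w" using \<phi>_mono[OF that] by (simp add: a_def)
    ultimately show ?thesis
      unfolding \<kappa>_def using suminf_split_head[OF a_sum[of v]] suminf_split_head[OF a_sum[of w]] by linarith
  qed
  then have "strict_mono \<kappa>" by (simp add: strict_mono_def)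
  moreover have "\<kappa> 0 = 0"
  proof -
    have "(D ^^ n) 0 = 0" "(C ^^ n) 0 = 0" for n by (induction n) (auto simp: D0 C0)
    then show ?thesis by (simp add: \<kappa>_def a_def b_def \<phi>0 C0)
  qed
  moreover have "\<kappa> (D w) = - \<kappa> w / 2" for w
  proof -
    have "a n (D w) = - 1/2 * a (Suc n) w" for n by (simp add: a_def funpow_swap1)
    then have 1: "(\<Sum>n. a n (D w)) = - 1/2 * ((\<Sum>n. a n w) - a 0 w)"
      using suminf_split_head[OF a_sum[of w]] suminf_mult[of "\<lambda>n. a (Suc n) w" "-1/2"] a_sum[of w]
      by (simp add: summable_Suc_iff[of "\<lambda>n. a n w"])
    have "b (Suc n) (D w) = - 1/2 * b n w" for n
      by (simp add: b_def funpow_swap1 CD)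
    then have 2: "(\<Sum>n. b (Suc n) (D w)) = - 1/2 * (b 0 w + (\<Sum>n. b (Suc n) w))"
      using suminf_split_head[OF b_sum[of w]] suminf_mult[of "\<lambda>n. b n w" "-1/2"] b_sum[of w] by simp
    have "a 0 w = b 0 w" by (simp add: a_def b_def)
    with 1 2 show ?thesis unfolding \<kappa>_def by (simp add: field_simps)
  qed
  moreover have "continuous_on UNIV \<kappa>"
  proof -
    have "continuous_on {-r<..<r} \<kappa>" for r
    proof -
      have "uniform_limit {-r<..<r} (\<lambda>n x. \<Sum>i<n. a i x) (\<lambda>x. \<Sum>i. a i x) sequentially"
      proof (rule Weierstrass_m_test[where M="\<lambda>n. (2 * q ^ p) ^ n * r ^ p"])
        show "summable (\<lambda>n. (2 * q ^ p) ^ n * r ^ p)"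
          using p(2) q by (intro summable_mult2 summable_geometric) auto
        fix n x assume "x \<in> {-r<..<r}"
        then have "\<bar>x\<bar> ^ p \<le> r ^ p" by (intro power_mono) auto
        then have "(2 * q ^ p) ^ n * \<bar>x\<bar> ^ p \<le> (2 * q ^ p) ^ n * r ^ p"
          using q by (intro mult_left_mono) auto
        then show "norm (a n x) \<le> (2 * q ^ p) ^ n * r ^ p" using a_bd[of n x] by (metis order_trans real_norm_def)
      qed
      then have "continuous_on {-r<..<r} (\<lambda>x. \<Sum>i. a i x)"
        by (rule uniform_limit_theorem[rotated])
           (auto intro!: continuous_intros always_eventually continuous_on_subset[OF a_cont])
      moreover have "uniform_limit {-r<..<r} (\<lambda>n x. \<Sum>i<n. b (Suc i) x) (\<lambda>x. \<Sum>i. b (Suc i) x) sequentially"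
      proof (rule Weierstrass_m_test[where M="\<lambda>n. (1/2) ^ Suc n"])
        show "summable (\<lambda>n. (1/2::real) ^ Suc n)"
          by (subst summable_Suc_iff, rule summable_geometric) auto
        show "norm (b (Suc n) x) \<le> (1/2) ^ Suc n" for n x using b_bd[of "Suc n" x] by simp
      qed
      then have "continuous_on {-r<..<r} (\<lambda>x. \<Sum>i. b (Suc i) x)"
        by (rule uniform_limit_theorem[rotated])
           (auto intro!: continuous_intros always_eventually continuous_on_subset[OF b_cont])
      ultimately show ?thesis unfolding \<kappa>_def by (intro continuous_intros)
    qed
    then have "continuous_on (\<Union>r. {-r<..<r}) \<kappa>"
      by (intro continuous_on_open_UN) auto
    moreover have "(\<Union>r. {-r<..<r}) = (UNIV :: real set)"
    proof -
      have "x \<in> {-(\<bar>x\<bar>+1)<..<\<bar>x\<bar>+1}" for x :: real by auto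
      then show ?thesis by blast
    qed
    ultimately show ?thesis by simp
  qed
  ultimately show ?thesis using that by blast
qed

section \<open>Coordinates adapted to the two axes\<close>

text \<open>The point with coordinate \<open>x\<close> in direction \<open>i\<close> and \<open>y\<close> in the other direction. Keeping \<open>i\<close>
  a variable treats both positions of the sliding axis at once.\<close>

definition pt :: "2 \<Rightarrow> real \<Rightarrow> real \<Rightarrow> plane" where
  "pt i x y = (\<chi> k. if k = i then x else y)"

lemma pt_nth: "pt i x y $ i = x" "k \<noteq> i \<Longrightarrow> pt i x y $ k = y"
  by (auto simp: pt_def)

lemma two_cases:
  assumes "i \<noteq> j"
  shows "(k::2) = i \<or> k = j"
  using exhaust_2[of i] exhaust_2[of j] exhaust_2[of k] assms by (elim disjE) simp_all

lemma plane_eq_iff: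
  fixes p q :: plane
  assumes "i \<noteq> j"
  shows "p = q \<longleftrightarrow> p $ i = q $ i \<and> p $ j = q $ j"
proof
  assume *: "p $ i = q $ i \<and> p $ j = q $ j"
  have "p $ k = q $ k" for k using two_cases[OF assms, of k] * by (elim disjE) simp_all
  then show "p = q" by (simp add: vec_eq_iff)
qed simp

lemma pt_eta: "i \<noteq> j \<Longrightarrow> pt i (p $ i) (p $ j) = p"
  by (simp add: plane_eq_iff[of i j] pt_nth)

lemma pt_scale: "pt i x y = x *\<^sub>R pt i 1 0 + y *\<^sub>R pt i 0 1"
  by (simp add: pt_def vec_eq_iff)

lemma continuous_on_pt [continuous_intros]:
  "continuous_on S u \<Longrightarrow> continuous_on S v \<Longrightarrow> continuous_on S (\<lambda>x. pt i (u x) (v x))"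
  by (subst pt_scale) (intro continuous_intros)

lemma has_vector_derivative_pt:
  assumes "(u has_real_derivative u') (at s within S)" "(v has_real_derivative v') (at s within S)"
  shows "((\<lambda>s. pt i (u s) (v s)) has_vector_derivative pt i u' v') (at s within S)"
proof -
  have "((\<lambda>s. u s *\<^sub>R pt i 1 0 + v s *\<^sub>R pt i 0 1) has_vector_derivative u' *\<^sub>R pt i 1 0 + v' *\<^sub>R pt i 0 1)
     (at s within S)"
    using assms unfolding has_real_derivative_iff_has_vector_derivative
    by (intro has_vector_derivative_add) (auto intro!: derivative_eq_intros simp: has_real_derivative_iff_has_vector_derivative)
  then show ?thesis by (simp flip: pt_scale)
qed

lemma has_vector_derivative_nth:
  assumes "(\<gamma> has_vector_derivative v) (at s within S)"
  shows "((\<lambda>s. \<gamma> s $ k) has_real_derivative (v $ k)) (at s within S)"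
  using bounded_linear.has_vector_derivative[OF bounded_linear_vec_nth assms]
  by (simp add: has_real_derivative_iff_has_vector_derivative)

lemma other_eq: "i \<noteq> j \<Longrightarrow> other i = j"
  unfolding other_def using exhaust_2[of i] exhaust_2[of j] by metis

lemma coord_prod: "i \<noteq> (j::2) \<Longrightarrow> p $ 1 * p $ 2 = p $ i * (p $ j :: real)"
  using exhaust_2[of i] exhaust_2[of j] by (metis mult.commute)

section \<open>Fields that cross one axis and slide along the other\<close>

lemma disjoint_open_not_frontier:
  assumes "openin T S1" "openin T S2" "S1 \<inter> S2 = {}" "p \<in> S1 \<union> S2"
  shows "p \<notin> T frontier_of S1"
proof -
  have "S2 \<inter> T closure_of S1 = {}"
    using assms openin_Int_closure_of_eq_empty[of T S2 S1] by blast
  moreover have "T interior_of S1 = S1" using assms by (simp add: interior_of_openin)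
  ultimately show ?thesis using assms unfolding frontier_of_def by auto
qed

lemma eventually_at_split:
  fixes t :: real
  assumes "\<forall>\<^sub>F s in at t within (I \<inter> {..t}). P s" "\<forall>\<^sub>F s in at t within (I \<inter> {t..}). P s"
  shows "\<forall>\<^sub>F s in at t within I. P s"
proof -
  have "at t within I = at t within (I \<inter> {..t} \<union> I \<inter> {t..})"
    by (rule arg_cong[where f="\<lambda>S. at t within S"]) auto
  then show ?thesis using assms by (simp add: at_within_union eventually_sup)
qed

lemma crosses_at_cong:
  assumes "\<And>s. s \<in> I \<Longrightarrow> \<gamma> s \<in> A \<longleftrightarrow> \<gamma> s \<in> A'" "\<And>s. s \<in> I \<Longrightarrow> \<gamma> s \<in> B \<longleftrightarrow> \<gamma> s \<in> B'"
    and "F (\<gamma> t) = F' (\<gamma> t)" "G (\<gamma> t) = G' (\<gamma> t)"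
  shows "crosses_at F A G B I \<gamma> t \<longleftrightarrow> crosses_at F' A' G' B' I \<gamma> t"
  using assms by (auto simp: crosses_at_def eventually_at_filter elim!: eventually_mono)

text \<open>The sliding field is the affine combination of the two fields whose component transversal to the axis
  vanishes.\<close>

lemma sliding_field_convex:
  assumes "i \<noteq> j" "Y $ j \<noteq> X $ j" "X = fst Z p" "Y = snd Z p"
  shows "sliding_field Z j p = pt i (((Y $ j) / (Y $ j - X $ j)) * X $ i + ((- X $ j) / (Y $ j - X $ j)) * Y $ i) 0"
  using assms other_eq[of j i]
  by (simp add: plane_eq_iff[of i j] pt_nth sliding_field_def Let_def axis_def diff_divide_distrib)

text \<open>The piecewise field \<open>(X, Y)\<close> is only known on the neighbourhood \<open>V\<close>. There it agrees with the globally
  defined \<open>F\<close> and \<open>G\<close>, which have the right signs everywhere, so that leaves and labels can be used without regard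
  to domains. The neighbourhood is a parameter on its own because it will be shrunk after the
  homeomorphism, which depends on \<open>F\<close> and \<open>G\<close> only, has been constructed.\<close>

locale crossing_sliding =
  F: slope_field "\<lambda>x y. F (pt i x y) $ j / F (pt i x y) $ i" L M +
  G: slope_field "\<lambda>x y. G (pt i x y) $ j / G (pt i x y) $ i" L M
  for i j :: 2 and F G :: "plane \<Rightarrow> plane" and L M :: real +
  fixes e m K :: real and X Y :: "plane \<Rightarrow> plane" and V :: "plane set"
  assumes ij: "i \<noteq> j" and e: "e = 1 \<or> e = -1"
    and F_cont: "continuous_on UNIV F" and G_cont: "continuous_on UNIV G" and m_pos: "m > 0"
    and F_i: "\<And>p. m \<le> e * F p $ i \<and> e * F p $ i \<le> K"
    and G_i: "\<And>p. m \<le> e * G p $ i \<and> e * G p $ i \<le> K"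
    and F_j: "\<And>p. e * F p $ j < 0" and G_j: "\<And>p. e * G p $ j > 0"
    and V_open: "open V" and V_0: "0 \<in> V"
    and X_eq: "\<And>p. p \<in> V \<Longrightarrow> X p = F p" and Y_eq: "\<And>p. p \<in> V \<Longrightarrow> Y p = G p"
begin

lemma other_simps: "other i = j" "other j = i"
  using ij other_eq by auto

lemma ee: "e * (e * a) = a" "e * e = 1" "e \<noteq> 0"
  using e by auto

lemma prod_eq: "p $ 1 * p $ 2 = p $ i * (p $ j :: real)"
  using coord_prod ij by blast

lemma F_abs: "\<bar>F p $ i\<bar> \<le> K" "\<bar>G p $ i\<bar> \<le> K"
  using F_i[of p] G_i[of p] m_pos e by auto

lemma Fi_ne: "F p $ i \<noteq> 0" "G p $ i \<noteq> 0"
  using F_i[of p] G_i[of p] m_pos by auto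

lemma crossing_i: "crossing (X, Y) V i = Sigma_axis V i"
proof -
  have "F p $ i * G p $ i > 0" for p
    using F_i[of p] G_i[of p] m_pos e by (auto simp: zero_less_mult_iff)
  then show ?thesis by (auto simp: crossing_def Sigma_axis_def X_eq Y_eq)
qed

lemma crossing_j: "crossing (X, Y) V j = {}"
proof -
  have "F p $ j * G p $ j < 0" for p
    using F_j[of p] G_j[of p] e by (auto simp: mult_less_0_iff)
  then show ?thesis by (auto simp: crossing_def Sigma_axis_def X_eq Y_eq) (metis less_asym)
qed

lemma not_opposite_i: "\<not> (F p $ i < 0 \<and> G p $ i > 0)" "\<not> (F p $ i > 0 \<and> G p $ i < 0)"
  using F_i[of p] G_i[of p] m_pos e by auto

lemma sliding_i: "sliding (X, Y) V i = {}" "escaping (X, Y) V i = {}"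
  using not_opposite_i
  by (auto simp: sliding_def escaping_def Sigma_plus_def Sigma_minus_def Sigma_axis_def X_eq Y_eq)

lemma sliding_j:
  "(sliding (X, Y) V j = Sigma_plus V j \<and> escaping (X, Y) V j = Sigma_minus V j) \<or>
   (sliding (X, Y) V j = Sigma_minus V j \<and> escaping (X, Y) V j = Sigma_plus V j)"
proof (cases "e = 1")
  case True
  then have "F p $ j < 0" "G p $ j > 0" "\<not> F p $ j > 0" "\<not> G p $ j < 0" for p
    using F_j[of p] G_j[of p] by auto
  then have "sliding (X, Y) V j = Sigma_plus V j \<and> escaping (X, Y) V j = Sigma_minus V j"
    by (auto simp: sliding_def escaping_def Sigma_plus_def Sigma_minus_def Sigma_axis_def X_eq Y_eq)
  then show ?thesis ..
next
  case False
  then have "F p $ j > 0" "G p $ j < 0" "\<not> F p $ j < 0" "\<not> G p $ j > 0" for p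
    using F_j[of p] G_j[of p] e by auto
  then have "sliding (X, Y) V j = Sigma_minus V j \<and> escaping (X, Y) V j = Sigma_plus V j"
    by (auto simp: sliding_def escaping_def Sigma_plus_def Sigma_minus_def Sigma_axis_def X_eq Y_eq)
  then show ?thesis ..
qed

lemma sliding_escaping_j:
  "sliding (X, Y) V j \<union> escaping (X, Y) V j = {p\<in>V. p $ j = 0 \<and> p $ i \<noteq> 0}"
  using sliding_j by (auto simp: Sigma_plus_def Sigma_minus_def Sigma_axis_def other_simps)

text \<open>The crossing axis belongs to one region. On the other axis the two half axes are relatively open and one
  of them slides while the other one escapes. The origin is therefore the only boundary point, and the coinductive clause of
  \<open>regular_curve\<close> never applies.\<close>

lemma no_region_boundary: "region_boundary (X, Y) V k - {0} = {}"
proof -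
  let ?T = "top_of_set (Sigma_axis V j)"
  have op: "openin ?T (Sigma_plus V j)" "openin ?T (Sigma_minus V j)"
  proof -
    have "open {p::plane. p $ i > 0}" "open {p::plane. p $ i < 0}"
      by (auto intro!: open_Collect_less continuous_intros)
    moreover have "Sigma_plus V j = Sigma_axis V j \<inter> {p. p $ i > 0}"
      "Sigma_minus V j = Sigma_axis V j \<inter> {p. p $ i < 0}"
      by (auto simp: Sigma_plus_def Sigma_minus_def other_simps)
    ultimately show "openin ?T (Sigma_plus V j)" "openin ?T (Sigma_minus V j)"
      by (auto simp: openin_open)
  qed
  have disj: "Sigma_plus V j \<inter> Sigma_minus V j = {}"
    by (auto simp: Sigma_plus_def Sigma_minus_def)
  have fr: "p \<notin> ?T frontier_of Sigma_plus V j \<and> p \<notin> ?T frontier_of Sigma_minus V j"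
    if "p \<noteq> 0" for p
  proof (cases "p \<in> Sigma_axis V j")
    case True
    then have "p $ i \<noteq> 0" using that ij by (auto simp: Sigma_axis_def plane_eq_iff[of i j])
    then have "p \<in> Sigma_plus V j \<union> Sigma_minus V j"
      using True by (auto simp: Sigma_plus_def Sigma_minus_def other_simps)
    then show ?thesis using disjoint_open_not_frontier op disj by (metis Int_commute Un_commute)
  next
    case False
    moreover have "?T frontier_of S \<subseteq> Sigma_axis V j" for S
      by (metis frontier_of_subset_topspace topspace_euclidean_subtopology)
    ultimately show ?thesis by blast
  qed
  have "region_boundary (X, Y) V j - {0} = {}"
    using sliding_j fr by (auto simp: region_boundary_def crossing_j; blast)
  moreover have "(top_of_set (Sigma_axis V i)) frontier_of Sigma_axis V i = {}"
    by (metis frontier_of_topspace topspace_euclidean_subtopology)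
  then have "region_boundary (X, Y) V i - {0} = {}"
    by (simp add: region_boundary_def crossing_i sliding_i)
  ultimately show ?thesis using two_cases[OF ij, of k] by auto
qed

lemma regular_curve_iff:
  "regular_curve (X, Y) V I \<gamma> \<longleftrightarrow> is_interval I \<and> interior I \<noteq> {} \<and> continuous_on I \<gamma> \<and>
     \<gamma> ` I \<subseteq> V \<and> (\<forall>t\<in>I. follows_at (X, Y) V I \<gamma> t)"
proof
  assume "regular_curve (X, Y) V I \<gamma>"
  then show "is_interval I \<and> interior I \<noteq> {} \<and> continuous_on I \<gamma> \<and>
     \<gamma> ` I \<subseteq> V \<and> (\<forall>t\<in>I. follows_at (X, Y) V I \<gamma> t)"
    using no_region_boundary by (cases rule: regular_curve.cases) (simp, blast)
next
  assume "is_interval I \<and> interior I \<noteq> {} \<and> continuous_on I \<gamma> \<and>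
     \<gamma> ` I \<subseteq> V \<and> (\<forall>t\<in>I. follows_at (X, Y) V I \<gamma> t)"
  then show "regular_curve (X, Y) V I \<gamma>" by (intro regular_curve.intros) auto
qed

text \<open>The velocity along the sliding axis, extended to the plane.\<close>

definition slide :: "plane \<Rightarrow> real" where
  "slide p = (let X = F p; Y = G p in
     ((Y $ j) / (Y $ j - X $ j)) * X $ i + ((- X $ j) / (Y $ j - X $ j)) * Y $ i)"

lemma GF_ne: "G p $ j \<noteq> F p $ j"
  using F_j[of p] G_j[of p] by auto

lemma sliding_field_eq: "p \<in> V \<Longrightarrow> sliding_field (X, Y) j p = pt i (slide p) 0"
  unfolding slide_def Let_def by (rule sliding_field_convex[OF ij GF_ne]) (simp_all add: X_eq Y_eq)

lemma slide_bounds: "m \<le> e * slide p" "e * slide p \<le> K"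
proof -
  define l where "l = G p $ j / (G p $ j - F p $ j)"
  define l' where "l' = (- F p $ j) / (G p $ j - F p $ j)"
  have pos: "e * G p $ j - e * F p $ j > 0" using F_j[of p] G_j[of p] by linarith
  have "l = (e * G p $ j) / (e * G p $ j - e * F p $ j)" "l' = (e * (- F p $ j)) / (e * G p $ j - e * F p $ j)"
    unfolding l_def l'_def right_diff_distrib[symmetric]
    by (rule mult_divide_mult_cancel_left[OF ee(3), symmetric])+
  then have l: "l \<ge> 0" "l' \<ge> 0" using F_j[of p] G_j[of p] pos by (auto simp: divide_nonneg_pos divide_nonpos_pos)
  have "l + l' = 1" using GF_ne[of p] by (simp add: l_def l'_def flip: diff_divide_distrib)
  moreover have eq: "e * slide p = l * (e * F p $ i) + l' * (e * G p $ i)"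
    by (simp add: slide_def Let_def l_def l'_def algebra_simps)
  ultimately show "m \<le> e * slide p" "e * slide p \<le> K"
    using convex_bound_le[of "e * F p $ i" K "e * G p $ i" l l'] l F_i[of p] G_i[of p]
      convex_bound_le[of "- (e * F p $ i)" "- m" "- (e * G p $ i)" l l']
    by auto
qed

lemma slide_cont: "continuous_on UNIV slide"
  unfolding slide_def Let_def using GF_ne
  by (intro continuous_intros F_cont G_cont) auto

text \<open>What \<open>follows_at\<close> amounts to for these fields: motion in \<open>xy > 0\<close>, motion in \<open>xy < 0\<close>, sliding, crossing, and
  sliding through the origin, in this order.\<close>

definition step :: "real set \<Rightarrow> (real \<Rightarrow> plane) \<Rightarrow> real \<Rightarrow> bool" where
  "step I \<gamma> t \<longleftrightarrow>
     (\<gamma> t $ i * \<gamma> t $ j > 0 \<and> (\<gamma> has_vector_derivative F (\<gamma> t)) (at t within I)) \<or>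
     (\<gamma> t $ i * \<gamma> t $ j < 0 \<and> (\<gamma> has_vector_derivative G (\<gamma> t)) (at t within I)) \<or>
     (\<gamma> t $ j = 0 \<and> \<gamma> t $ i \<noteq> 0 \<and> (\<gamma> has_vector_derivative pt i (slide (\<gamma> t)) 0) (at t within I) \<and>
        (\<forall>\<^sub>F s in at t within I. \<gamma> s $ j = 0)) \<or>
     (\<gamma> t $ i = 0 \<and> \<gamma> t $ j \<noteq> 0 \<and>
        (crosses_at F {p. p $ i * p $ j > 0} G {p. p $ i * p $ j < 0} I \<gamma> t \<or>
         crosses_at G {p. p $ i * p $ j < 0} F {p. p $ i * p $ j > 0} I \<gamma> t)) \<or>
     (\<gamma> t = 0 \<and> (\<forall>\<^sub>F s in at t within I. \<gamma> s $ j = 0 \<and> \<gamma> s $ i \<noteq> 0))"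

lemma axis_points_near:
  assumes "d > 0"
  shows "\<exists>p\<in>V. p $ j = 0 \<and> p $ i \<noteq> 0 \<and> dist p 0 < d"
proof -
  obtain r where r: "r > 0" "ball 0 r \<subseteq> V" using V_open V_0 openE by blast
  define c where "c = min d r / 2"
  have c: "c > 0" "c < d" "c < r"
    using r assms by (auto simp: c_def)
  then have "norm (c *\<^sub>R axis i 1 :: plane) = c" by (simp add: norm_axis_1)
  with c show ?thesis
    using r ij by (intro bexI[of _ "c *\<^sub>R axis i 1"]) (auto simp: axis_def subset_iff)
qed

lemma follows_at_iff:
  assumes t: "t \<in> I" and V: "\<gamma> ` I \<subseteq> V"
  shows "follows_at (X, Y) V I \<gamma> t \<longleftrightarrow> step I \<gamma> t"
proof -
  have tV: "\<gamma> t \<in> V" and sV: "\<And>s. s \<in> I \<Longrightarrow> \<gamma> s \<in> V" using assms by auto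
  have pos: "s \<in> I \<Longrightarrow> \<gamma> s \<in> Upos V \<longleftrightarrow> \<gamma> s \<in> {p. p $ i * p $ j > 0}"
   and neg: "s \<in> I \<Longrightarrow> \<gamma> s \<in> Uneg V \<longleftrightarrow> \<gamma> s \<in> {p. p $ i * p $ j < 0}" for s
    using sV[of s] by (auto simp: Upos_def Uneg_def prod_eq)
  have ex2: "(\<exists>k. P k) \<longleftrightarrow> P i \<or> P j" for P :: "2 \<Rightarrow> bool"
    using two_cases[OF ij] by metis
  have ev: "(\<forall>\<^sub>F s in at t within I. \<gamma> s \<in> V \<and> P s) \<longleftrightarrow> (\<forall>\<^sub>F s in at t within I. P s)" for P
    using sV by (auto simp: eventually_at_filter elim!: eventually_mono)
  have "follows_off_origin_at (X, Y) V I \<gamma> t \<longleftrightarrow>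
     (\<gamma> t $ i * \<gamma> t $ j > 0 \<and> (\<gamma> has_vector_derivative F (\<gamma> t)) (at t within I)) \<or>
     (\<gamma> t $ i * \<gamma> t $ j < 0 \<and> (\<gamma> has_vector_derivative G (\<gamma> t)) (at t within I)) \<or>
     (\<gamma> t $ j = 0 \<and> \<gamma> t $ i \<noteq> 0 \<and> (\<gamma> has_vector_derivative pt i (slide (\<gamma> t)) 0) (at t within I) \<and>
        (\<forall>\<^sub>F s in at t within I. \<gamma> s $ j = 0)) \<or>
     (\<gamma> t $ i = 0 \<and> \<gamma> t $ j \<noteq> 0 \<and>
        (crosses_at F {p. p $ i * p $ j > 0} G {p. p $ i * p $ j < 0} I \<gamma> t \<or>
         crosses_at G {p. p $ i * p $ j < 0} F {p. p $ i * p $ j > 0} I \<gamma> t))"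
  proof -
    have 1: "crosses_at X (Upos V) Y (Uneg V) I \<gamma> t \<longleftrightarrow>
        crosses_at F {p. p $ i * p $ j > 0} G {p. p $ i * p $ j < 0} I \<gamma> t"
      by (rule crosses_at_cong) (use pos neg tV X_eq Y_eq in auto)
    have 2: "crosses_at Y (Uneg V) X (Upos V) I \<gamma> t \<longleftrightarrow>
        crosses_at G {p. p $ i * p $ j < 0} F {p. p $ i * p $ j > 0} I \<gamma> t"
      by (rule crosses_at_cong) (use pos neg tV X_eq Y_eq in auto)
    have 3: "(\<forall>\<^sub>F s in at t within I. \<gamma> s \<in> Sigma_axis V j) \<longleftrightarrow> (\<forall>\<^sub>F s in at t within I. \<gamma> s $ j = 0)"
      by (simp add: Sigma_axis_def ev)
    have 4: "\<gamma> t \<in> crossing (X, Y) V i \<and> \<gamma> t \<noteq> 0 \<longleftrightarrow> \<gamma> t $ i = 0 \<and> \<gamma> t $ j \<noteq> 0"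
      using tV by (auto simp: crossing_i Sigma_axis_def plane_eq_iff[OF ij, of "\<gamma> t" 0])
    show ?thesis
      unfolding follows_off_origin_at_def ex2 fst_conv snd_conv sliding_escaping_j sliding_i crossing_j 1 2 3
        sliding_field_eq[OF tV] pos[OF t] neg[OF t] mem_Collect_eq X_eq[OF tV] Y_eq[OF tV]
      using 4 tV by (auto simp: plane_eq_iff[OF ij, of "\<gamma> t" 0])
  qed
  moreover have "follows_at_origin (X, Y) V I \<gamma> t \<longleftrightarrow>
     \<gamma> t = 0 \<and> (\<forall>\<^sub>F s in at t within I. \<gamma> s $ j = 0 \<and> \<gamma> s $ i \<noteq> 0)"
  proof -
    obtain p where p: "p \<in> V" "p $ j = 0" "p $ i \<noteq> 0" using axis_points_near[of 1] by auto
    have un: "(\<Union>k. crossing (X, Y) V k) = Sigma_axis V i"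
      using two_cases[OF ij] crossing_i crossing_j by (auto, metis empty_iff)
    have "closure (Sigma_axis V i) \<subseteq> {p. p $ i = 0}"
      by (rule closure_minimal) (auto simp: Sigma_axis_def intro!: closed_Collect_eq continuous_intros)
    then have "Sigma_set V \<noteq> V \<inter> closure (\<Union>k. crossing (X, Y) V k)"
      using p unfolding un by (auto simp: Sigma_set_def prod_eq set_eq_iff)
    moreover have cl: "0 \<in> closure (escaping (X, Y) V j \<union> sliding (X, Y) V j)"
      unfolding Un_commute[of "escaping _ _ _"] sliding_escaping_j closure_approachable
      using axis_points_near by blast
    moreover have "0 \<in> closure (crossing (X, Y) V (other j))"
      using V_0 closure_subset by (fastforce simp: other_simps crossing_i Sigma_axis_def)
    moreover have "0 \<notin> closure (escaping (X, Y) V (other j) \<union> sliding (X, Y) V (other j))"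
      by (simp add: other_simps sliding_i)
    moreover have "(\<forall>\<^sub>F s in at t within I. \<gamma> s \<in> escaping (X, Y) V j \<union> sliding (X, Y) V j) \<longleftrightarrow>
        (\<forall>\<^sub>F s in at t within I. \<gamma> s $ j = 0 \<and> \<gamma> s $ i \<noteq> 0)"
      unfolding Un_commute[of "escaping _ _ _"] sliding_escaping_j by (simp add: ev)
    ultimately show ?thesis
      unfolding follows_at_origin_def ex2 by (simp add: sliding_i)
  qed
  ultimately show ?thesis unfolding follows_at_def step_def by blast
qed

lemma regular_curve_iff_step:
  "regular_curve (X, Y) V I \<gamma> \<longleftrightarrow> is_interval I \<and> interior I \<noteq> {} \<and> continuous_on I \<gamma> \<and>
     \<gamma> ` I \<subseteq> V \<and> (\<forall>t\<in>I. step I \<gamma> t)"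
  unfolding regular_curve_iff using follows_at_iff by blast

section \<open>Regular curves are curves along leaves\<close>

definition labF :: "plane \<Rightarrow> real" where "labF p = F.label (p $ i) (p $ j)"
definition labG :: "plane \<Rightarrow> real" where "labG p = G.label (p $ i) (p $ j)"

text \<open>On the line \<open>x = 0\<close> the two labels agree, so the choice made there is immaterial. On \<open>y = 0\<close> they
  differ outside the origin: such a point is the foot of one leaf of each field.\<close>

definition leaf_label :: "plane \<Rightarrow> real" where
  "leaf_label p = (if 0 \<le> p $ i * p $ j then labF p else labG p)"

lemma leaf_label_G: "p $ i * p $ j \<le> 0 \<Longrightarrow> p $ j \<noteq> 0 \<Longrightarrow> leaf_label p = labG p"
  by (cases "p $ i = 0") (auto simp: leaf_label_def labF_def labG_def F.label_0 G.label_0 mult_le_0_iff zero_le_mult_iff)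

definition leaf_curve :: "real set \<Rightarrow> (real \<Rightarrow> plane) \<Rightarrow> bool" where
  "leaf_curve I \<gamma> \<longleftrightarrow> is_interval I \<and> interior I \<noteq> {} \<and> continuous_on I \<gamma> \<and> \<gamma> ` I \<subseteq> V \<and>
     strict_mono_on I (\<lambda>t. e * \<gamma> t $ i) \<and>
     ((\<forall>t\<in>I. \<gamma> t $ j = 0) \<or>
      ((\<forall>t\<in>I. \<gamma> t $ j \<noteq> 0) \<and> (\<forall>s\<in>I. \<forall>t\<in>I. leaf_label (\<gamma> s) = leaf_label (\<gamma> t))))"

lemma labF_const:
  assumes "a \<le> b" and c: "continuous_on {a..b} \<gamma>"
    and d: "\<And>s. a < s \<Longrightarrow> s < b \<Longrightarrow> (\<gamma> has_vector_derivative F (\<gamma> s)) (at s)"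
  shows "labF (\<gamma> a) = labF (\<gamma> b)"
  unfolding labF_def
proof (rule F.label_const_along_curve[OF \<open>a \<le> b\<close>, where x="\<lambda>s. \<gamma> s $ i" and y="\<lambda>s. \<gamma> s $ j" and x'="\<lambda>s. F (\<gamma> s) $ i" and B=K])
  fix s assume s: "a < s" "s < b"
  show "((\<lambda>s. \<gamma> s $ i) has_real_derivative F (\<gamma> s) $ i) (at s)"
    by (rule has_vector_derivative_nth[OF d[OF s]])
  show "((\<lambda>s. \<gamma> s $ j) has_real_derivative
        F (pt i (\<gamma> s $ i) (\<gamma> s $ j)) $ j / F (pt i (\<gamma> s $ i) (\<gamma> s $ j)) $ i * F (\<gamma> s) $ i) (at s)"
    using has_vector_derivative_nth[OF d[OF s], of j] Fi_ne by (simp add: pt_eta[OF ij])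
qed (use F_abs c in \<open>auto intro!: continuous_intros\<close>)

lemma labG_const:
  assumes "a \<le> b" and c: "continuous_on {a..b} \<gamma>"
    and d: "\<And>s. a < s \<Longrightarrow> s < b \<Longrightarrow> (\<gamma> has_vector_derivative G (\<gamma> s)) (at s)"
  shows "labG (\<gamma> a) = labG (\<gamma> b)"
  unfolding labG_def
proof (rule G.label_const_along_curve[OF \<open>a \<le> b\<close>, where x="\<lambda>s. \<gamma> s $ i" and y="\<lambda>s. \<gamma> s $ j" and x'="\<lambda>s. G (\<gamma> s) $ i" and B=K])
  fix s assume s: "a < s" "s < b"
  show "((\<lambda>s. \<gamma> s $ i) has_real_derivative G (\<gamma> s) $ i) (at s)"
    by (rule has_vector_derivative_nth[OF d[OF s]])
  show "((\<lambda>s. \<gamma> s $ j) has_real_derivative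
        G (pt i (\<gamma> s $ i) (\<gamma> s $ j)) $ j / G (pt i (\<gamma> s $ i) (\<gamma> s $ j)) $ i * G (\<gamma> s) $ i) (at s)"
    using has_vector_derivative_nth[OF d[OF s], of j] Fi_ne by (simp add: pt_eta[OF ij])
qed (use F_abs c in \<open>auto intro!: continuous_intros\<close>)

lemma at_within_inner:
  fixes a b s :: real
  assumes "{a..b} \<subseteq> I" "a < s" "s < b"
  shows "at s within I = at s"
  using assms by (intro at_within_interior) (auto simp: interior_def intro!: exI[of _ "{a<..<b}"])

text \<open>Stated for one side of \<open>t\<close> at a time: at a crossing the curve follows different fields before and
  after \<open>t\<close>. The point \<open>\<gamma> t\<close> may then lie on \<open>x = 0\<close>, where both labels agree.\<close>

lemma leaf_label_locally_const:
  assumes I: "is_interval I" and c: "continuous_on I \<gamma>" and st: "\<And>s. s \<in> I \<Longrightarrow> step I \<gamma> s"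
    and t: "t \<in> I" "\<gamma> t $ j \<noteq> 0" and S: "S = I \<inter> {..t} \<or> S = I \<inter> {t..}"
    and sgn: "((\<forall>\<^sub>F s in at t within S. \<gamma> s $ i * \<gamma> s $ j > 0) \<and> \<gamma> t $ i * \<gamma> t $ j \<ge> 0) \<or>
              ((\<forall>\<^sub>F s in at t within S. \<gamma> s $ i * \<gamma> s $ j < 0) \<and> \<gamma> t $ i * \<gamma> t $ j \<le> 0)"
  shows "\<forall>\<^sub>F s in at t within S. leaf_label (\<gamma> s) = leaf_label (\<gamma> t)"
proof -
  have conv: "r \<in> S \<and> r \<noteq> t \<and> dist r t < dist s t \<and> at r within I = at r"
    if "s \<in> S" "min s t < r" "r < max s t" for r s
  proof -
    have "s \<in> I" using that S by auto
    then have "{min s t..max s t} \<subseteq> I"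
      using interval_subset[OF I] t by (metis max_def min_def)
    then show ?thesis using that S at_within_inner[of "min s t" "max s t" I r]
      by (auto simp: dist_real_def subset_iff min_def max_def split: if_splits)
  qed
  have cont: "continuous_on {min s t..max s t} \<gamma>" if "s \<in> S" for s
  proof -
    have "s \<in> I" using that S by auto
    then have "{min s t..max s t} \<subseteq> I"
      using interval_subset[OF I] t by (metis max_def min_def)
    then show ?thesis using c continuous_on_subset by blast
  qed
  have SI: "S \<subseteq> I" using S by auto
  from sgn show ?thesis
  proof (elim disjE conjE)
    assume ev: "\<forall>\<^sub>F s in at t within S. \<gamma> s $ i * \<gamma> s $ j > 0" and tt: "\<gamma> t $ i * \<gamma> t $ j \<ge> 0"
    obtain d where d: "d > 0" and D: "\<And>s. s \<in> S \<Longrightarrow> s \<noteq> t \<Longrightarrow> dist s t < d \<Longrightarrow> \<gamma> s $ i * \<gamma> s $ j > 0"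
      using ev unfolding eventually_at by blast
    have "leaf_label (\<gamma> s) = leaf_label (\<gamma> t)" if s: "s \<in> S" "s \<noteq> t" "dist s t < d" for s
    proof -
      have "labF (\<gamma> (min s t)) = labF (\<gamma> (max s t))"
      proof (rule labF_const[OF _ cont[OF s(1)]])
        fix r assume r: "min s t < r" "r < max s t"
        have "\<gamma> r $ i * \<gamma> r $ j > 0" using conv[OF s(1) r] D[of r] s(3) by auto
        moreover have "r \<in> I" "at r within I = at r" using conv[OF s(1) r] SI by auto
        ultimately show "(\<gamma> has_vector_derivative F (\<gamma> r)) (at r)"
          using st[of r] by (auto simp: step_def)
      qed simp
      moreover have "leaf_label (\<gamma> s) = labF (\<gamma> s)" "leaf_label (\<gamma> t) = labF (\<gamma> t)"
        using D[OF s] tt by (auto simp: leaf_label_def)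
      ultimately show ?thesis by (auto simp: min_def max_def split: if_splits)
    qed
    then show ?thesis unfolding eventually_at using d by blast
  next
    assume ev: "\<forall>\<^sub>F s in at t within S. \<gamma> s $ i * \<gamma> s $ j < 0" and tt: "\<gamma> t $ i * \<gamma> t $ j \<le> 0"
    obtain d where d: "d > 0" and D: "\<And>s. s \<in> S \<Longrightarrow> s \<noteq> t \<Longrightarrow> dist s t < d \<Longrightarrow> \<gamma> s $ i * \<gamma> s $ j < 0"
      using ev unfolding eventually_at by blast
    have "leaf_label (\<gamma> s) = leaf_label (\<gamma> t)" if s: "s \<in> S" "s \<noteq> t" "dist s t < d" for s
    proof -
      have "labG (\<gamma> (min s t)) = labG (\<gamma> (max s t))"
      proof (rule labG_const[OF _ cont[OF s(1)]])
        fix r assume r: "min s t < r" "r < max s t"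
        have "\<gamma> r $ i * \<gamma> r $ j < 0" using conv[OF s(1) r] D[of r] s(3) by auto
        moreover have "r \<in> I" "at r within I = at r" using conv[OF s(1) r] SI by auto
        ultimately show "(\<gamma> has_vector_derivative G (\<gamma> r)) (at r)"
          using st[of r] by (auto simp: step_def)
      qed simp
      moreover have "leaf_label (\<gamma> s) = labG (\<gamma> s)" "leaf_label (\<gamma> t) = labG (\<gamma> t)"
        using D[OF s] tt t leaf_label_G by (auto simp: leaf_label_def)
      ultimately show ?thesis by (auto simp: min_def max_def split: if_splits)
    qed
    then show ?thesis unfolding eventually_at using d by blast
  qed
qed

text \<open>All three properties are local. Near a zero of \<open>y\<close> the curve stays on the axis, so the zeros form
  a relatively open and closed set. The \<open>x\<close>-component has a derivative of sign \<open>e\<close>, one-sided at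
  crossings; only when sliding through the origin no derivative is given, and there monotonicity on
  each side follows from the neighbouring times. The label is constant on each side of every time.\<close>

lemma regular_curve_imp_leaf_curve:
  assumes "regular_curve (X, Y) V I \<gamma>"
  shows "leaf_curve I \<gamma>"
proof -
  have I: "is_interval I" "interior I \<noteq> {}" and c: "continuous_on I \<gamma>" and V: "\<gamma> ` I \<subseteq> V"
    and st: "\<And>t. t \<in> I \<Longrightarrow> step I \<gamma> t"
    using assms by (auto simp: regular_curve_iff_step)
  have cn: "continuous_on I (\<lambda>t. \<gamma> t $ k)" for k using c by (intro continuous_intros)
  have ev_ne: "\<forall>\<^sub>F s in at t within I. \<gamma> s $ k \<noteq> 0" if "t \<in> I" "\<gamma> t $ k \<noteq> 0" for t k
    using cn[of k] that by (auto simp: continuous_on_def intro!: tendsto_imp_eventually_ne)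
  have ev_zero: "\<forall>\<^sub>F s in at t within I. (\<gamma> s $ j = 0) = (\<gamma> t $ j = 0)" if "t \<in> I" for t
  proof (cases "\<gamma> t $ j = 0")
    case True
    then have "\<forall>\<^sub>F s in at t within I. \<gamma> s $ j = 0"
      using st[OF that] by (auto simp: step_def elim!: eventually_mono)
    with True show ?thesis by (auto elim!: eventually_mono)
  next
    case False
    then show ?thesis using ev_ne[OF that, of j] by (auto elim!: eventually_mono)
  qed
  have zero: "(\<gamma> s $ j = 0) = (\<gamma> t $ j = 0)" if "s \<in> I" "t \<in> I" for s t
    using constant_on_if_locally_constant[OF I(1), of "\<lambda>t. \<gamma> t $ j = 0", OF ev_zero that] .
  have der_pos: "\<forall>\<^sub>F s in at t within S. (t < s \<longrightarrow> e * \<gamma> t $ i < e * \<gamma> s $ i) \<and> (s < t \<longrightarrow> e * \<gamma> s $ i < e * \<gamma> t $ i)"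
    if "(\<gamma> has_vector_derivative v) (at t within S)" "e * v $ i > 0" for t S v
    by (rule eventually_increasing_if_deriv_pos[where u="\<lambda>t. e * \<gamma> t $ i" and l="e * v $ i"])
       (use that in \<open>auto intro!: derivative_eq_intros has_vector_derivative_nth\<close>)
  have pos: "e * F p $ i > 0" "e * G p $ i > 0" "e * pt i (slide p) 0 $ i > 0" for p
    using F_i[of p] G_i[of p] slide_bounds[of p] m_pos by (auto simp: pt_nth)
  have inc: "\<forall>\<^sub>F s in at t within I. (t < s \<longrightarrow> e * \<gamma> t $ i < e * \<gamma> s $ i) \<and> (s < t \<longrightarrow> e * \<gamma> s $ i < e * \<gamma> t $ i)"
    if t: "t \<in> I" for t
    using st[OF t] unfolding step_def
  proof (elim disjE conjE)
    assume "crosses_at F {p. 0 < p $ i * p $ j} G {p. p $ i * p $ j < 0} I \<gamma> t"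
    then have d1: "(\<gamma> has_vector_derivative F (\<gamma> t)) (at t within (I \<inter> {..t}))"
      and d2: "(\<gamma> has_vector_derivative G (\<gamma> t)) (at t within (I \<inter> {t..}))"
      unfolding crosses_at_def by blast+
    show ?thesis by (rule eventually_at_split[OF der_pos[OF d1 pos(1)] der_pos[OF d2 pos(2)]])
  next
    assume "crosses_at G {p. p $ i * p $ j < 0} F {p. 0 < p $ i * p $ j} I \<gamma> t"
    then have d1: "(\<gamma> has_vector_derivative G (\<gamma> t)) (at t within (I \<inter> {..t}))"
      and d2: "(\<gamma> has_vector_derivative F (\<gamma> t)) (at t within (I \<inter> {t..}))"
      unfolding crosses_at_def by blast+
    show ?thesis by (rule eventually_at_split[OF der_pos[OF d1 pos(2)] der_pos[OF d2 pos(1)]])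
  next
    assume t0: "\<gamma> t = 0" and ev: "\<forall>\<^sub>F s in at t within I. \<gamma> s $ j = 0 \<and> \<gamma> s $ i \<noteq> 0"
    obtain d where d: "d > 0" and D: "\<And>s. s \<in> I \<Longrightarrow> s \<noteq> t \<Longrightarrow> dist s t < d \<Longrightarrow> \<gamma> s $ j = 0 \<and> \<gamma> s $ i \<noteq> 0"
      using ev unfolding eventually_at by blast
    \<comment> \<open>Strictly between \<open>a\<close> and \<open>b\<close> the curve slides at nonzero \<open>x\<close>, where its derivative is known.\<close>
    have less: "e * \<gamma> a $ i < e * \<gamma> b $ i"
      if ab: "a \<in> I" "b \<in> I" "a < b" "a = t \<or> b = t" "dist a t < d" "dist b t < d" for a b
    proof (rule DERIV_pos_imp_increasing_open[OF \<open>a < b\<close>, where f="\<lambda>t. e * \<gamma> t $ i"])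
      have sub: "{a..b} \<subseteq> I" using interval_subset[OF I(1)] ab by blast
      then show "continuous_on {a..b} (\<lambda>t. e * \<gamma> t $ i)"
        by (intro continuous_intros continuous_on_subset[OF cn])
      fix r assume r: "a < r" "r < b"
      then have rI: "r \<in> I" and at: "at r within I = at r" using sub at_within_inner[OF sub] by auto
      have "\<gamma> r $ j = 0" "\<gamma> r $ i \<noteq> 0" using D[OF rI] r ab by (auto simp: dist_real_def)
      then have "(\<gamma> has_vector_derivative pt i (slide (\<gamma> r)) 0) (at r)"
        using st[OF rI] at by (auto simp: step_def)
      then have "((\<lambda>t. e * \<gamma> t $ i) has_real_derivative e * pt i (slide (\<gamma> r)) 0 $ i) (at r)"
        by (auto intro!: derivative_eq_intros has_vector_derivative_nth)
      then show "\<exists>y. ((\<lambda>t. e * \<gamma> t $ i) has_real_derivative y) (at r) \<and> 0 < y" using pos(3) by blast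
    qed
    show ?thesis unfolding eventually_at using d less[of t] less[of _ t] t by (intro exI[of _ d]) auto
  qed (rule der_pos, assumption, rule pos)+
  have mono: "strict_mono_on I (\<lambda>t. e * \<gamma> t $ i)"
    using strict_mono_on_if_locally_increasing[OF I(1), of "\<lambda>t. e * \<gamma> t $ i"] inc by blast
  have "(\<forall>t\<in>I. \<gamma> t $ j = 0) \<or> (\<forall>t\<in>I. \<gamma> t $ j \<noteq> 0)" using zero by blast
  moreover have "leaf_label (\<gamma> a) = leaf_label (\<gamma> b)" if nz: "\<forall>t\<in>I. \<gamma> t $ j \<noteq> 0" and ab: "a \<in> I" "b \<in> I" for a b
  proof (rule constant_on_if_locally_constant[OF I(1) _ ab, where u="\<lambda>t. leaf_label (\<gamma> t)"])
    fix t assume t: "t \<in> I"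
    have nzt: "\<gamma> t $ j \<noteq> 0" using nz t by blast
    have prod: "((\<lambda>s. \<gamma> s $ i * \<gamma> s $ j) \<longlongrightarrow> \<gamma> t $ i * \<gamma> t $ j) (at t within I)"
    proof -
      have *: "((\<lambda>s. \<gamma> s $ k) \<longlongrightarrow> \<gamma> t $ k) (at t within I)" for k
        using cn[of k] t by (simp add: continuous_on_def)
      show ?thesis by (rule tendsto_mult[OF * *])
    qed
    have half: "at t within (I \<inter> {..t}) \<le> at t within I" "at t within (I \<inter> {t..}) \<le> at t within I"
      by (auto intro: at_le)
    have loc: "\<forall>\<^sub>F s in at t within S. leaf_label (\<gamma> s) = leaf_label (\<gamma> t)"
      if "S = I \<inter> {..t} \<or> S = I \<inter> {t..}"
        "((\<forall>\<^sub>F s in at t within S. \<gamma> s $ i * \<gamma> s $ j > 0) \<and> \<gamma> t $ i * \<gamma> t $ j \<ge> 0) \<or>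
         ((\<forall>\<^sub>F s in at t within S. \<gamma> s $ i * \<gamma> s $ j < 0) \<and> \<gamma> t $ i * \<gamma> t $ j \<le> 0)" for S
      using leaf_label_locally_const[OF I(1) c st t nzt that] .
    from st[OF t] nzt have "(\<gamma> t $ i * \<gamma> t $ j > 0) \<or> (\<gamma> t $ i * \<gamma> t $ j < 0) \<or>
       (\<gamma> t $ i = 0 \<and> (crosses_at F {p. p $ i * p $ j > 0} G {p. p $ i * p $ j < 0} I \<gamma> t \<or>
         crosses_at G {p. p $ i * p $ j < 0} F {p. p $ i * p $ j > 0} I \<gamma> t))"
      unfolding step_def by auto
    then show "\<forall>\<^sub>F s in at t within I. leaf_label (\<gamma> s) = leaf_label (\<gamma> t)"
    proof (elim disjE conjE)
      assume "\<gamma> t $ i * \<gamma> t $ j > 0"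
      moreover from this have "\<forall>\<^sub>F s in at t within I. \<gamma> s $ i * \<gamma> s $ j > 0"
        using order_tendstoD(1)[OF prod] by blast
      ultimately show ?thesis
        using half by - (rule eventually_at_split; rule loc; auto dest: filter_leD)
    next
      assume "\<gamma> t $ i * \<gamma> t $ j < 0"
      moreover from this have "\<forall>\<^sub>F s in at t within I. \<gamma> s $ i * \<gamma> s $ j < 0"
        using order_tendstoD(2)[OF prod] by blast
      ultimately show ?thesis
        using half by - (rule eventually_at_split; rule loc; auto dest: filter_leD)
    next
      assume "\<gamma> t $ i = 0" "crosses_at F {p. p $ i * p $ j > 0} G {p. p $ i * p $ j < 0} I \<gamma> t"
      then show ?thesis by - (rule eventually_at_split; rule loc; auto simp: crosses_at_def)
    next
      assume "\<gamma> t $ i = 0" "crosses_at G {p. p $ i * p $ j < 0} F {p. p $ i * p $ j > 0} I \<gamma> t"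
      then show ?thesis by - (rule eventually_at_split; rule loc; auto simp: crosses_at_def)
    qed
  qed
  ultimately show ?thesis unfolding leaf_curve_def using I c V mono by blast
qed

end

section \<open>Curves along leaves are regular up to reparametrization\<close>

text \<open>If \<open>\<xi>\<close> is the position of the given curve and \<open>r\<close> a motion through all positions, then \<open>J\<close> is the set of times at
  which the motion is at a position that the curve visits.\<close>

lemma reparametrize_onto:
  fixes \<xi> r :: "real \<Rightarrow> real"
  assumes I: "is_interval I" "interior I \<noteq> {}" and \<xi>: "continuous_on I \<xi>" "strict_mono_on I \<xi>"
    and r: "strict_mono r" "surj r"
  obtains J \<tau> where "is_interval J" "interior J \<noteq> {}" "strict_mono_on J \<tau>" "\<tau> ` J = I"
    "\<And>s. s \<in> J \<Longrightarrow> \<xi> (\<tau> s) = r s"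
proof -
  define J where "J = r -` (\<xi> ` I)"
  define \<tau> where "\<tau> s = inv_into I \<xi> (r s)" for s
  have inj: "inj_on \<xi> I" using \<xi>(2) strict_mono_on_imp_inj_on by blast
  have \<tau>I: "\<tau> s \<in> I" and \<xi>\<tau>: "\<xi> (\<tau> s) = r s" if "s \<in> J" for s
    using that by (auto simp: J_def \<tau>_def inv_into_into f_inv_into_f)
  have K: "is_interval (\<xi> ` I)"
    using I(1) \<xi>(1) by (simp add: is_interval_connected_1 connected_continuous_image)
  have J: "is_interval J"
    unfolding is_interval_1 J_def
  proof (intro ballI allI impI, elim conjE)
    fix a b x assume h: "a \<in> r -` \<xi> ` I" "b \<in> r -` \<xi> ` I" "a \<le> x" "x \<le> b"
    then have "r a \<le> r x" "r x \<le> r b" using r(1) by (simp_all add: strict_mono_less_eq)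
    then show "x \<in> r -` \<xi> ` I"
      using interval_subset[OF K, of "r a" "r b"] h by auto
  qed
  have mono: "strict_mono_on J \<tau>"
  proof (rule strict_mono_onI)
    fix a b assume h: "a \<in> J" "b \<in> J" "a < b"
    then have "\<xi> (\<tau> a) < \<xi> (\<tau> b)" using \<xi>\<tau> r(1) by (simp add: strict_mono_less)
    then show "\<tau> a < \<tau> b"
      using \<xi>(2) \<tau>I h by (metis less_irrefl not_less_iff_gr_or_eq strict_mono_onD less_asym)
  qed
  have im: "\<tau> ` J = I"
  proof
    show "\<tau> ` J \<subseteq> I" using \<tau>I by auto
    show "I \<subseteq> \<tau> ` J"
    proof
      fix t assume t: "t \<in> I"
      obtain s where s: "r s = \<xi> t" using r(2) by (metis surjD)
      then have "s \<in> J" "\<tau> s = t" using t inj by (auto simp: J_def \<tau>_def inv_into_f_f)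
      then show "t \<in> \<tau> ` J" by auto
    qed
  qed
  have "interior J \<noteq> {}"
  proof -
    obtain x d where "d > 0" "ball x d \<subseteq> I"
      using I(2) by (meson ex_in_conv mem_interior)
    then have "x \<in> I" "x + d / 2 \<in> I" "x \<noteq> x + d / 2"
      using subsetD[of "ball x d" I x] subsetD[of "ball x d" I "x + d / 2"] by (simp_all add: dist_real_def)
    moreover from this im obtain a b where "a \<in> J" "\<tau> a = x" "b \<in> J" "\<tau> b = x + d / 2"
      by (metis imageE)
    ultimately have ab: "a \<in> J" "b \<in> J" "a \<noteq> b" by auto
    define l where "l = min a b"
    define u where "u = max a b"
    have lu: "l \<in> J" "u \<in> J" "l < u" using ab by (auto simp: l_def u_def min_def max_def)
    then have "{l<..<u} \<subseteq> J" using interval_subset[OF J lu(1,2)] by force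
    then have "{l<..<u} \<subseteq> interior J" by (simp add: interior_maximal)
    then show ?thesis using lu(3) by (metis greaterThanLessThan_empty_iff not_less subset_empty)
  qed
  then show ?thesis using that[of J \<tau>] J mono im \<xi>\<tau> by blast
qed

lemma strict_mono_surj_join:
  fixes r1 r2 :: "real \<Rightarrow> real"
  assumes "strict_mono r1" "surj r1" "strict_mono r2" "surj r2" "r1 0 = 0" "r2 0 = 0"
  defines "r \<equiv> \<lambda>s. if 0 \<le> s then r2 s else r1 s"
  shows "strict_mono r" "surj r"
proof -
  have neg: "s < 0 \<longleftrightarrow> r1 s < 0" and pos: "0 \<le> s \<longleftrightarrow> 0 \<le> r2 s" for s
    using assms strict_mono_less[of r1 s 0] strict_mono_less_eq[of r2 0 s] by auto
  show "strict_mono r"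
  proof (rule strict_monoI)
    fix x y :: real assume "x < y"
    then show "r x < r y"
      using neg[of x] pos[of y] strict_monoD[OF assms(1) \<open>x < y\<close>] strict_monoD[OF assms(3) \<open>x < y\<close>]
      by (auto simp: r_def)
  qed
  have "\<exists>s. r s = y" for y
  proof (cases "0 \<le> y")
    case True
    obtain s where "r2 s = y" using assms(4) by (metis surjD)
    then show ?thesis using True pos[of s] by (auto simp: r_def)
  next
    case False
    obtain s where "r1 s = y" using assms(2) by (metis surjD)
    then show ?thesis using False neg[of s] by (intro exI[of _ s]) (auto simp: r_def)
  qed
  then show "surj r" by (metis surj_def)
qed

context crossing_sliding
begin

text \<open>Along a leaf the field is a function of the position \<open>e x\<close>, so the parametrization by time solves a scalar
  autonomous equation.\<close>

lemma leaf_trajectory: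
  assumes H_cont: "continuous_on UNIV H" and H_i: "\<And>p. m \<le> e * H p $ i \<and> e * H p $ i \<le> K"
    and u: "\<And>x. (u has_real_derivative H (pt i x (u x)) $ j / H (pt i x (u x)) $ i) (at x)"
  obtains \<delta> where "\<delta> 0 = pt i 0 (u 0)" "\<And>s. (\<delta> has_vector_derivative H (\<delta> s)) (at s)"
    "strict_mono (\<lambda>s. e * \<delta> s $ i)" "surj (\<lambda>s. e * \<delta> s $ i)" "\<And>s. \<delta> s $ j = u (\<delta> s $ i)"
proof -
  have u_cont: "continuous_on S u" for S
    using u DERIV_isCont continuous_at_imp_continuous_on by blast
  have \<psi>: "continuous_on UNIV (\<lambda>v. e * H (pt i (e * v) (u (e * v))) $ i)"
    by (intro continuous_intros continuous_on_compose2[OF H_cont] continuous_on_compose2[OF u_cont[of UNIV]]) auto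
  obtain R where R: "R 0 = 0" "\<And>s. (R has_real_derivative e * H (pt i (e * R s) (u (e * R s))) $ i) (at s)"
      "strict_mono R" "surj R"
    by (rule autonomous_flow[OF \<psi> m_pos H_i]) (rule that)
  define \<delta> where "\<delta> s = pt i (e * R s) (u (e * R s))" for s
  have \<delta>i: "\<delta> s $ i = e * R s" and \<delta>j: "\<delta> s $ j = u (e * R s)" for s
    using ij by (auto simp: \<delta>_def pt_nth)
  have ed: "((\<lambda>s. e * R s) has_real_derivative H (\<delta> s) $ i) (at s)" for s
    using DERIV_cmult[OF R(2)[of s], of e] by (simp add: ee \<delta>_def flip: mult.assoc)
  have "(\<delta> has_vector_derivative H (\<delta> s)) (at s)" for s
  proof -
    have "H (\<delta> s) $ i \<noteq> 0" using H_i[of "\<delta> s"] m_pos by auto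
    then have "((\<lambda>s. u (e * R s)) has_real_derivative H (\<delta> s) $ j) (at s)"
      using DERIV_chain2[OF u ed[of s]] by (simp add: \<delta>_def)
    from has_vector_derivative_pt[OF ed this, of i]
    show ?thesis unfolding \<delta>_def[symmetric] pt_eta[OF ij] by (simp add: \<delta>_def[abs_def])
  qed
  moreover have "\<delta> 0 = pt i 0 (u 0)" by (simp add: \<delta>_def R)
  moreover have "(\<lambda>s. e * \<delta> s $ i) = R" by (auto simp: \<delta>i ee)
  moreover have "\<delta> s $ j = u (\<delta> s $ i)" for s by (simp add: \<delta>i \<delta>j)
  ultimately show ?thesis using that R by metis
qed

text \<open>The curve follows \<open>u1\<close> before and \<open>u2\<close> after it meets the line \<open>x = 0\<close>. The time is normalized so that this
  meeting happens at time \<open>0\<close>, even if the curve itself stays on one side of the line; then both cases are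
  covered by the same motion.\<close>

lemma crossing_reparametrization:
  fixes I :: "real set"
  assumes I: "is_interval I" "interior I \<noteq> {}" and c: "continuous_on I \<gamma>" and mono: "strict_mono_on I (\<lambda>t. e * \<gamma> t $ i)"
    and H1: "continuous_on UNIV H1" "\<And>p. m \<le> e * H1 p $ i \<and> e * H1 p $ i \<le> K"
      "\<And>x. (u1 has_real_derivative H1 (pt i x (u1 x)) $ j / H1 (pt i x (u1 x)) $ i) (at x)"
    and H2: "continuous_on UNIV H2" "\<And>p. m \<le> e * H2 p $ i \<and> e * H2 p $ i \<le> K"
      "\<And>x. (u2 has_real_derivative H2 (pt i x (u2 x)) $ j / H2 (pt i x (u2 x)) $ i) (at x)"
    and u0: "u1 0 = u2 0"
    and on1: "\<And>t. t \<in> I \<Longrightarrow> e * \<gamma> t $ i \<le> 0 \<Longrightarrow> \<gamma> t $ j = u1 (\<gamma> t $ i)"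
    and on2: "\<And>t. t \<in> I \<Longrightarrow> e * \<gamma> t $ i \<ge> 0 \<Longrightarrow> \<gamma> t $ j = u2 (\<gamma> t $ i)"
  obtains J \<tau> where "is_interval J" "interior J \<noteq> {}" "strict_mono_on J \<tau>" "\<tau> ` J = I" "continuous_on J (\<gamma> \<circ> \<tau>)"
    "\<And>s. s \<in> J \<Longrightarrow> s < 0 \<Longrightarrow> e * (\<gamma> \<circ> \<tau>) s $ i < 0 \<and> ((\<gamma> \<circ> \<tau>) has_vector_derivative H1 ((\<gamma> \<circ> \<tau>) s)) (at s within J)"
    "\<And>s. s \<in> J \<Longrightarrow> s > 0 \<Longrightarrow> e * (\<gamma> \<circ> \<tau>) s $ i > 0 \<and> ((\<gamma> \<circ> \<tau>) has_vector_derivative H2 ((\<gamma> \<circ> \<tau>) s)) (at s within J)"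
    "0 \<in> J \<Longrightarrow> (\<gamma> \<circ> \<tau>) 0 $ i = 0 \<and> ((\<gamma> \<circ> \<tau>) has_vector_derivative H1 ((\<gamma> \<circ> \<tau>) 0)) (at 0 within J \<inter> {..0})
        \<and> ((\<gamma> \<circ> \<tau>) has_vector_derivative H2 ((\<gamma> \<circ> \<tau>) 0)) (at 0 within J \<inter> {0..})"
proof -
  obtain d1 where d1: "d1 0 = pt i 0 (u1 0)" "\<And>s. (d1 has_vector_derivative H1 (d1 s)) (at s)"
    "strict_mono (\<lambda>s. e * d1 s $ i)" "surj (\<lambda>s. e * d1 s $ i)" "\<And>s. d1 s $ j = u1 (d1 s $ i)"
    by (rule leaf_trajectory[OF H1]) (rule that)
  obtain d2 where d2: "d2 0 = pt i 0 (u2 0)" "\<And>s. (d2 has_vector_derivative H2 (d2 s)) (at s)"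
    "strict_mono (\<lambda>s. e * d2 s $ i)" "surj (\<lambda>s. e * d2 s $ i)" "\<And>s. d2 s $ j = u2 (d2 s $ i)"
    by (rule leaf_trajectory[OF H2]) (rule that)
  define r where "r s = (if 0 \<le> s then e * d2 s $ i else e * d1 s $ i)" for s
  have r: "strict_mono r" "surj r"
    unfolding r_def using strict_mono_surj_join[OF d1(3,4) d2(3,4)] d1(1) d2(1) by (auto simp: pt_nth)
  have r0: "r 0 = 0" by (simp add: r_def d2(1) pt_nth)
  have ci: "continuous_on I (\<lambda>t. e * \<gamma> t $ i)" by (intro continuous_intros c)
  obtain J \<tau> where J: "is_interval J" "interior J \<noteq> {}" "strict_mono_on J \<tau>" "\<tau> ` J = I"
      and \<tau>: "\<And>s. s \<in> J \<Longrightarrow> e * \<gamma> (\<tau> s) $ i = r s"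
    by (rule reparametrize_onto[OF I ci mono r]) (rule that)
  define \<beta> where "\<beta> = \<gamma> \<circ> \<tau>"
  have \<tau>I: "\<tau> s \<in> I" if "s \<in> J" for s using that J(4) by blast
  have \<beta>2: "\<beta> s = d2 s" if "s \<in> J" "s \<ge> 0" for s
  proof -
    have "e * \<beta> s $ i = e * d2 s $ i" using \<tau>[OF that(1)] that by (simp add: \<beta>_def r_def)
    then have eq: "\<beta> s $ i = d2 s $ i" using ee by simp
    have "r s \<ge> 0" using r(1) r0 that by (metis strict_mono_less_eq)
    then have "\<beta> s $ j = u2 (\<beta> s $ i)" using on2[OF \<tau>I[OF that(1)]] \<tau>[OF that(1)] by (simp add: \<beta>_def)
    then show ?thesis using eq d2(5) by (simp add: plane_eq_iff[OF ij])
  qed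
  have \<beta>1: "\<beta> s = d1 s" if "s \<in> J" "s \<le> 0" for s
  proof -
    have "d1 0 = d2 0" using d1(1) d2(1) u0 by simp
    then have "e * \<beta> s $ i = e * d1 s $ i" using \<tau>[OF that(1)] that by (cases "s = 0") (auto simp: \<beta>_def r_def)
    then have eq: "\<beta> s $ i = d1 s $ i" using ee by simp
    have "r s \<le> 0" using r(1) r0 that by (metis strict_mono_less_eq)
    then have "\<beta> s $ j = u1 (\<beta> s $ i)" using on1[OF \<tau>I[OF that(1)]] \<tau>[OF that(1)] by (simp add: \<beta>_def)
    then show ?thesis using eq d1(5) by (simp add: plane_eq_iff[OF ij])
  qed
  have D1: "(\<beta> has_vector_derivative H1 (\<beta> s)) (at s within J \<inter> {..0})" if "s \<in> J" "s \<le> 0" for s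
  proof (rule has_vector_derivative_transform[where f=d1])
    show "(d1 has_vector_derivative H1 (\<beta> s)) (at s within J \<inter> {..0})"
      using d1(2)[of s] \<beta>1[OF that] by (simp add: has_vector_derivative_at_within)
  qed (use that \<beta>1 in auto)
  have D2: "(\<beta> has_vector_derivative H2 (\<beta> s)) (at s within J \<inter> {0..})" if "s \<in> J" "s \<ge> 0" for s
  proof (rule has_vector_derivative_transform[where f=d2])
    show "(d2 has_vector_derivative H2 (\<beta> s)) (at s within J \<inter> {0..})"
      using d2(2)[of s] \<beta>2[OF that] by (simp add: has_vector_derivative_at_within)
  qed (use that \<beta>2 in auto)
  have loc1: "at s within J \<inter> {..0} = at s within J" if "s < 0" for s
    by (rule at_within_nhd[of s "{..<0}"]) (use that in auto)
  have loc2: "at s within J \<inter> {0..} = at s within J" if "s > 0" for s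
    by (rule at_within_nhd[of s "{0<..}"]) (use that in auto)
  have sg: "s \<in> J \<Longrightarrow> e * \<beta> s $ i = r s" for s using \<tau> by (simp add: \<beta>_def)
  have 1: "e * \<beta> s $ i < 0 \<and> (\<beta> has_vector_derivative H1 (\<beta> s)) (at s within J)" if "s \<in> J" "s < 0" for s
    using D1[of s] loc1[of s] that sg r(1) r0 by (metis less_imp_le strict_mono_less)
  have 2: "e * \<beta> s $ i > 0 \<and> (\<beta> has_vector_derivative H2 (\<beta> s)) (at s within J)" if "s \<in> J" "s > 0" for s
    using D2[of s] loc2[of s] that sg r(1) r0 by (metis less_imp_le strict_mono_less)
  have 3: "\<beta> 0 $ i = 0 \<and> (\<beta> has_vector_derivative H1 (\<beta> 0)) (at 0 within J \<inter> {..0})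
        \<and> (\<beta> has_vector_derivative H2 (\<beta> 0)) (at 0 within J \<inter> {0..})" if "0 \<in> J"
    using D1[OF that] D2[OF that] sg[OF that] r0 ee(3) by simp
  have "continuous_on J \<beta>"
  proof -
    have "continuous (at s within J) \<beta>" if "s \<in> J" for s
    proof -
      consider "s < 0" | "s > 0" | "s = 0" by linarith
      then show ?thesis
      proof cases
        case 3
        have "at s within J = sup (at s within J \<inter> {..0}) (at s within J \<inter> {0..})"
          unfolding at_within_union[symmetric] by (rule arg_cong[where f="\<lambda>S. at s within S"]) auto
        moreover have "(\<beta> \<longlongrightarrow> \<beta> s) (at s within J \<inter> {..0})" "(\<beta> \<longlongrightarrow> \<beta> s) (at s within J \<inter> {0..})"
          using D1[OF that] D2[OF that] 3 has_vector_derivative_continuous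
          by (auto simp: continuous_within)
        ultimately show ?thesis unfolding continuous_within by (simp add: filterlim_sup)
      qed (use 1 2 that has_vector_derivative_continuous in blast)+
    qed
    then show ?thesis by (simp add: continuous_on_eq_continuous_within)
  qed
  then show ?thesis using that[OF J(1-4)] 1 2 3 by (simp flip: \<beta>_def)
qed

text \<open>The sliding motion passes through the origin with positive speed, so it is there
  at one instant only, as the clause for the origin demands.\<close>

lemma sliding_reparametrization:
  assumes lc: "leaf_curve I \<gamma>" and z: "\<forall>t\<in>I. \<gamma> t $ j = 0"
  shows "\<exists>J \<tau>. strict_mono_on J \<tau> \<and> \<tau> ` J = I \<and> regular_curve (X, Y) V J (\<gamma> \<circ> \<tau>)"
proof -
  have I: "is_interval I" "interior I \<noteq> {}" and c: "continuous_on I \<gamma>" and V: "\<gamma> ` I \<subseteq> V"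
    and mono: "strict_mono_on I (\<lambda>t. e * \<gamma> t $ i)"
    using lc unfolding leaf_curve_def by blast+
  have \<psi>: "continuous_on UNIV (\<lambda>v. e * slide (pt i (e * v) 0))"
    by (intro continuous_intros continuous_on_compose2[OF slide_cont]) auto
  obtain r where r: "r 0 = 0" "\<And>s. (r has_real_derivative e * slide (pt i (e * r s) 0)) (at s)"
      "strict_mono r" "surj r"
    by (rule autonomous_flow[OF \<psi> m_pos conjI[OF slide_bounds]]) (rule that)
  have ci: "continuous_on I (\<lambda>t. e * \<gamma> t $ i)" by (intro continuous_intros c)
  obtain J \<tau> where J: "is_interval J" "interior J \<noteq> {}" "strict_mono_on J \<tau>" "\<tau> ` J = I"
      and \<tau>: "\<And>s. s \<in> J \<Longrightarrow> e * \<gamma> (\<tau> s) $ i = r s"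
    by (rule reparametrize_onto[OF I ci mono r(3,4)]) (rule that)
  define \<beta> where "\<beta> = \<gamma> \<circ> \<tau>"
  define \<delta> where "\<delta> s = pt i (e * r s) 0" for s
  have \<tau>I: "\<tau> s \<in> I" if "s \<in> J" for s using that J(4) by blast
  have \<beta>: "\<beta> s = \<delta> s" if "s \<in> J" for s
  proof -
    have "\<beta> s $ i = e * r s" using \<tau>[OF that] ee by (metis \<beta>_def comp_apply)
    moreover have "\<beta> s $ j = 0" using z \<tau>I[OF that] by (simp add: \<beta>_def)
    ultimately show ?thesis using ij by (simp add: plane_eq_iff[OF ij] \<delta>_def pt_nth)
  qed
  have D\<delta>: "(\<delta> has_vector_derivative pt i (slide (\<delta> s)) 0) (at s)" for s
  proof -
    have "((\<lambda>s. e * r s) has_real_derivative slide (\<delta> s)) (at s)"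
      using DERIV_cmult[OF r(2)[of s], of e] by (simp add: ee \<delta>_def flip: mult.assoc)
    from has_vector_derivative_pt[OF this, of "\<lambda>_. 0" 0 i] show ?thesis by (simp add: \<delta>_def[abs_def])
  qed
  have D\<beta>: "(\<beta> has_vector_derivative pt i (slide (\<beta> s)) 0) (at s within J)" if "s \<in> J" for s
  proof (rule has_vector_derivative_transform[where f=\<delta>])
    show "(\<delta> has_vector_derivative pt i (slide (\<beta> s)) 0) (at s within J)"
      using D\<delta>[of s] \<beta>[OF that] by (simp add: has_vector_derivative_at_within)
  qed (use that \<beta> in auto)
  have "step J \<beta> s" if s: "s \<in> J" for s
  proof (cases "s = 0")
    case True
    have nz: "r s' \<noteq> 0" if "s' \<noteq> s" for s' using r(1,3) True that by (metis strict_mono_eq)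
    have "\<beta> s = 0" using \<beta>[OF s] True ij by (simp add: \<delta>_def r plane_eq_iff[OF ij] pt_nth)
    moreover have "\<forall>\<^sub>F s' in at s within J. \<beta> s' $ j = 0 \<and> \<beta> s' $ i \<noteq> 0"
      using nz \<beta> ij ee(3) by (auto simp: eventually_at_filter \<delta>_def pt_nth)
    ultimately show ?thesis by (simp add: step_def)
  next
    case False
    then have "r s \<noteq> 0" using r(1,3) by (metis strict_mono_eq)
    then have "\<beta> s $ i \<noteq> 0" "\<beta> s $ j = 0" using \<beta>[OF s] ij ee(3) by (auto simp: \<delta>_def pt_nth)
    moreover have "\<forall>\<^sub>F s' in at s within J. \<beta> s' $ j = 0"
      using \<beta> ij by (auto simp: eventually_at_filter \<delta>_def pt_nth)
    ultimately show ?thesis using D\<beta>[OF s] by (simp add: step_def)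
  qed
  moreover have "continuous_on J \<beta>"
    using D\<beta> has_vector_derivative_continuous continuous_on_eq_continuous_within by blast
  moreover have "\<beta> ` J \<subseteq> V" using V \<tau>I by (auto simp: \<beta>_def)
  ultimately have "regular_curve (X, Y) V J \<beta>" using J by (simp add: regular_curve_iff_step)
  then show ?thesis using J by (auto simp: \<beta>_def)
qed

lemma F_leaf: "(F.leaf 0 w has_real_derivative F (pt i x (F.leaf 0 w x)) $ j / F (pt i x (F.leaf 0 w x)) $ i) (at x)"
  using F.leaf(2) unfolding F.solution_def by blast

lemma G_leaf: "(G.leaf 0 w has_real_derivative G (pt i x (G.leaf 0 w x)) $ j / G (pt i x (G.leaf 0 w x)) $ i) (at x)"
  using G.leaf(2) unfolding G.solution_def by blast

lemma constant_sign:
  fixes y :: "real \<Rightarrow> real"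
  assumes "is_interval I" "continuous_on I y" "\<forall>t\<in>I. y t \<noteq> 0"
  shows "(\<forall>t\<in>I. y t > 0) \<or> (\<forall>t\<in>I. y t < 0)"
proof (rule ccontr)
  assume "\<not> ?thesis"
  then obtain a b where "a \<in> I" "b \<in> I" "y a < 0" "y b > 0"
    using assms(3) linorder_less_linear by (auto simp: not_less le_less)
  moreover have "connected (y ` I)"
    using assms by (simp add: connected_continuous_image is_interval_connected_1)
  ultimately have "0 \<in> y ` I"
    using connectedD_interval[of "y ` I" "y a" "y b" 0] by simp
  then show False using assms(3) by auto
qed

text \<open>With \<open>\<sigma>\<close> the sign of \<open>y\<close>, the sign of \<open>xy\<close> is that of \<open>(e \<sigma>) (e x)\<close>, and \<open>e x\<close> increases with time.
  So \<open>e \<sigma>\<close> decides which field is followed first.\<close>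

lemma leaf_curve_imp_regular_curve:
  assumes lc: "leaf_curve I \<gamma>"
  shows "\<exists>J \<tau>. strict_mono_on J \<tau> \<and> \<tau> ` J = I \<and> regular_curve (X, Y) V J (\<gamma> \<circ> \<tau>)"
proof (cases "\<forall>t\<in>I. \<gamma> t $ j = 0")
  case True
  then show ?thesis using sliding_reparametrization lc by blast
next
  case False
  have I: "is_interval I" "interior I \<noteq> {}" and c: "continuous_on I \<gamma>" and V: "\<gamma> ` I \<subseteq> V"
    and mono: "strict_mono_on I (\<lambda>t. e * \<gamma> t $ i)" and nz: "\<forall>t\<in>I. \<gamma> t $ j \<noteq> 0"
    and lab: "\<forall>s\<in>I. \<forall>t\<in>I. leaf_label (\<gamma> s) = leaf_label (\<gamma> t)"
    using lc False unfolding leaf_curve_def by blast+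
  obtain t0 where "t0 \<in> I" using I(2) interior_subset by blast
  define w where "w = leaf_label (\<gamma> t0)"
  have w: "leaf_label (\<gamma> t) = w" if "t \<in> I" for t using lab that \<open>t0 \<in> I\<close> unfolding w_def by blast
  have onF: "\<gamma> t $ j = F.leaf 0 w (\<gamma> t $ i)" if "t \<in> I" "\<gamma> t $ i * \<gamma> t $ j \<ge> 0" for t
    using w[OF that(1)] that(2) F.leaf_label[of "\<gamma> t $ i" "\<gamma> t $ j"] by (simp add: leaf_label_def labF_def)
  have onG: "\<gamma> t $ j = G.leaf 0 w (\<gamma> t $ i)" if "t \<in> I" "\<gamma> t $ i * \<gamma> t $ j \<le> 0" for t
    using w[OF that(1)] that nz leaf_label_G[of "\<gamma> t"] G.leaf_label[of "\<gamma> t $ i" "\<gamma> t $ j"] by (simp add: labG_def)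
  have w0: "F.leaf 0 w 0 = G.leaf 0 w 0" by (simp add: F.leaf G.leaf)
  have cj: "continuous_on I (\<lambda>t. \<gamma> t $ j)" using c by (intro continuous_intros)
  obtain \<sigma> :: real where \<sigma>: "\<sigma> = 1 \<or> \<sigma> = -1" "\<And>t. t \<in> I \<Longrightarrow> \<sigma> * \<gamma> t $ j > 0"
    using constant_sign[OF I(1) cj nz] that[of 1] that[of "-1"] by auto
  have sg: "(\<gamma> t $ i * \<gamma> t $ j > 0) = ((e * \<sigma>) * (e * \<gamma> t $ i) > 0)"
       "(\<gamma> t $ i * \<gamma> t $ j < 0) = ((e * \<sigma>) * (e * \<gamma> t $ i) < 0)" if "t \<in> I" for t
  proof -
    have eq: "(e * \<sigma>) * (e * \<gamma> t $ i) = \<sigma> * \<gamma> t $ i"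
      using e by (elim disjE) simp_all
    have "(\<sigma> = 1 \<and> \<gamma> t $ j > 0) \<or> (\<sigma> = -1 \<and> \<gamma> t $ j < 0)"
      using \<sigma>(1) \<sigma>(2)[OF that] by auto
    then show "(\<gamma> t $ i * \<gamma> t $ j > 0) = ((e * \<sigma>) * (e * \<gamma> t $ i) > 0)"
       "(\<gamma> t $ i * \<gamma> t $ j < 0) = ((e * \<sigma>) * (e * \<gamma> t $ i) < 0)"
      unfolding eq by (elim disjE conjE; simp add: zero_less_mult_iff mult_less_0_iff)+
  qed
  have fin: ?thesis
    if J: "is_interval J" "interior J \<noteq> {}" "strict_mono_on J \<tau>" "\<tau> ` J = I" "continuous_on J (\<gamma> \<circ> \<tau>)"
      and st: "\<And>s. s \<in> J \<Longrightarrow> step J (\<gamma> \<circ> \<tau>) s" for J \<tau>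
  proof -
    have "(\<gamma> \<circ> \<tau>) ` J \<subseteq> V" using J(4) V by auto
    then have "regular_curve (X, Y) V J (\<gamma> \<circ> \<tau>)" using J st by (simp add: regular_curve_iff_step)
    then show ?thesis using J by blast
  qed
  show ?thesis
  proof (cases "e * \<sigma> = 1")
    case True
    have sgF: "(\<gamma> t $ i * \<gamma> t $ j > 0) = (e * \<gamma> t $ i > 0)" "(\<gamma> t $ i * \<gamma> t $ j < 0) = (e * \<gamma> t $ i < 0)" if "t \<in> I" for t
      using sg[OF that] True by simp_all
    have on1: "\<gamma> t $ j = G.leaf 0 w (\<gamma> t $ i)" if "t \<in> I" "e * \<gamma> t $ i \<le> 0" for t
      using onG that sgF[OF that(1)] by (meson not_less)
    have on2: "\<gamma> t $ j = F.leaf 0 w (\<gamma> t $ i)" if "t \<in> I" "e * \<gamma> t $ i \<ge> 0" for t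
      using onF that sgF[OF that(1)] by (meson not_less)
    obtain J \<tau> where J: "is_interval J" "interior J \<noteq> {}" "strict_mono_on J \<tau>" "\<tau> ` J = I" "continuous_on J (\<gamma> \<circ> \<tau>)"
      and bef: "\<And>s. s \<in> J \<Longrightarrow> s < 0 \<Longrightarrow> e * (\<gamma> \<circ> \<tau>) s $ i < 0 \<and> ((\<gamma> \<circ> \<tau>) has_vector_derivative G ((\<gamma> \<circ> \<tau>) s)) (at s within J)"
      and aft: "\<And>s. s \<in> J \<Longrightarrow> s > 0 \<Longrightarrow> e * (\<gamma> \<circ> \<tau>) s $ i > 0 \<and> ((\<gamma> \<circ> \<tau>) has_vector_derivative F ((\<gamma> \<circ> \<tau>) s)) (at s within J)"
      and now: "0 \<in> J \<Longrightarrow> (\<gamma> \<circ> \<tau>) 0 $ i = 0 \<and> ((\<gamma> \<circ> \<tau>) has_vector_derivative G ((\<gamma> \<circ> \<tau>) 0)) (at 0 within J \<inter> {..0})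
        \<and> ((\<gamma> \<circ> \<tau>) has_vector_derivative F ((\<gamma> \<circ> \<tau>) 0)) (at 0 within J \<inter> {0..})"
      by (rule crossing_reparametrization[OF I c mono G_cont G_i G_leaf F_cont F_i F_leaf w0[symmetric]]) (rule on1, assumption+, rule on2, assumption+, rule that)
    have \<tau>I: "\<tau> s \<in> I" if "s \<in> J" for s using that J(4) by blast
    show ?thesis
    proof (rule fin[OF J])
      fix s assume s: "s \<in> J"
      consider "s < 0" | "s > 0" | "s = 0" by linarith
      then show "step J (\<gamma> \<circ> \<tau>) s"
      proof cases
        case 1 then show ?thesis using bef[OF s] sgF[OF \<tau>I[OF s]] by (simp add: step_def)
      next
        case 2 then show ?thesis using aft[OF s] sgF[OF \<tau>I[OF s]] by (simp add: step_def)
      next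
        case 3
        have "\<forall>\<^sub>F r in at s within (J \<inter> {..s}). (\<gamma> \<circ> \<tau>) r \<in> {p. p $ i * p $ j < 0}"
          using bef sgF \<tau>I 3 by (auto simp: eventually_at_filter)
        moreover have "\<forall>\<^sub>F r in at s within (J \<inter> {s..}). (\<gamma> \<circ> \<tau>) r \<in> {p. p $ i * p $ j > 0}"
          using aft sgF \<tau>I 3 by (auto simp: eventually_at_filter)
        ultimately have "crosses_at G {p. p $ i * p $ j < 0} F {p. p $ i * p $ j > 0} J (\<gamma> \<circ> \<tau>) s"
          using now s 3 unfolding crosses_at_def by simp
        moreover have "(\<gamma> \<circ> \<tau>) s $ i = 0" "(\<gamma> \<circ> \<tau>) s $ j \<noteq> 0" using now s 3 nz \<tau>I[OF s] by auto
        ultimately show ?thesis unfolding step_def by blast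
      qed
    qed
  next
    case False
    then have "e * \<sigma> = -1" using \<sigma>(1) e by auto
    then have sgG: "(\<gamma> t $ i * \<gamma> t $ j > 0) = (e * \<gamma> t $ i < 0)" "(\<gamma> t $ i * \<gamma> t $ j < 0) = (e * \<gamma> t $ i > 0)" if "t \<in> I" for t
      using sg[OF that] by simp_all
    have on1: "\<gamma> t $ j = F.leaf 0 w (\<gamma> t $ i)" if "t \<in> I" "e * \<gamma> t $ i \<le> 0" for t
      using onF that sgG[OF that(1)] by (meson not_less)
    have on2: "\<gamma> t $ j = G.leaf 0 w (\<gamma> t $ i)" if "t \<in> I" "e * \<gamma> t $ i \<ge> 0" for t
      using onG that sgG[OF that(1)] by (meson not_less)
    obtain J \<tau> where J: "is_interval J" "interior J \<noteq> {}" "strict_mono_on J \<tau>" "\<tau> ` J = I" "continuous_on J (\<gamma> \<circ> \<tau>)"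
      and bef: "\<And>s. s \<in> J \<Longrightarrow> s < 0 \<Longrightarrow> e * (\<gamma> \<circ> \<tau>) s $ i < 0 \<and> ((\<gamma> \<circ> \<tau>) has_vector_derivative F ((\<gamma> \<circ> \<tau>) s)) (at s within J)"
      and aft: "\<And>s. s \<in> J \<Longrightarrow> s > 0 \<Longrightarrow> e * (\<gamma> \<circ> \<tau>) s $ i > 0 \<and> ((\<gamma> \<circ> \<tau>) has_vector_derivative G ((\<gamma> \<circ> \<tau>) s)) (at s within J)"
      and now: "0 \<in> J \<Longrightarrow> (\<gamma> \<circ> \<tau>) 0 $ i = 0 \<and> ((\<gamma> \<circ> \<tau>) has_vector_derivative F ((\<gamma> \<circ> \<tau>) 0)) (at 0 within J \<inter> {..0})
        \<and> ((\<gamma> \<circ> \<tau>) has_vector_derivative G ((\<gamma> \<circ> \<tau>) 0)) (at 0 within J \<inter> {0..})"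
      by (rule crossing_reparametrization[OF I c mono F_cont F_i F_leaf G_cont G_i G_leaf w0]) (rule on1, assumption+, rule on2, assumption+, rule that)
    have \<tau>I: "\<tau> s \<in> I" if "s \<in> J" for s using that J(4) by blast
    show ?thesis
    proof (rule fin[OF J])
      fix s assume s: "s \<in> J"
      consider "s < 0" | "s > 0" | "s = 0" by linarith
      then show "step J (\<gamma> \<circ> \<tau>) s"
      proof cases
        case 1 then show ?thesis using bef[OF s] sgG[OF \<tau>I[OF s]] by (simp add: step_def)
      next
        case 2 then show ?thesis using aft[OF s] sgG[OF \<tau>I[OF s]] by (simp add: step_def)
      next
        case 3
        have "\<forall>\<^sub>F r in at s within (J \<inter> {..s}). (\<gamma> \<circ> \<tau>) r \<in> {p. p $ i * p $ j > 0}"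
          using bef sgG \<tau>I 3 by (auto simp: eventually_at_filter)
        moreover have "\<forall>\<^sub>F r in at s within (J \<inter> {s..}). (\<gamma> \<circ> \<tau>) r \<in> {p. p $ i * p $ j < 0}"
          using aft sgG \<tau>I 3 by (auto simp: eventually_at_filter)
        ultimately have "crosses_at F {p. p $ i * p $ j > 0} G {p. p $ i * p $ j < 0} J (\<gamma> \<circ> \<tau>) s"
          using now s 3 unfolding crosses_at_def by simp
        moreover have "(\<gamma> \<circ> \<tau>) s $ i = 0" "(\<gamma> \<circ> \<tau>) s $ j \<noteq> 0" using now s 3 nz \<tau>I[OF s] by auto
        ultimately show ?thesis unfolding step_def by blast
      qed
    qed
  qed
qed

end

text \<open>A constant trajectory sits at a point that no regular curve visits. Its image has the same property,
  because the inverse map brings regular curves back; this is why both directions are assumed.\<close>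

lemma maps_trajectories_if_leaf_curves:
  assumes C: "crossing_sliding i j F G L M e m K X Y V"
    and C': "crossing_sliding i j F' G' L' M' e m' K' X' Y' V'"
    and h: "\<And>I \<gamma>. crossing_sliding.leaf_curve i j F G e V I \<gamma> \<Longrightarrow> crossing_sliding.leaf_curve i j F' G' e V' I (h \<circ> \<gamma>)"
    and g: "\<And>I \<gamma>. crossing_sliding.leaf_curve i j F' G' e V' I \<gamma> \<Longrightarrow> crossing_sliding.leaf_curve i j F G e V I (g \<circ> \<gamma>)"
    and hV: "h ` V \<subseteq> V'" and gh: "\<And>p. p \<in> V \<Longrightarrow> g (h p) = p"
  shows "maps_trajectories h (X, Y) V (X', Y') V'"
proof -
  have *: "\<exists>J \<tau>. strict_mono_on J \<tau> \<and> \<tau> ` J = I \<and> regular_curve (X', Y') V' J (h \<circ> \<gamma> \<circ> \<tau>)"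
    if "regular_curve (X, Y) V I \<gamma>" for I \<gamma>
    using crossing_sliding.leaf_curve_imp_regular_curve[OF C' h[OF crossing_sliding.regular_curve_imp_leaf_curve[OF C that]]] .
  have **: "\<exists>J \<tau>. strict_mono_on J \<tau> \<and> \<tau> ` J = I \<and> regular_curve (X, Y) V J (g \<circ> \<gamma> \<circ> \<tau>)"
    if "regular_curve (X', Y') V' I \<gamma>" for I \<gamma>
    using crossing_sliding.leaf_curve_imp_regular_curve[OF C g[OF crossing_sliding.regular_curve_imp_leaf_curve[OF C' that]]] .
  show ?thesis
    unfolding maps_trajectories_def
  proof (intro allI impI)
    fix I \<gamma> assume "trajectory (X, Y) V I \<gamma>"
    then consider "regular_curve (X, Y) V I \<gamma>" |
      p where "is_interval I" "interior I \<noteq> {}" "p \<in> V" "\<forall>t\<in>I. \<gamma> t = p"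
        "\<And>J \<eta>. regular_curve (X, Y) V J \<eta> \<Longrightarrow> p \<notin> \<eta> ` J"
      unfolding trajectory_def by blast
    then show "\<exists>J \<tau>. strict_mono_on J \<tau> \<and> \<tau> ` J = I \<and> trajectory (X', Y') V' J (h \<circ> \<gamma> \<circ> \<tau>)"
    proof cases
      case 1
      then show ?thesis using * unfolding trajectory_def by blast
    next
      case 2
      have "h p \<notin> \<eta> ` J" if \<eta>: "regular_curve (X', Y') V' J \<eta>" for J \<eta>
      proof
        assume "h p \<in> \<eta> ` J"
        then obtain t where t: "t \<in> J" "\<eta> t = h p" by auto
        obtain J' \<tau> where J': "\<tau> ` J' = J" "regular_curve (X, Y) V J' (g \<circ> \<eta> \<circ> \<tau>)"
          using **[OF \<eta>] by blast
        obtain s where "s \<in> J'" "\<tau> s = t" using t J'(1) by blast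
        then have "p \<in> (g \<circ> \<eta> \<circ> \<tau>) ` J'"
          using gh[OF 2(3)] t by (intro image_eqI[of _ _ s]) auto
        then show False using 2(5)[OF J'(2)] by blast
      qed
      then have "trajectory (X', Y') V' I (h \<circ> \<gamma> \<circ> id)"
        using 2(1-4) hV unfolding trajectory_def by (intro disjI2 conjI bexI[of _ "h p"]) auto
      moreover have "strict_mono_on I id" by (simp add: strict_mono_on_def)
      ultimately show ?thesis by (intro exI[of _ I] exI[of _ id]) auto
    qed
  qed
qed

section \<open>Orientation and transfer of leaves\<close>

lemma of_complex_plane_nth: "of_complex_plane z $ 1 = Re z" "of_complex_plane z $ 2 = Im z"
  by (simp_all add: of_complex_plane_def)

lemma continuous_on_of_complex_plane: "continuous_on S of_complex_plane"
proof -
  have eq: "of_complex_plane z = Re z *\<^sub>R axis 1 1 + Im z *\<^sub>R axis 2 1" for z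
    by (simp add: plane_eq_iff[of 1 2] of_complex_plane_nth axis_def)
  show ?thesis unfolding eq[abs_def] by (intro continuous_intros)
qed

lemma continuous_on_to_complex: "continuous_on S to_complex"
proof -
  have eq: "to_complex p = of_real (p $ 1) + \<i> * of_real (p $ 2)" for p
    by (simp add: to_complex_def complex_eq_iff)
  show ?thesis unfolding eq[abs_def] by (intro continuous_intros)
qed

lemma dist_of_complex_plane: "dist (of_complex_plane z) p = cmod (z - to_complex p)"
proof -
  have "dist (of_complex_plane z) p = sqrt ((Re z - p $ 1)\<^sup>2 + (Im z - p $ 2)\<^sup>2)"
    by (simp add: dist_vec_def L2_set_def sum_2 of_complex_plane_nth dist_real_def)
  then show ?thesis by (simp add: cmod_def to_complex_def)
qed

text \<open>The convex combinations of \<open>q - p\<close> and \<open>h q - h p\<close> do not vanish, since the first nonzero component of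
  \<open>q - p\<close>, in the order \<open>i, j\<close>, has the same sign in both. Hence the straight-line homotopy between
  the image of a circle around \<open>p\<close> and a circle around \<open>h p\<close> avoids \<open>h p\<close>.\<close>

lemma orientation_preserving_if_monotone:
  fixes i j :: 2
  assumes ij: "i \<noteq> j" and "open V" and cont: "continuous_on V h"
    and hi: "\<And>p q. p \<in> V \<Longrightarrow> q \<in> V \<Longrightarrow> p $ i < q $ i \<Longrightarrow> h p $ i < h q $ i"
    and hj: "\<And>p q. p \<in> V \<Longrightarrow> q \<in> V \<Longrightarrow> p $ i = q $ i \<Longrightarrow> p $ j < q $ j \<Longrightarrow> h p $ i = h q $ i \<and> h p $ j < h q $ j"
  shows "orientation_preserving_on V h"
  unfolding orientation_preserving_on_def
proof
  fix p assume p: "p \<in> V"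
  obtain \<rho> where \<rho>: "\<rho> > 0" "cball p \<rho> \<subseteq> V" using \<open>open V\<close> p open_contains_cball by blast
  have no: "\<exists>k. (1 - u) * (q $ k - p $ k) + u * (h q $ k - h p $ k) \<noteq> 0"
    if q: "q \<in> V" "q \<noteq> p" and u: "0 \<le> u" "u \<le> 1" for q u
  proof -
    have pos: "(1 - u) * a + u * b > 0" if "a > 0" "b > 0" for a b :: real
      using that u by (cases "u = 0") (auto intro!: add_nonneg_pos mult_pos_pos)
    have neg: "(1 - u) * a + u * b < 0" if "a < 0" "b < 0" for a b :: real
      using pos[of "- a" "- b"] that by simp
    consider "p $ i < q $ i" | "q $ i < p $ i" | "p $ i = q $ i" "p $ j < q $ j" | "p $ i = q $ i" "q $ j < p $ j"
      using q(2) by (metis ij linorder_neqE_linordered_idom plane_eq_iff)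
    then show ?thesis
    proof cases
      case 1 then show ?thesis using pos[of "q $ i - p $ i" "h q $ i - h p $ i"] hi[OF p q(1)] by (intro exI[of _ i]) auto
    next
      case 2 then show ?thesis using neg[of "q $ i - p $ i" "h q $ i - h p $ i"] hi[OF q(1) p] by (intro exI[of _ i]) auto
    next
      case 3 then show ?thesis using pos[of "q $ j - p $ j" "h q $ j - h p $ j"] hj[OF p q(1)] by (intro exI[of _ j]) auto
    next
      case 4 then show ?thesis using neg[of "q $ j - p $ j" "h q $ j - h p $ j"] hj[OF q(1) p] by (intro exI[of _ j]) auto
    qed
  qed
  let ?c = "circlepath (to_complex p) \<rho>"
  let ?z = "to_complex (h p)"
  let ?f = "to_complex \<circ> h \<circ> of_complex_plane \<circ> ?c"
  have dc: "cmod (?c t - to_complex p) = \<rho>" for t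
    using \<rho>(1) by (simp add: circlepath norm_mult)
  have qV: "of_complex_plane (?c t) \<in> V" for t
    using \<rho>(2) dc[of t] dist_of_complex_plane[of "?c t" p] by (auto simp: dist_commute)
  have "winding_number ?f ?z = winding_number (circlepath ?z \<rho>) ?z"
  proof (rule winding_number_loops_linear_eq)
    have "continuous_on {0..1} ?c" using path_circlepath[of "to_complex p" \<rho>] by (simp add: path_def)
    then have "continuous_on {0..1} (of_complex_plane \<circ> ?c)"
      by (rule continuous_on_compose[OF _ continuous_on_of_complex_plane])
    then have "continuous_on {0..1} (h \<circ> (of_complex_plane \<circ> ?c))"
      by (rule continuous_on_compose) (use qV in \<open>auto intro: continuous_on_subset[OF cont]\<close>)
    then have "continuous_on {0..1} (to_complex \<circ> (h \<circ> (of_complex_plane \<circ> ?c)))"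
      by (rule continuous_on_compose[OF _ continuous_on_to_complex])
    then show "path ?f" by (simp add: path_def o_assoc)
    show "pathfinish ?f = pathstart ?f"
      using pathfinish_circlepath[of "to_complex p" \<rho>] pathstart_circlepath[of "to_complex p" \<rho>]
      by (simp add: pathfinish_def pathstart_def)
    fix t :: real
    define q where "q = of_complex_plane (?c t)"
    have q: "q \<in> V" "q \<noteq> p"
      using qV[of t] dc[of t] dist_of_complex_plane[of "?c t" p] \<rho>(1) by (auto simp: q_def)
    have ct: "?c t = to_complex q" by (simp add: q_def to_complex_def of_complex_plane_nth)
    have circ: "circlepath ?z \<rho> t = ?z + (to_complex q - to_complex p)"
      using ct by (simp add: circlepath algebra_simps)
    have ft: "?f t = to_complex (h q)" by (simp add: q_def)
    show "?z \<notin> closed_segment (circlepath ?z \<rho> t) (?f t)"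
    proof
      assume "?z \<in> closed_segment (circlepath ?z \<rho> t) (?f t)"
      then obtain u where u: "0 \<le> u" "u \<le> 1"
        and eq: "?z = (1 - u) *\<^sub>R (?z + (to_complex q - to_complex p)) + u *\<^sub>R to_complex (h q)"
        unfolding in_segment(1) circ ft by blast
      have "(1 - u) * (q $ 1 - p $ 1) + u * (h q $ 1 - h p $ 1) = 0"
        using arg_cong[OF eq, of Re] by (simp add: to_complex_def algebra_simps)
      moreover have "(1 - u) * (q $ 2 - p $ 2) + u * (h q $ 2 - h p $ 2) = 0"
        using arg_cong[OF eq, of Im] by (simp add: to_complex_def algebra_simps)
      moreover obtain k where "(1 - u) * (q $ k - p $ k) + u * (h q $ k - h p $ k) \<noteq> 0"
        using no[OF q u] by blast
      ultimately show False using exhaust_2[of k] by (elim disjE) simp_all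
    qed
  qed auto
  also have "\<dots> = 1" using \<rho>(1) by (rule winding_number_circlepath_centre)
  finally show "\<exists>\<rho>>0. cball p \<rho> \<subseteq> V \<and> winding_number (to_complex \<circ> h \<circ> of_complex_plane \<circ> circlepath (to_complex p) \<rho>) ?z = 1"
    using \<rho> by blast
qed

lemma leaf_curve_transfer:
  assumes C: "crossing_sliding i j F G L M e m K X Y V"
    and C': "crossing_sliding i j F' G' L' M' e m' K' X' Y' V'"
    and c: "continuous_on V \<phi>" and V: "\<phi> ` V \<subseteq> V'"
    and i: "\<And>p q. p \<in> V \<Longrightarrow> q \<in> V \<Longrightarrow> p $ i < q $ i \<Longrightarrow> \<phi> p $ i < \<phi> q $ i"
    and j: "\<And>p. p \<in> V \<Longrightarrow> \<phi> p $ j = 0 \<longleftrightarrow> p $ j = 0"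
    and lab: "\<And>p q. p \<in> V \<Longrightarrow> q \<in> V \<Longrightarrow> crossing_sliding.leaf_label i j F G p = crossing_sliding.leaf_label i j F G q \<Longrightarrow>
       crossing_sliding.leaf_label i j F' G' (\<phi> p) = crossing_sliding.leaf_label i j F' G' (\<phi> q)"
    and \<gamma>: "crossing_sliding.leaf_curve i j F G e V I \<gamma>"
  shows "crossing_sliding.leaf_curve i j F' G' e V' I (\<phi> \<circ> \<gamma>)"
proof -
  note * = \<gamma>[unfolded crossing_sliding.leaf_curve_def[OF C]]
  have e: "e = 1 \<or> e = -1" using crossing_sliding.e[OF C] .
  have \<gamma>V: "\<And>t. t \<in> I \<Longrightarrow> \<gamma> t \<in> V" and mono: "strict_mono_on I (\<lambda>t. e * \<gamma> t $ i)" using * by blast+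
  have "strict_mono_on I (\<lambda>t. e * (\<phi> \<circ> \<gamma>) t $ i)"
  proof (rule strict_mono_onI)
    fix a b assume ab: "a \<in> I" "b \<in> I" "a < b"
    have "e * \<gamma> a $ i < e * \<gamma> b $ i" using strict_mono_onD[OF mono ab] .
    then show "e * (\<phi> \<circ> \<gamma>) a $ i < e * (\<phi> \<circ> \<gamma>) b $ i"
      using e i[OF \<gamma>V[OF ab(1)] \<gamma>V[OF ab(2)]] i[OF \<gamma>V[OF ab(2)] \<gamma>V[OF ab(1)]] by auto
  qed
  moreover have "continuous_on I (\<phi> \<circ> \<gamma>)"
  proof (rule continuous_on_compose)
    show "continuous_on I \<gamma>" using * by blast
    show "continuous_on (\<gamma> ` I) \<phi>" by (rule continuous_on_subset[OF c]) (use \<gamma>V in auto)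
  qed
  moreover have "(\<forall>t\<in>I. (\<phi> \<circ> \<gamma>) t $ j = 0) \<or> ((\<forall>t\<in>I. (\<phi> \<circ> \<gamma>) t $ j \<noteq> 0) \<and>
      (\<forall>s\<in>I. \<forall>t\<in>I. crossing_sliding.leaf_label i j F' G' ((\<phi> \<circ> \<gamma>) s) = crossing_sliding.leaf_label i j F' G' ((\<phi> \<circ> \<gamma>) t)))"
  proof (cases "\<forall>t\<in>I. \<gamma> t $ j = 0")
    case True
    then show ?thesis using j \<gamma>V by simp
  next
    case False
    then have nz: "\<forall>t\<in>I. \<gamma> t $ j \<noteq> 0" and l: "\<forall>s\<in>I. \<forall>t\<in>I. crossing_sliding.leaf_label i j F G (\<gamma> s) = crossing_sliding.leaf_label i j F G (\<gamma> t)"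
      using * by blast+
    have "crossing_sliding.leaf_label i j F' G' ((\<phi> \<circ> \<gamma>) s) = crossing_sliding.leaf_label i j F' G' ((\<phi> \<circ> \<gamma>) t)" if "s \<in> I" "t \<in> I" for s t
      unfolding comp_apply by (rule lab[OF \<gamma>V[OF that(1)] \<gamma>V[OF that(2)]]) (use l that in blast)
    moreover have "\<forall>t\<in>I. (\<phi> \<circ> \<gamma>) t $ j \<noteq> 0" using nz j \<gamma>V by simp
    ultimately show ?thesis by blast
  qed
  moreover have "(\<phi> \<circ> \<gamma>) ` I \<subseteq> V'" using V \<gamma>V by auto
  moreover have "is_interval I" "interior I \<noteq> {}" using * by blast+
  ultimately show ?thesis unfolding crossing_sliding.leaf_curve_def[OF C'] by blast
qed

text \<open>Where the case distinction changes, the two values lie on different sides of \<open>0\<close>.\<close>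

lemma glued_monotone:
  fixes f1 f2 :: "real \<Rightarrow> real"
  assumes "f1 0 = 0" "f2 0 = 0" "\<And>y y'. y < y' \<Longrightarrow> f1 y < f1 y'" "\<And>y y'. y < y' \<Longrightarrow> f2 y < f2 y'" "y < y'"
  shows "(if 0 \<le> x * y then f1 y else f2 y) < (if 0 \<le> x * y' then f1 y' else f2 y')"
proof -
  consider "0 \<le> x * y \<longleftrightarrow> 0 \<le> x * y'" | "0 \<le> x * y" "x * y' < 0" | "x * y < 0" "0 \<le> x * y'" by linarith
  then show ?thesis
  proof cases
    case 1 then show ?thesis using assms by auto
  next
    case 2
    then have "y \<le> 0" "0 < y'" using assms(5) by (auto simp: zero_le_mult_iff mult_less_0_iff)
    then have "f1 y \<le> 0" "0 < f2 y'" using assms(1,2) assms(3)[of y 0] assms(4)[of 0 y'] by (auto simp: le_less)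
    then show ?thesis using 2 by auto
  next
    case 3
    then have "y < 0" "0 \<le> y'" using assms(5) by (auto simp: zero_le_mult_iff mult_less_0_iff)
    then have "f2 y < 0" "0 \<le> f1 y'" using assms(1,2) assms(4)[of y 0] assms(3)[of 0 y'] by (auto simp: le_less)
    then show ?thesis using 3 by auto
  qed
qed

section \<open>The homeomorphism\<close>

context crossing_sliding
begin

lemma slope_signs: "F p $ j / F p $ i < 0" "G p $ j / G p $ i > 0"
  using F_i[of p] G_i[of p] F_j[of p] G_j[of p] m_pos e
  by (auto simp: divide_less_0_iff zero_less_divide_iff)

text \<open>The axis \<open>x = 0\<close> is mapped by \<open>\<kappa>\<close>, the axis \<open>y = 0\<close> by \<open>x \<mapsto> \<kappa> (F.label x 0)\<close>. Subtracting the value of the foot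
  \<open>(x, 0)\<close> in the second component makes the image of the axis \<open>y = 0\<close> an axis again, and turns leaves into
  lines of a fixed slope as soon as \<open>\<kappa>\<close> conjugates the feet.\<close>

definition leaf_homeo :: "(real \<Rightarrow> real) \<Rightarrow> plane \<Rightarrow> plane" where
  "leaf_homeo \<kappa> p = pt i (\<kappa> (F.label (p $ i) 0))
     (if 0 \<le> p $ i * p $ j then \<kappa> (F.label (p $ i) (p $ j)) - \<kappa> (F.label (p $ i) 0)
      else \<kappa> (G.label (p $ i) (p $ j)) - \<kappa> (G.label (p $ i) 0))"

context
  fixes \<kappa> :: "real \<Rightarrow> real"
  assumes \<kappa>_cont: "continuous_on UNIV \<kappa>" and \<kappa>_mono: "strict_mono \<kappa>" and \<kappa>_0: "\<kappa> 0 = 0"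
begin

lemma leaf_homeo_nth:
  "leaf_homeo \<kappa> p $ i = \<kappa> (F.label (p $ i) 0)"
  "leaf_homeo \<kappa> p $ j = (if 0 \<le> p $ i * p $ j then \<kappa> (F.label (p $ i) (p $ j)) - \<kappa> (F.label (p $ i) 0)
      else \<kappa> (G.label (p $ i) (p $ j)) - \<kappa> (G.label (p $ i) 0))"
  using ij by (simp_all add: leaf_homeo_def pt_nth)

lemma leaf_homeo_i_less: "p $ i < q $ i \<Longrightarrow> leaf_homeo \<kappa> p $ i < leaf_homeo \<kappa> q $ i"
  using F.foot_less[of "p $ i" "q $ i"] slope_signs(1) \<kappa>_mono by (simp add: leaf_homeo_nth strict_mono_less)

lemma leaf_homeo_i_eq: "p $ i = q $ i \<Longrightarrow> leaf_homeo \<kappa> p $ i = leaf_homeo \<kappa> q $ i"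
  by (simp add: leaf_homeo_nth)

lemma leaf_homeo_j_less: "p $ i = q $ i \<Longrightarrow> p $ j < q $ j \<Longrightarrow> leaf_homeo \<kappa> p $ j < leaf_homeo \<kappa> q $ j"
  unfolding leaf_homeo_nth
  using glued_monotone[where x="q $ i" and y="p $ j" and y'="q $ j" and ?f1.0="\<lambda>y. \<kappa> (F.label (q $ i) y) - \<kappa> (F.label (q $ i) 0)"
      and ?f2.0="\<lambda>y. \<kappa> (G.label (q $ i) y) - \<kappa> (G.label (q $ i) 0)"]
    F.label_less G.label_less \<kappa>_mono
  by (simp only: strict_mono_less diff_self diff_strict_right_mono)

lemma leaf_homeo_axis: "p $ i = 0 \<Longrightarrow> leaf_homeo \<kappa> p $ i = 0" "p $ j = 0 \<Longrightarrow> leaf_homeo \<kappa> p $ j = 0"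
  by (auto simp: leaf_homeo_nth F.label_0 \<kappa>_0)

lemma leaf_homeo_sign:
  "leaf_homeo \<kappa> p $ i > 0 \<longleftrightarrow> p $ i > 0" "leaf_homeo \<kappa> p $ i < 0 \<longleftrightarrow> p $ i < 0"
  "leaf_homeo \<kappa> p $ j > 0 \<longleftrightarrow> p $ j > 0" "leaf_homeo \<kappa> p $ j < 0 \<longleftrightarrow> p $ j < 0"
proof -
  have "leaf_homeo \<kappa> 0 $ i = 0" using leaf_homeo_axis(1)[of 0] by simp
  then have i: "p $ i > 0 \<Longrightarrow> leaf_homeo \<kappa> p $ i > 0" "p $ i < 0 \<Longrightarrow> leaf_homeo \<kappa> p $ i < 0"
    using leaf_homeo_i_less[of p 0] leaf_homeo_i_less[of 0 p] by auto
  have "leaf_homeo \<kappa> (pt i (p $ i) 0) $ j = 0" using leaf_homeo_axis(2) ij by (simp add: pt_nth)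
  then have j: "p $ j > 0 \<Longrightarrow> leaf_homeo \<kappa> p $ j > 0" "p $ j < 0 \<Longrightarrow> leaf_homeo \<kappa> p $ j < 0"
    using leaf_homeo_j_less[of p "pt i (p $ i) 0"] leaf_homeo_j_less[of "pt i (p $ i) 0" p] ij by (auto simp: pt_nth)
  show "leaf_homeo \<kappa> p $ i > 0 \<longleftrightarrow> p $ i > 0" "leaf_homeo \<kappa> p $ i < 0 \<longleftrightarrow> p $ i < 0"
    using i leaf_homeo_axis(1)[of p] by linarith+
  show "leaf_homeo \<kappa> p $ j > 0 \<longleftrightarrow> p $ j > 0" "leaf_homeo \<kappa> p $ j < 0 \<longleftrightarrow> p $ j < 0"
    using j leaf_homeo_axis(2)[of p] by linarith+
qed

lemma leaf_homeo_zero: "leaf_homeo \<kappa> p $ i = 0 \<longleftrightarrow> p $ i = 0" "leaf_homeo \<kappa> p $ j = 0 \<longleftrightarrow> p $ j = 0"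
  using leaf_homeo_sign[of p] leaf_homeo_axis[of p] by linarith+

lemma leaf_homeo_inj: "inj (leaf_homeo \<kappa>)"
proof (rule injI)
  fix p q assume eq: "leaf_homeo \<kappa> p = leaf_homeo \<kappa> q"
  then have "p $ i = q $ i" using leaf_homeo_i_less[of p q] leaf_homeo_i_less[of q p] by (cases "p $ i" "q $ i" rule: linorder_cases) auto
  moreover from this have "p $ j = q $ j" using leaf_homeo_j_less[of p q] leaf_homeo_j_less[of q p] eq by (cases "p $ j" "q $ j" rule: linorder_cases) auto
  ultimately show "p = q" by (simp add: plane_eq_iff[OF ij])
qed

lemma leaf_homeo_cont: "continuous_on UNIV (leaf_homeo \<kappa>)"
proof -
  have \<kappa>c: "continuous_on S (\<lambda>x. \<kappa> (f x))" if "continuous_on S f" for S and f :: "plane \<Rightarrow> real"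
    using continuous_on_compose2[OF \<kappa>_cont that] by simp
  have c: "closed {p::plane. 0 \<le> p $ i * p $ j}" "closed {p::plane. p $ i * p $ j \<le> 0}"
    by (intro closed_Collect_le continuous_intros)+
  have "continuous_on ({p::plane. 0 \<le> p $ i * p $ j} \<union> {p. p $ i * p $ j \<le> 0})
     (\<lambda>p. if 0 \<le> p $ i * p $ j then \<kappa> (F.label (p $ i) (p $ j)) - \<kappa> (F.label (p $ i) 0)
      else \<kappa> (G.label (p $ i) (p $ j)) - \<kappa> (G.label (p $ i) 0))"
  proof (rule continuous_on_cases[OF c])
    show "\<forall>x. x \<in> {p. 0 \<le> p $ i * p $ j} \<and> \<not> 0 \<le> x $ i * x $ j \<or> x \<in> {p. p $ i * p $ j \<le> 0} \<and> 0 \<le> x $ i * x $ j \<longrightarrow>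
        \<kappa> (F.label (x $ i) (x $ j)) - \<kappa> (F.label (x $ i) 0) = \<kappa> (G.label (x $ i) (x $ j)) - \<kappa> (G.label (x $ i) 0)"
    proof (intro allI impI)
      fix x :: plane
      assume "x \<in> {p. 0 \<le> p $ i * p $ j} \<and> \<not> 0 \<le> x $ i * x $ j \<or> x \<in> {p. p $ i * p $ j \<le> 0} \<and> 0 \<le> x $ i * x $ j"
      then have "x $ i * x $ j = 0" by auto
      then have "x $ i = 0 \<or> x $ j = 0" by simp
      then show "\<kappa> (F.label (x $ i) (x $ j)) - \<kappa> (F.label (x $ i) 0) = \<kappa> (G.label (x $ i) (x $ j)) - \<kappa> (G.label (x $ i) 0)"
        by (auto simp: F.label_0 G.label_0)
    qed
  qed (intro continuous_intros \<kappa>c F.label_cont_comp G.label_cont_comp)+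
  moreover have "{p::plane. 0 \<le> p $ i * p $ j} \<union> {p. p $ i * p $ j \<le> 0} = UNIV" by auto
  ultimately show ?thesis
    unfolding leaf_homeo_def by (intro continuous_on_pt \<kappa>c F.label_cont_comp continuous_intros) (simp only:)
qed

text \<open>The left-hand side is the label of the image point for the constant fields of slope \<open>-1\<close> and \<open>\<sigma>\<close>. For slope \<open>-1\<close>
  the foot cancels by definition; for slope \<open>\<sigma>\<close> it cancels by the conjugacy of the feet.\<close>

lemma leaf_homeo_label:
  assumes conj: "\<And>x. \<kappa> (G.label x 0) = - \<sigma> * \<kappa> (F.label x 0)"
  shows "(if 0 \<le> leaf_homeo \<kappa> p $ i * leaf_homeo \<kappa> p $ j then leaf_homeo \<kappa> p $ j + leaf_homeo \<kappa> p $ i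
          else leaf_homeo \<kappa> p $ j - \<sigma> * leaf_homeo \<kappa> p $ i) = \<kappa> (leaf_label p)"
proof -
  have "0 \<le> leaf_homeo \<kappa> p $ i * leaf_homeo \<kappa> p $ j \<longleftrightarrow> 0 \<le> p $ i * p $ j"
    using leaf_homeo_sign[of p] by (simp add: mult_less_0_iff flip: not_less)
  then show ?thesis using conj[of "p $ i"] by (auto simp: leaf_homeo_nth leaf_label_def labF_def labG_def)
qed

end

end

section \<open>Conjugating the feet, and the equivalence with constant fields\<close>

lemma bijective_if_expanding:
  fixes A :: "real \<Rightarrow> real"
  assumes cont: "continuous_on UNIV A" and mono: "strict_mono A" and "m > 0"
    and pos: "\<And>x. x \<ge> 0 \<Longrightarrow> m * x \<le> A x" and neg: "\<And>x. x \<le> 0 \<Longrightarrow> A x \<le> m * x"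
  shows "bij A"
proof -
  have "\<exists>x. A x = w" for w
  proof -
    have 1: "A (- (\<bar>w\<bar> / m)) \<le> w" using neg[of "- (\<bar>w\<bar> / m)"] \<open>m > 0\<close> by (simp add: abs_le_iff)
    have 2: "w \<le> A (\<bar>w\<bar> / m)" using pos[of "\<bar>w\<bar> / m"] \<open>m > 0\<close> by simp
    show ?thesis
      using IVT'[OF 1 2 _ continuous_on_subset[OF cont]] \<open>m > 0\<close> by auto
  qed
  then have "surj A" by (metis surj_def)
  then show ?thesis using mono strict_mono_imp_inj_on by (auto simp: bij_def)
qed

text \<open>With \<open>A\<close> and \<open>B\<close> the labels of the feet, the map \<open>B \<circ> inv A\<close> sends the label of a leaf of \<open>f\<close> to the label of
  the leaf of \<open>g\<close> with the same foot. It contracts by \<open>\<beta>2 / \<mu>1\<close> if the slopes of \<open>g\<close> are the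
  smaller ones; otherwise its inverse \<open>A \<circ> inv B\<close> contracts by \<open>\<mu>2 / \<beta>1\<close>.\<close>

lemma feet_conjugacy:
  assumes f: "slope_field f L M" and g: "slope_field g L' M'"
    and fb: "\<And>x y. - \<mu>2 \<le> f x y \<and> f x y \<le> - \<mu>1" and gb: "\<And>x y. \<beta>1 \<le> g x y \<and> g x y \<le> \<beta>2"
    and pos: "\<mu>1 > 0" "\<beta>1 > 0"
    and \<sigma>: "(\<sigma> = 1 / 2 \<and> \<beta>2 < \<mu>1) \<or> (\<sigma> = 2 \<and> \<mu>2 < \<beta>1)"
  obtains \<kappa> :: "real \<Rightarrow> real" where "continuous_on UNIV \<kappa>" "strict_mono \<kappa>" "\<kappa> 0 = 0"
    "\<And>x. \<kappa> (slope_field.label g x 0) = - \<sigma> * \<kappa> (slope_field.label f x 0)"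
proof -
  interpret f: slope_field f L M by (rule f)
  interpret g: slope_field g L' M' by (rule g)
  define A where "A x = f.label x 0" for x
  define B where "B x = g.label x 0" for x
  have cA: "continuous_on UNIV A" and cB: "continuous_on UNIV B"
    unfolding A_def B_def by (intro f.label_cont_comp g.label_cont_comp continuous_intros)+
  have f_neg: "f x y < 0" and g_pos: "g x y > 0" for x y using fb[of x y] gb[of x y] pos by linarith+
  have A_less: "A x < A y" and B_less: "B y < B x" if "x < y" for x y
    using f.foot_less[OF f_neg that] g.foot_greater[OF g_pos that] by (auto simp: A_def B_def)
  note fA = f.foot_bounds[of "- \<mu>2" "- \<mu>1", OF fb, folded A_def]
  note gB = g.foot_bounds[of \<beta>1 \<beta>2, OF gb, folded B_def]
  have absA: "\<mu>1 * \<bar>x\<bar> \<le> \<bar>A x\<bar>" "\<bar>A x\<bar> \<le> \<mu>2 * \<bar>x\<bar>" for x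
  proof -
    have "x \<ge> 0 \<Longrightarrow> \<mu>1 * x \<ge> 0" "x \<le> 0 \<Longrightarrow> \<mu>1 * x \<le> 0"
      using pos by (simp_all add: mult_nonneg_nonpos)
    then show "\<mu>1 * \<bar>x\<bar> \<le> \<bar>A x\<bar>" "\<bar>A x\<bar> \<le> \<mu>2 * \<bar>x\<bar>"
      using fA[of x] by (cases "x \<ge> 0"; simp)+
  qed
  have absB: "\<beta>1 * \<bar>x\<bar> \<le> \<bar>B x\<bar>" "\<bar>B x\<bar> \<le> \<beta>2 * \<bar>x\<bar>" for x
  proof -
    have "x \<ge> 0 \<Longrightarrow> \<beta>1 * x \<ge> 0" "x \<le> 0 \<Longrightarrow> \<beta>1 * x \<le> 0"
      using pos by (simp_all add: mult_nonneg_nonpos)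
    then show "\<beta>1 * \<bar>x\<bar> \<le> \<bar>B x\<bar>" "\<bar>B x\<bar> \<le> \<beta>2 * \<bar>x\<bar>"
      using gB[of x] by (cases "x \<ge> 0"; simp)+
  qed
  have "bij A"
    by (rule bijective_if_expanding[OF cA _ pos(1)]) (use fA A_less in \<open>auto simp: strict_mono_def\<close>)
  have "bij (\<lambda>x. - B x)"
  proof (rule bijective_if_expanding[OF _ _ pos(2)])
    show "\<beta>1 * x \<le> - B x" if "x \<ge> 0" for x using gB(1)[OF that] by simp
    show "- B x \<le> \<beta>1 * x" if "x \<le> 0" for x using gB(2)[OF that] by simp
  qed (use B_less cB in \<open>auto simp: strict_mono_def intro!: continuous_intros\<close>)
  then have "bij B"
    using bij_uminus bij_comp[of "\<lambda>x. - B x" uminus] by (simp add: o_def)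
  define D where "D w = B (inv A w)" for w
  define C where "C w = A (inv B w)" for w
  have DA: "D (A x) = B x" and CB: "C (B x) = A x" for x
    using \<open>bij A\<close> \<open>bij B\<close> by (simp_all add: D_def C_def bij_is_inj)
  have Ai: "A (inv A w) = w" and Bi: "B (inv B w) = w" for w
    using \<open>bij A\<close> \<open>bij B\<close> by (simp_all add: bij_is_surj surj_f_inv_f)
  have CD: "C (D w) = w" "D (C w) = w" for w
    using CB[of "inv A w"] DA[of "inv B w"] Ai Bi by (simp_all add: D_def C_def)
  have invA: "inv A v < inv A w" if "v < w" for v w
    using A_less[of "inv A w" "inv A v"] Ai that by (metis less_asym linorder_neqE_linordered_idom)
  have invB: "inv B w < inv B v" if "v < w" for v w
    using B_less[of "inv B v" "inv B w"] Bi that by (metis less_asym linorder_neqE_linordered_idom)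
  from \<sigma> show ?thesis
  proof (elim disjE conjE)
    assume s: "\<sigma> = 1 / 2" "\<beta>2 < \<mu>1"
    have \<beta>2: "0 \<le> \<beta>2" using gb[of 0 0] pos by linarith
    obtain \<kappa> :: "real \<Rightarrow> real" where \<kappa>: "continuous_on UNIV \<kappa>" "strict_mono \<kappa>" "\<kappa> 0 = 0" "\<And>w. \<kappa> (D w) = - \<kappa> w / 2"
    proof (rule decreasing_contraction_conjugacy[of D C "\<beta>2 / \<mu>1"])
      show "D w < D v" if "v < w" for v w using B_less invA that by (simp add: D_def)
      show "\<bar>D w\<bar> \<le> \<beta>2 / \<mu>1 * \<bar>w\<bar>" for w
      proof -
        have "\<bar>inv A w\<bar> \<le> \<bar>w\<bar> / \<mu>1" using absA(1)[of "inv A w"] Ai pos by (simp add: field_simps)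
        then have "\<beta>2 * \<bar>inv A w\<bar> \<le> \<beta>2 * (\<bar>w\<bar> / \<mu>1)" using \<beta>2 by (rule mult_left_mono)
        then show ?thesis using absB(2)[of "inv A w"] by (simp add: D_def)
      qed
    qed (use CD \<beta>2 s pos in auto)
    show ?thesis using that[OF \<kappa>(1-3)] \<kappa>(4) DA s by (simp add: A_def B_def) (metis DA A_def B_def)
  next
    assume s: "\<sigma> = 2" "\<mu>2 < \<beta>1"
    have \<mu>2: "0 \<le> \<mu>2" using fb[of 0 0] pos by linarith
    obtain \<kappa> :: "real \<Rightarrow> real" where \<kappa>: "continuous_on UNIV \<kappa>" "strict_mono \<kappa>" "\<kappa> 0 = 0" "\<And>w. \<kappa> (C w) = - \<kappa> w / 2"
    proof (rule decreasing_contraction_conjugacy[of C D "\<mu>2 / \<beta>1"])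
      show "C w < C v" if "v < w" for v w using A_less invB that by (simp add: C_def)
      show "\<bar>C w\<bar> \<le> \<mu>2 / \<beta>1 * \<bar>w\<bar>" for w
      proof -
        have "\<bar>inv B w\<bar> \<le> \<bar>w\<bar> / \<beta>1" using absB(1)[of "inv B w"] Bi pos by (simp add: field_simps)
        then have "\<mu>2 * \<bar>inv B w\<bar> \<le> \<mu>2 * (\<bar>w\<bar> / \<beta>1)" using \<mu>2 by (rule mult_left_mono)
        then show ?thesis using absA(2)[of "inv B w"] by (simp add: C_def)
      qed
    qed (use CD \<mu>2 s pos in auto)
    have "\<kappa> (B x) = - \<sigma> * \<kappa> (A x)" for x using \<kappa>(4)[of "B x"] CB[of x] s by simp
    then show ?thesis using that[OF \<kappa>(1-3)] by (simp add: A_def B_def)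
  qed
qed

lemma constant_slope_label:
  assumes "slope_field (\<lambda>x y. c) L M"
  shows "slope_field.label (\<lambda>x y. c) x y = y - c * x"
proof -
  interpret slope_field "\<lambda>x y. c" L M by (rule assms)
  have "solution (\<lambda>t. y + c * (t - x))" unfolding solution_def by (auto intro!: derivative_eq_intros)
  from label_solution[OF this, of x] show ?thesis by simp
qed

text \<open>Constant fields belong to the same class, so that the analysis of regular curves applies to the
  normal form as well.\<close>

lemma crossing_sliding_constant:
  fixes e c1 c2 :: real
  assumes ij: "i \<noteq> j" and e: "e = 1 \<or> e = -1" and c: "c1 > 0" "c2 > 0" and V: "open V" "0 \<in> V"
  defines "F \<equiv> \<lambda>p::plane. pt i e (- e)" and "G \<equiv> \<lambda>p::plane. pt i (e * c1) (e * c2)"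
  shows "crossing_sliding i j F G 1 (1 + c2 / c1) e (min 1 c1) (max 1 c1) F G V" (is ?C)
    and "crossing_sliding.leaf_label i j F G q = (if 0 \<le> q $ i * q $ j then q $ j + q $ i else q $ j - c2 / c1 * q $ i)"
proof -
  have F: "F p $ i = e" "F p $ j = - e" and G: "G p $ i = e * c1" "G p $ j = e * c2" for p
    using ij by (simp_all add: F_def G_def pt_nth)
  have ee: "e \<noteq> 0" "e * e = 1" "e * (e * a) = a" for a using e by auto
  have sF: "(\<lambda>x y. F (pt i x y) $ j / F (pt i x y) $ i) = (\<lambda>x y. -1)" using ee by (simp add: F)
  have sG: "(\<lambda>x y. G (pt i x y) $ j / G (pt i x y) $ i) = (\<lambda>x y. c2 / c1)" using ee by (simp add: G)
  have sfF: "slope_field (\<lambda>x y. -1) 1 (1 + c2 / c1)" and sfG: "slope_field (\<lambda>x y. c2 / c1) 1 (1 + c2 / c1)"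
    using c by (unfold_locales; simp)+
  show C: ?C
  proof (intro crossing_sliding.intro crossing_sliding_axioms.intro)
    show "slope_field (\<lambda>x y. F (pt i x y) $ j / F (pt i x y) $ i) 1 (1 + c2 / c1)"
      unfolding sF by (rule sfF)
    show "slope_field (\<lambda>x y. G (pt i x y) $ j / G (pt i x y) $ i) 1 (1 + c2 / c1)"
      unfolding sG by (rule sfG)
    show "continuous_on UNIV F" "continuous_on UNIV G" by (simp_all add: F_def G_def)
  qed (use ij e c V F G ee in auto)
  show "crossing_sliding.leaf_label i j F G q = (if 0 \<le> q $ i * q $ j then q $ j + q $ i else q $ j - c2 / c1 * q $ i)"
    unfolding crossing_sliding.leaf_label_def[OF C] crossing_sliding.labF_def[OF C] crossing_sliding.labG_def[OF C]
      sF sG constant_slope_label[OF sfF] constant_slope_label[OF sfG] by simp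
qed

text \<open>The neighbourhood of the constant fields is the image \<open>leaf_homeo \<kappa> ` V\<close>. The homeomorphism identifies labels
  with labels, and so does its inverse because \<open>\<kappa>\<close> is injective; the rest is transfer of leaves.\<close>

lemma (in crossing_sliding) locally_equivalent_to_constant:
  assumes \<kappa>: "continuous_on UNIV \<kappa>" "strict_mono \<kappa>" "\<kappa> 0 = 0"
    and conj: "\<And>x. \<kappa> (G.label x 0) = - (c2 / c1) * \<kappa> (F.label x 0)"
    and c: "c1 > 0" "c2 > 0" and U: "V \<subseteq> U" "leaf_homeo \<kappa> ` V \<subseteq> U"
    and \<Omega>: "(X, Y) \<in> Omega r U" "(\<lambda>p. pt i e (- e), \<lambda>p. pt i (e * c1) (e * c2)) \<in> Omega r U"
  shows "locally_Sigma_equivalent r U (X, Y) (\<lambda>p. pt i e (- e), \<lambda>p. pt i (e * c1) (e * c2))"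
proof -
  let ?h = "leaf_homeo \<kappa>"
  let ?X = "\<lambda>p::plane. pt i e (- e)" and ?Y = "\<lambda>p::plane. pt i (e * c1) (e * c2)"
  let ?lab = "crossing_sliding.leaf_label i j ?X ?Y"
  define V' where "V' = ?h ` V"
  have hc: "continuous_on V ?h" using leaf_homeo_cont[OF \<kappa>] continuous_on_subset by blast
  have hinj: "inj_on ?h V" using leaf_homeo_inj[OF \<kappa>] inj_on_subset by blast
  obtain g where hom: "homeomorphism V V' ?h g"
    unfolding V'_def using invariance_of_domain_homeomorphism[OF V_open hc _ hinj] by blast
  have V'_open: "open V'" unfolding V'_def using invariance_of_domain[OF hc V_open hinj] .
  have "?h 0 = 0" using leaf_homeo_zero[OF \<kappa>, of 0] by (simp add: plane_eq_iff[OF ij])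
  then have V'_0: "0 \<in> V'" unfolding V'_def using V_0 by (metis image_eqI)
  have gV: "g q \<in> V" and hg: "?h (g q) = q" if "q \<in> V'" for q
    using hom that by (auto simp: homeomorphism_def)
  have gh: "g (?h p) = p" if "p \<in> V" for p using hom that by (auto simp: homeomorphism_def)
  have gc: "continuous_on V' g" using hom by (simp add: homeomorphism_def)
  have C: "crossing_sliding i j F G L M e m K X Y V" by (rule crossing_sliding_axioms)
  note C' = crossing_sliding_constant(1)[OF ij e c V'_open V'_0]
  have lab: "?lab (?h p) = \<kappa> (leaf_label p)" for p
    unfolding crossing_sliding_constant(2)[OF ij e c V'_open V'_0] using leaf_homeo_label[OF \<kappa> conj] .
  have \<kappa>_inj: "\<kappa> a = \<kappa> b \<longleftrightarrow> a = b" for a b using \<kappa>(2) by (simp add: strict_mono_eq)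
  have h_curve: "crossing_sliding.leaf_curve i j ?X ?Y e V' I (?h \<circ> \<gamma>)" if "leaf_curve I \<gamma>" for I \<gamma>
  proof (rule leaf_curve_transfer[OF C C' hc _ _ _ _ that])
    show "?h ` V \<subseteq> V'" by (simp add: V'_def)
    show "?h p $ i < ?h q $ i" if "p $ i < q $ i" for p q using leaf_homeo_i_less[OF \<kappa> that] .
    show "?h p $ j = 0 \<longleftrightarrow> p $ j = 0" for p by (rule leaf_homeo_zero(2)[OF \<kappa>])
    show "?lab (?h p) = ?lab (?h q)" if "leaf_label p = leaf_label q" for p q unfolding lab that ..
  qed
  have g_curve: "leaf_curve I (g \<circ> \<gamma>)" if "crossing_sliding.leaf_curve i j ?X ?Y e V' I \<gamma>" for I \<gamma>
  proof (rule leaf_curve_transfer[OF C' C gc _ _ _ _ that])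
    show "g ` V' \<subseteq> V" using gV by auto
    show "g p $ i < g q $ i" if "p \<in> V'" "q \<in> V'" "p $ i < q $ i" for p q
    proof (cases "g p $ i" "g q $ i" rule: linorder_cases)
      case equal
      then show ?thesis using leaf_homeo_i_eq[OF \<kappa>, of "g q" "g p"] hg[OF that(1)] hg[OF that(2)] that(3) by simp
    next
      case greater
      then show ?thesis using leaf_homeo_i_less[OF \<kappa>, of "g q" "g p"] hg[OF that(1)] hg[OF that(2)] that(3) by simp
    qed
    show "g p $ j = 0 \<longleftrightarrow> p $ j = 0" if "p \<in> V'" for p using leaf_homeo_zero(2)[OF \<kappa>, of "g p"] hg[OF that] by simp
    show "leaf_label (g p) = leaf_label (g q)" if "p \<in> V'" "q \<in> V'" "?lab p = ?lab q" for p q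
      using lab[of "g p"] lab[of "g q"] \<kappa>_inj unfolding hg[OF that(1)] hg[OF that(2)] that(3) by simp
  qed
  have "maps_trajectories ?h (X, Y) V (?X, ?Y) V'"
    by (rule maps_trajectories_if_leaf_curves[OF C C' h_curve g_curve]) (simp_all add: V'_def gh)
  moreover have "maps_trajectories g (?X, ?Y) V' (X, Y) V"
    by (rule maps_trajectories_if_leaf_curves[OF C' C g_curve h_curve _ hg]) (simp_all add: gV image_subset_iff)
  moreover have "orientation_preserving_on V ?h"
  proof (rule orientation_preserving_if_monotone[OF ij V_open hc])
    show "?h p $ i < ?h q $ i" if "p $ i < q $ i" for p q using leaf_homeo_i_less[OF \<kappa> that] .
    show "?h p $ i = ?h q $ i \<and> ?h p $ j < ?h q $ j" if "p $ i = q $ i" "p $ j < q $ j" for p q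
      using leaf_homeo_i_eq[OF \<kappa> that(1)] leaf_homeo_j_less[OF \<kappa> that] by blast
  qed
  moreover have "?h ` Sigma_set V = Sigma_set V'"
  proof -
    have "?h p $ i * ?h p $ j = 0 \<longleftrightarrow> p $ i * p $ j = 0" for p using leaf_homeo_zero[OF \<kappa>, of p] by simp
    then show ?thesis unfolding Sigma_set_def V'_def prod_eq by auto
  qed
  ultimately show ?thesis
    unfolding locally_Sigma_equivalent_def
    using \<Omega> V_open V_0 V'_open V'_0 U hom V'_def by blast
qed

section \<open>Reduction of the theorem to global fields\<close>

lemma Ck_on_continuous: "Ck_on k f W \<Longrightarrow> continuous_on W f"
  by (cases k) (auto intro!: differentiable_imp_continuous_on differentiable_at_imp_differentiable_on)

lemma Ck_on_const: "Ck_on k (\<lambda>x. c) W"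
  by (induction k arbitrary: c) auto

text \<open>Continuity of the fibre derivative of the slope gives a Lipschitz constant near the origin.\<close>

lemma C1_slope_derivative:
  fixes f :: "plane \<Rightarrow> plane"
  assumes "Ck_on r f W" "r \<ge> 1" "i \<noteq> j"
  obtains E where "continuous_on {p\<in>W. f p $ i \<noteq> 0} E"
    "\<And>x y. pt i x y \<in> W \<Longrightarrow> f (pt i x y) $ i \<noteq> 0 \<Longrightarrow>
       ((\<lambda>y. f (pt i x y) $ j / f (pt i x y) $ i) has_real_derivative E (pt i x y)) (at y)"
proof -
  obtain k where r: "r = Suc k" using \<open>r \<ge> 1\<close> by (cases r) auto
  have diff: "f differentiable (at p)" if "p \<in> W" for p using assms(1) that by (simp add: r)
  define D where "D p = frechet_derivative f (at p) (pt i 0 1)" for p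
  have D_cont: "continuous_on W D"
    using assms(1) Ck_on_continuous[of k "\<lambda>p. frechet_derivative f (at p) (pt i 0 1)" W]
    unfolding r D_def by simp
  have f_cont: "continuous_on W f" using assms(1) by (rule Ck_on_continuous)
  define E where "E p = (D p $ j * f p $ i - f p $ j * D p $ i) / (f p $ i * f p $ i)" for p
  have "continuous_on {p\<in>W. f p $ i \<noteq> 0} E"
    unfolding E_def
    by (intro continuous_intros continuous_on_subset[OF D_cont] continuous_on_subset[OF f_cont]) auto
  moreover have "((\<lambda>y. f (pt i x y) $ j / f (pt i x y) $ i) has_real_derivative E (pt i x y)) (at y)"
    if "pt i x y \<in> W" "f (pt i x y) $ i \<noteq> 0" for x y
  proof -
    have Df: "(f has_derivative frechet_derivative f (at (pt i x y))) (at (pt i x y))"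
      using diff[OF that(1)] by (simp add: frechet_derivative_works)
    have Dp: "((\<lambda>y. pt i x y) has_vector_derivative pt i 0 1) (at y within UNIV)"
      by (rule has_vector_derivative_pt) (auto intro!: derivative_eq_intros)
    have "((f \<circ> (\<lambda>y. pt i x y)) has_vector_derivative D (pt i x y)) (at y)"
      unfolding D_def by (rule vector_derivative_diff_chain_within[OF Dp has_derivative_at_withinI[OF Df]])
    then have d: "((\<lambda>y. f (pt i x y) $ k) has_real_derivative D (pt i x y) $ k) (at y)" for k
      using has_vector_derivative_nth by (fastforce simp: o_def)
    show ?thesis unfolding E_def by (rule DERIV_divide[OF d d that(2)])
  qed
  ultimately show ?thesis using that by blast
qed

lemma norm_pt_le:
  assumes "i \<noteq> j"
  shows "norm (pt i x y) \<le> \<bar>x\<bar> + \<bar>y\<bar>"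
proof -
  have "norm (pt i x y) \<le> norm (x *\<^sub>R pt i 1 0) + norm (y *\<^sub>R pt i 0 1)"
    by (subst pt_scale) (rule norm_triangle_ineq)
  moreover have "pt i 1 0 = axis i 1" "pt i 0 1 = axis j 1"
    using assms by (simp_all add: plane_eq_iff[OF assms] pt_nth axis_def)
  ultimately show ?thesis by (simp add: norm_axis_1)
qed

definition clamp :: "real \<Rightarrow> real \<Rightarrow> real" where
  "clamp \<rho> t = max (- \<rho>) (min \<rho> t)"

lemma clamp: "\<rho> > 0 \<Longrightarrow> \<bar>clamp \<rho> t\<bar> \<le> \<rho>" "\<bar>clamp \<rho> t - clamp \<rho> t'\<bar> \<le> \<bar>t - t'\<bar>" "\<bar>t\<bar> \<le> \<rho> \<Longrightarrow> clamp \<rho> t = t"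
  by (auto simp: clamp_def)

text \<open>Clamping is \<open>1\<close>-Lipschitz and takes values in the box, so bounds and Lipschitz constants on the box become
  global ones.\<close>

lemma clamped_slope_field:
  fixes f :: "plane \<Rightarrow> plane"
  assumes ij: "i \<noteq> j" and "\<rho> > 0" "L > 0"
    and box: "\<And>x y. \<bar>x\<bar> \<le> \<rho> \<Longrightarrow> \<bar>y\<bar> \<le> \<rho> \<Longrightarrow> pt i x y \<in> W \<and> f (pt i x y) $ i \<noteq> 0"
    and fc: "continuous_on W f"
    and E: "\<And>x y. \<bar>x\<bar> \<le> \<rho> \<Longrightarrow> \<bar>y\<bar> \<le> \<rho> \<Longrightarrow>
       ((\<lambda>y. f (pt i x y) $ j / f (pt i x y) $ i) has_real_derivative E (pt i x y)) (at y) \<and> \<bar>E (pt i x y)\<bar> \<le> L"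
    and M: "\<And>x y. \<bar>x\<bar> \<le> \<rho> \<Longrightarrow> \<bar>y\<bar> \<le> \<rho> \<Longrightarrow> \<bar>f (pt i x y) $ j / f (pt i x y) $ i\<bar> \<le> M"
  defines "F \<equiv> \<lambda>p. f (pt i (clamp \<rho> (p $ i)) (clamp \<rho> (p $ j)))"
  shows "continuous_on UNIV F" "slope_field (\<lambda>x y. F (pt i x y) $ j / F (pt i x y) $ i) L M"
proof -
  note cl = clamp(1)[OF \<open>\<rho> > 0\<close>]
  show F_cont: "continuous_on UNIV F"
    unfolding F_def
  proof (rule continuous_on_compose2[OF fc])
    show "continuous_on UNIV (\<lambda>p::plane. pt i (clamp \<rho> (p $ i)) (clamp \<rho> (p $ j)))"
      unfolding clamp_def by (intro continuous_on_pt continuous_intros)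
  qed (use box cl in auto)
  have eq: "F (pt i x y) = f (pt i (clamp \<rho> x) (clamp \<rho> y))" for x y
    using ij by (simp add: F_def pt_nth)
  have F_ne: "F p $ i \<noteq> 0" for p unfolding F_def using box cl by blast
  show "slope_field (\<lambda>x y. F (pt i x y) $ j / F (pt i x y) $ i) L M"
  proof
    show "continuous_on UNIV (\<lambda>z. F (pt i (fst z) (snd z)) $ j / F (pt i (fst z) (snd z)) $ i)"
    proof -
      have "continuous_on UNIV (\<lambda>z. F (pt i (fst z) (snd z)))"
        by (rule continuous_on_compose2[OF F_cont]) (auto intro!: continuous_on_pt continuous_intros)
      then show ?thesis using F_ne by (intro continuous_on_divide continuous_on_component) auto
    qed
    show "L > 0" by fact
    show "\<bar>F (pt i x y) $ j / F (pt i x y) $ i\<bar> \<le> M" for x y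
      unfolding eq using M cl by blast
    fix x y y'
    define c where "c = clamp \<rho> x"
    let ?s = "\<lambda>y. f (pt i c y) $ j / f (pt i c y) $ i"
    have "norm (?s (clamp \<rho> y) - ?s (clamp \<rho> y')) \<le> L * norm (clamp \<rho> y - clamp \<rho> y')"
    proof (rule field_differentiable_bound[of "{-\<rho>..\<rho>}"])
      have c: "\<bar>c\<bar> \<le> \<rho>" unfolding c_def by (rule cl)
      have t: "\<bar>t\<bar> \<le> \<rho>" if "t \<in> {-\<rho>..\<rho>}" for t using that by (simp add: abs_le_iff)
      show "(?s has_field_derivative E (pt i c t)) (at t within {-\<rho>..\<rho>})" if "t \<in> {-\<rho>..\<rho>}" for t
        by (rule has_field_derivative_at_within[OF conjunct1[OF E[OF c t[OF that]]]])
      show "norm (E (pt i c t)) \<le> L" if "t \<in> {-\<rho>..\<rho>}" for t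
        using conjunct2[OF E[OF c t[OF that]]] by simp
      show "clamp \<rho> y \<in> {-\<rho>..\<rho>}" "clamp \<rho> y' \<in> {-\<rho>..\<rho>}"
        using cl[of y] cl[of y'] by (simp_all add: abs_le_iff)
    qed simp
    also have "\<dots> \<le> L * \<bar>y - y'\<bar>"
      using clamp(2)[of \<rho> y y'] \<open>L > 0\<close> by (intro mult_left_mono) auto
    finally show "\<bar>F (pt i x y) $ j / F (pt i x y) $ i - F (pt i x y') $ j / F (pt i x y') $ i\<bar> \<le> L * \<bar>y - y'\<bar>"
      unfolding eq c_def by simp
  qed
qed

text \<open>Windows around the absolute values of the two slopes at the origin, narrow enough to keep
  their order.\<close>

lemma slope_window:
  fixes \<mu> \<beta> :: real
  assumes "\<mu> > 0" "\<beta> > 0" "\<mu> \<noteq> \<beta>"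
  obtains \<mu>1 \<mu>2 \<beta>1 \<beta>2 where "0 < \<mu>1" "\<mu>1 < \<mu>" "\<mu> < \<mu>2" "0 < \<beta>1" "\<beta>1 < \<beta>" "\<beta> < \<beta>2"
    "\<beta> < \<mu> \<Longrightarrow> \<beta>2 < \<mu>1" "\<mu> < \<beta> \<Longrightarrow> \<mu>2 < \<beta>1"
proof (cases "\<beta> < \<mu>")
  case True
  then show ?thesis
    using assms by (intro that[of "(\<beta> + 2 * \<mu>) / 3" "2 * \<mu>" "\<beta> / 2" "(2 * \<beta> + \<mu>) / 3"]) auto
next
  case False
  then show ?thesis
    using assms by (intro that[of "\<mu> / 2" "(2 * \<mu> + \<beta>) / 3" "(\<mu> + 2 * \<beta>) / 3" "2 * \<beta>"]) auto
qed

lemma eventually_continuous_at_0: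
  fixes g :: "plane \<Rightarrow> real"
  assumes "continuous_on S g" "open S" "0 \<in> S"
  shows "a < g 0 \<Longrightarrow> \<forall>\<^sub>F p in nhds 0. a < g p" "g 0 < a \<Longrightarrow> \<forall>\<^sub>F p in nhds 0. g p < a"
proof -
  have "isCont g 0" using assms by (simp add: continuous_on_eq_continuous_at)
  then have "filterlim g (nhds (g 0)) (nhds 0)"
    by (simp add: isCont_def tendsto_at_iff_tendsto_nhds)
  then show "a < g 0 \<Longrightarrow> \<forall>\<^sub>F p in nhds 0. a < g p" "g 0 < a \<Longrightarrow> \<forall>\<^sub>F p in nhds 0. g p < a"
    by (auto dest: order_tendstoD)
qed

text \<open>The ratio \<open>c2 / c1\<close> is the slope of the second constant field. It is smaller than \<open>1\<close> exactly if the slope of \<open>Y\<close> at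
  the origin is smaller than the absolute slope of \<open>X\<close>; any other ratio on the same side of \<open>1\<close> would represent the
  same class.\<close>

theorem equivalent_to_constant:
  fixes U :: "plane set" and X Y :: "plane \<Rightarrow> plane" and i j :: 2
  assumes r: "r \<ge> 1" and U: "open U" "0 \<in> U" and \<Omega>: "(X, Y) \<in> Omega r U" and ij: "i \<noteq> j"
    and e: "e = 1 \<or> e = -1" and signs: "e * X 0 $ i > 0" "e * Y 0 $ i > 0" "e * X 0 $ j < 0" "e * Y 0 $ j > 0"
    and c: "c1 > 0" "c2 > 0"
    and \<sigma>: "(c2 / c1 = 1 / 2 \<and> Y 0 $ j / Y 0 $ i < - (X 0 $ j / X 0 $ i)) \<or>
            (c2 / c1 = 2 \<and> - (X 0 $ j / X 0 $ i) < Y 0 $ j / Y 0 $ i)"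
    and \<Omega>': "(\<lambda>p. pt i e (- e), \<lambda>p. pt i (e * c1) (e * c2)) \<in> Omega r U"
  shows "locally_Sigma_equivalent r U (X, Y) (\<lambda>p. pt i e (- e), \<lambda>p. pt i (e * c1) (e * c2))"
proof -
  obtain WX PX where PX: "open WX" "closure U \<subseteq> WX" "Ck_on r PX WX" "\<forall>p\<in>closure U. X p = PX p"
    using \<Omega> by (auto simp: Omega_def Ck_on_closed_def)
  obtain WY PY where PY: "open WY" "closure U \<subseteq> WY" "Ck_on r PY WY" "\<forall>p\<in>closure U. Y p = PY p"
    using \<Omega> by (auto simp: Omega_def Ck_on_closed_def)
  have UX: "U \<subseteq> WX" "U \<subseteq> WY" using PX(2) PY(2) closure_subset by blast+
  have XU: "X p = PX p" "Y p = PY p" if "p \<in> U" for p using that PX(4) PY(4) closure_subset by blast+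
  have X0: "X 0 = PX 0" "Y 0 = PY 0" using XU U by auto
  have cX: "continuous_on WX PX" and cY: "continuous_on WY PY" using PX PY Ck_on_continuous by blast+
  have cXk: "continuous_on WX (\<lambda>p. PX p $ k)" and cYk: "continuous_on WY (\<lambda>p. PY p $ k)" for k
    using cX cY by (auto intro: continuous_intros)
  obtain DX where DX: "continuous_on {p\<in>WX. PX p $ i \<noteq> 0} DX"
    "\<And>x y. pt i x y \<in> WX \<Longrightarrow> PX (pt i x y) $ i \<noteq> 0 \<Longrightarrow>
       ((\<lambda>y. PX (pt i x y) $ j / PX (pt i x y) $ i) has_real_derivative DX (pt i x y)) (at y)"
    by (rule C1_slope_derivative[OF PX(3) r ij]) (rule that)
  obtain DY where DY: "continuous_on {p\<in>WY. PY p $ i \<noteq> 0} DY"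
    "\<And>x y. pt i x y \<in> WY \<Longrightarrow> PY (pt i x y) $ i \<noteq> 0 \<Longrightarrow>
       ((\<lambda>y. PY (pt i x y) $ j / PY (pt i x y) $ i) has_real_derivative DY (pt i x y)) (at y)"
    by (rule C1_slope_derivative[OF PY(3) r ij]) (rule that)
  define \<mu> where "\<mu> = - (X 0 $ j / X 0 $ i)"
  define \<beta> where "\<beta> = Y 0 $ j / Y 0 $ i"
  have "\<mu> > 0" "\<beta> > 0" "\<mu> \<noteq> \<beta>"
    using signs e \<sigma> by (auto simp: \<mu>_def \<beta>_def divide_less_0_iff zero_less_divide_iff)
  then obtain \<mu>1 \<mu>2 \<beta>1 \<beta>2 where w: "0 < \<mu>1" "\<mu>1 < \<mu>" "\<mu> < \<mu>2" "0 < \<beta>1" "\<beta>1 < \<beta>" "\<beta> < \<beta>2"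
    "\<beta> < \<mu> \<Longrightarrow> \<beta>2 < \<mu>1" "\<mu> < \<beta> \<Longrightarrow> \<mu>2 < \<beta>1"
    by (rule slope_window) (rule that)
  have S: "open {p\<in>WX. PX p $ i \<noteq> 0}" "open {p\<in>WY. PY p $ i \<noteq> 0}"
    using continuous_open_preimage[OF cXk[of i] PX(1), of "- {0}"] continuous_open_preimage[OF cYk[of i] PY(1), of "- {0}"]
    by (simp_all add: vimage_def Int_def open_Compl)
  have S0: "0 \<in> {p\<in>WX. PX p $ i \<noteq> 0}" "0 \<in> {p\<in>WY. PY p $ i \<noteq> 0}"
    using signs UX U X0 by auto
  define m where "m = min (e * X 0 $ i) (e * Y 0 $ i) / 2"
  define K where "K = max (e * X 0 $ i) (e * Y 0 $ i) + 1"
  define L where "L = max \<bar>DX 0\<bar> \<bar>DY 0\<bar> + 1"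
  have m: "m > 0" "m < e * X 0 $ i" "m < e * Y 0 $ i" using signs by (auto simp: m_def min_def)
  have K: "e * X 0 $ i < K" "e * Y 0 $ i < K" by (auto simp: K_def)
  have L: "L > 0" "\<bar>DX 0\<bar> < L" "\<bar>DY 0\<bar> < L" by (auto simp: L_def)
  note evX = eventually_continuous_at_0[OF _ S(1) S0(1)] and evY = eventually_continuous_at_0[OF _ S(2) S0(2)]
  have cX': "continuous_on {p\<in>WX. PX p $ i \<noteq> 0} (\<lambda>p. PX p $ k)" and cY': "continuous_on {p\<in>WY. PY p $ i \<noteq> 0} (\<lambda>p. PY p $ k)" for k
    using continuous_on_subset[OF cXk[of k]] continuous_on_subset[OF cYk[of k]] by auto
  have sX: "continuous_on {p\<in>WX. PX p $ i \<noteq> 0} (\<lambda>p. PX p $ j / PX p $ i)" and sY: "continuous_on {p\<in>WY. PY p $ i \<noteq> 0} (\<lambda>p. PY p $ j / PY p $ i)"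
    by (rule continuous_on_divide[OF cX' cX'], simp) (rule continuous_on_divide[OF cY' cY'], simp)
  have eX: "continuous_on {p\<in>WX. PX p $ i \<noteq> 0} (\<lambda>p. e * PX p $ k)" and eY: "continuous_on {p\<in>WY. PY p $ i \<noteq> 0} (\<lambda>p. e * PY p $ k)" for k
    by (rule continuous_on_mult_left[OF cX'], rule continuous_on_mult_left[OF cY'])
  have evU: "\<forall>\<^sub>F p in nhds 0. p \<in> U" using U by (simp add: eventually_nhds_in_open)
  have "\<forall>\<^sub>F p in nhds 0. p \<in> U \<and> m < e * PX p $ i \<and> e * PX p $ i < K \<and> m < e * PY p $ i \<and> e * PY p $ i < K \<and>
     e * PX p $ j < 0 \<and> 0 < e * PY p $ j \<and> - \<mu>2 < PX p $ j / PX p $ i \<and> PX p $ j / PX p $ i < - \<mu>1 \<and>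
     \<beta>1 < PY p $ j / PY p $ i \<and> PY p $ j / PY p $ i < \<beta>2 \<and> \<bar>DX p\<bar> < L \<and> \<bar>DY p\<bar> < L"
    using w(2,3,5,6) m K L signs unfolding X0 \<mu>_def \<beta>_def
    by (intro eventually_conj evU evX[OF eX] evY[OF eY] evX[OF sX] evY[OF sY]
        evX(2)[OF continuous_on_rabs[OF DX(1)]] evY(2)[OF continuous_on_rabs[OF DY(1)]]) auto
  then obtain d where d: "d > 0" and good: "\<And>p. norm p < d \<Longrightarrow> p \<in> U \<and> m < e * PX p $ i \<and> e * PX p $ i < K \<and> m < e * PY p $ i \<and> e * PY p $ i < K \<and>
     e * PX p $ j < 0 \<and> 0 < e * PY p $ j \<and> - \<mu>2 < PX p $ j / PX p $ i \<and> PX p $ j / PX p $ i < - \<mu>1 \<and>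
     \<beta>1 < PY p $ j / PY p $ i \<and> PY p $ j / PY p $ i < \<beta>2 \<and> \<bar>DX p\<bar> < L \<and> \<bar>DY p\<bar> < L"
    unfolding eventually_nhds_metric by (auto simp: dist_norm)
  define \<rho> where "\<rho> = d / 3"
  have \<rho>: "\<rho> > 0" using d by (simp add: \<rho>_def)
  have inbox: "norm (pt i x y) < d" if "\<bar>x\<bar> \<le> \<rho>" "\<bar>y\<bar> \<le> \<rho>" for x y
    using norm_pt_le[OF ij, of x y] that d by (simp add: \<rho>_def)
  define cl where "cl p = pt i (clamp \<rho> (p $ i)) (clamp \<rho> (p $ j))" for p
  have cl_good: "norm (cl p) < d" for p unfolding cl_def using inbox clamp(1)[OF \<rho>] by blast
  define F where "F p = PX (cl p)" for p
  define G where "G p = PY (cl p)" for p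
  define M where "M = max \<mu>2 \<beta>2"
  have Fs: "continuous_on UNIV F" "slope_field (\<lambda>x y. F (pt i x y) $ j / F (pt i x y) $ i) L M"
  proof -
    have b: "pt i x y \<in> WX \<and> PX (pt i x y) $ i \<noteq> 0" if "\<bar>x\<bar> \<le> \<rho>" "\<bar>y\<bar> \<le> \<rho>" for x y
      using good[OF inbox[OF that]] UX m by auto
    have E: "((\<lambda>y. PX (pt i x y) $ j / PX (pt i x y) $ i) has_real_derivative DX (pt i x y)) (at y) \<and> \<bar>DX (pt i x y)\<bar> \<le> L"
      if "\<bar>x\<bar> \<le> \<rho>" "\<bar>y\<bar> \<le> \<rho>" for x y
      using good[OF inbox[OF that]] DX(2) b[OF that] by (simp add: less_imp_le)
    have M: "\<bar>PX (pt i x y) $ j / PX (pt i x y) $ i\<bar> \<le> M" if "\<bar>x\<bar> \<le> \<rho>" "\<bar>y\<bar> \<le> \<rho>" for x y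
      using good[OF inbox[OF that]] w by (auto simp: M_def abs_le_iff)
    show "continuous_on UNIV F" "slope_field (\<lambda>x y. F (pt i x y) $ j / F (pt i x y) $ i) L M"
      unfolding F_def cl_def by (rule clamped_slope_field[OF ij \<rho> L(1) b cX E M]; assumption)+
  qed
  have Gs: "continuous_on UNIV G" "slope_field (\<lambda>x y. G (pt i x y) $ j / G (pt i x y) $ i) L M"
  proof -
    have b: "pt i x y \<in> WY \<and> PY (pt i x y) $ i \<noteq> 0" if "\<bar>x\<bar> \<le> \<rho>" "\<bar>y\<bar> \<le> \<rho>" for x y
      using good[OF inbox[OF that]] UX m by auto
    have E: "((\<lambda>y. PY (pt i x y) $ j / PY (pt i x y) $ i) has_real_derivative DY (pt i x y)) (at y) \<and> \<bar>DY (pt i x y)\<bar> \<le> L"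
      if "\<bar>x\<bar> \<le> \<rho>" "\<bar>y\<bar> \<le> \<rho>" for x y
      using good[OF inbox[OF that]] DY(2) b[OF that] by (simp add: less_imp_le)
    have M: "\<bar>PY (pt i x y) $ j / PY (pt i x y) $ i\<bar> \<le> M" if "\<bar>x\<bar> \<le> \<rho>" "\<bar>y\<bar> \<le> \<rho>" for x y
      using good[OF inbox[OF that]] w by (auto simp: M_def abs_le_iff)
    show "continuous_on UNIV G" "slope_field (\<lambda>x y. G (pt i x y) $ j / G (pt i x y) $ i) L M"
      unfolding G_def cl_def by (rule clamped_slope_field[OF ij \<rho> L(1) b cY E M]; assumption)+
  qed
  have Fb: "- \<mu>2 \<le> F (pt i x y) $ j / F (pt i x y) $ i \<and> F (pt i x y) $ j / F (pt i x y) $ i \<le> - \<mu>1"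
   and Gb: "\<beta>1 \<le> G (pt i x y) $ j / G (pt i x y) $ i \<and> G (pt i x y) $ j / G (pt i x y) $ i \<le> \<beta>2" for x y
    using good[OF cl_good[of "pt i x y"]] by (auto simp: F_def G_def)
  have \<sigma>': "(c2 / c1 = 1 / 2 \<and> \<beta>2 < \<mu>1) \<or> (c2 / c1 = 2 \<and> \<mu>2 < \<beta>1)"
    using \<sigma> w(7,8) by (auto simp: \<mu>_def \<beta>_def)
  obtain \<kappa> :: "real \<Rightarrow> real" where \<kappa>: "continuous_on UNIV \<kappa>" "strict_mono \<kappa>" "\<kappa> 0 = 0"
    and conj: "\<And>x. \<kappa> (slope_field.label (\<lambda>x y. G (pt i x y) $ j / G (pt i x y) $ i) x 0) =
       - (c2 / c1) * \<kappa> (slope_field.label (\<lambda>x y. F (pt i x y) $ j / F (pt i x y) $ i) x 0)"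
    by (rule feet_conjugacy[OF Fs(2) Gs(2) Fb Gb w(1,4) \<sigma>']) (rule that)
  define V0 where "V0 = {p::plane. \<bar>p $ i\<bar> < \<rho> \<and> \<bar>p $ j\<bar> < \<rho>}"
  have V0_open: "open V0" unfolding V0_def by (intro open_Collect_conj open_Collect_less continuous_intros)
  have cl_V0: "cl p = p" if "p \<in> V0" for p
    using that by (simp add: cl_def V0_def clamp(3) pt_eta[OF ij])
  have V0_U: "p \<in> U" if "p \<in> V0" for p using good[OF cl_good[of p]] cl_V0[OF that] by simp
  have CS: "crossing_sliding i j F G L M e m K X Y V" if V: "open V" "0 \<in> V" "V \<subseteq> V0" for V
  proof (intro crossing_sliding.intro crossing_sliding_axioms.intro Fs Gs ij e m(1) V(1,2))
    fix p
    show "m \<le> e * F p $ i \<and> e * F p $ i \<le> K" "m \<le> e * G p $ i \<and> e * G p $ i \<le> K" "e * F p $ j < 0" "0 < e * G p $ j"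
      using good[OF cl_good[of p]] by (auto simp: F_def G_def)
    assume "p \<in> V"
    then have "p \<in> V0" using V by blast
    then show "X p = F p" "Y p = G p" using XU V0_U cl_V0 by (simp_all add: F_def G_def)
  qed
  have V0_0: "0 \<in> V0" using \<rho> by (simp add: V0_def)
  note C0 = CS[OF V0_open V0_0 order_refl]
  let ?h = "crossing_sliding.leaf_homeo i j F G \<kappa>"
  \<comment> \<open>Points are kept only if their image lies in \<open>U\<close>, since the second neighbourhood has to lie in \<open>U\<close> too.\<close>
  define V where "V = V0 \<inter> ?h -` U"
  have "?h 0 = 0"
    using crossing_sliding.leaf_homeo_zero[OF C0 \<kappa>, of 0] by (simp add: plane_eq_iff[OF ij])
  then have V_0: "0 \<in> V" using V0_0 U by (simp add: V_def)
  have "continuous_on V0 ?h" using crossing_sliding.leaf_homeo_cont[OF C0 \<kappa>] continuous_on_subset by blast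
  then have V_open: "open V" unfolding V_def using V0_open U(1) continuous_open_preimage by blast
  have C: "crossing_sliding i j F G L M e m K X Y V" using CS[OF V_open V_0] by (simp add: V_def)
  show ?thesis
    by (rule crossing_sliding.locally_equivalent_to_constant[OF C \<kappa> conj c _ _ \<Omega> \<Omega>'])
       (use V0_U in \<open>auto simp: V_def\<close>)
qed

lemma vector_eq_pt: "vector [x, y] = pt 1 x y" "vector [x, y] = pt 2 y x"
  by (simp_all add: plane_eq_iff[of 1 2] pt_nth)

text \<open>In terms of the absolute slopes \<open>\<mu>\<close> of \<open>X\<close> and \<open>\<beta>\<close> of \<open>Y\<close> at the origin, \<open>alpha (X, Y)\<close> is \<open>- \<beta> / \<mu>\<close> for \<open>i = 1\<close> and
  \<open>- \<mu> / \<beta>\<close> for \<open>i = 2\<close>. Thus its position relative to \<open>-1\<close> tells which slope is larger, and the two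
  Kronecker symbols put the factor \<open>2\<close> where it reproduces this order.\<close>

theorem proposition3p16:
  fixes r :: nat and U :: "(real^2) set" and X Y :: "real^2 \<Rightarrow> real^2" and i j :: 2
  assumes "r \<ge> 1" and "open U" and "bounded U" and "0 \<in> U"
    and "(X, Y) \<in> Omega r U"
    and "i \<noteq> j"
    and "X 0 $ i * Y 0 $ i > 0"
    and "X 0 $ j * Y 0 $ j < 0"
    and "X 0 $ 1 * X 0 $ 2 < 0"
    and "alpha (X, Y) \<noteq> -1"
  shows "locally_Sigma_equivalent r U (X, Y)
           (normal_form (sgn (X 0 $ 1)) (sgn (Y 0 $ 1)) (sgn (alpha (X, Y) + 1)))"
proof -
  define e where "e = sgn (X 0 $ i)"
  define c where "c = sgn (alpha (X, Y) + 1)"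
  define k1 where "k1 = 1 + kronecker 1 c"
  define k2 where "k2 = 1 + kronecker (-1) c"
  have ij: "i = 1 \<and> j = 2 \<or> i = 2 \<and> j = 1"
    using \<open>i \<noteq> j\<close> exhaust_2[of i] exhaust_2[of j] by metis
  have Xij: "X 0 $ i * X 0 $ j < 0" using assms(9) coord_prod[OF \<open>i \<noteq> j\<close>] by metis
  have e: "e = 1 \<or> e = -1" using assms(7) by (auto simp: e_def sgn_if)
  have signs: "e * X 0 $ i > 0" "e * Y 0 $ i > 0" "e * X 0 $ j < 0" "e * Y 0 $ j > 0"
    using assms(7,8) Xij by (auto simp: e_def sgn_if zero_less_mult_iff mult_less_0_iff)
  have c1: "c = 1 \<or> c = -1" using assms(10) by (auto simp: c_def sgn_if)
  have k: "c = 1 \<Longrightarrow> k1 = 2 \<and> k2 = 1" "c = -1 \<Longrightarrow> k1 = 1 \<and> k2 = 2"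
    by (auto simp: k1_def k2_def kronecker_def)
  have kpos: "k1 > 0" "k2 > 0" using k c1 by auto
  define c1' where "c1' = (if i = 1 then k1 else k2)"
  define c2' where "c2' = (if i = 1 then k2 else k1)"
  define \<mu> where "\<mu> = - (X 0 $ j / X 0 $ i)"
  define \<beta> where "\<beta> = Y 0 $ j / Y 0 $ i"
  have pos: "\<mu> > 0" "\<beta> > 0"
    using signs e by (auto simp: \<mu>_def \<beta>_def divide_less_0_iff zero_less_divide_iff)
  have ne: "X 0 $ i \<noteq> 0" "X 0 $ j \<noteq> 0" "Y 0 $ i \<noteq> 0" "Y 0 $ j \<noteq> 0" using signs by auto
  have \<sigma>: "(c2' / c1' = 1 / 2 \<and> \<beta> < \<mu>) \<or> (c2' / c1' = 2 \<and> \<mu> < \<beta>)"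
    using ij
  proof (elim disjE conjE)
    assume i: "i = 1" "j = 2"
    have "alpha (X, Y) + 1 = (\<mu> - \<beta>) / \<mu>"
      using ne i by (simp add: alpha_def \<mu>_def \<beta>_def field_simps)
    then have "c = sgn (\<mu> - \<beta>)" using pos by (simp add: c_def sgn_divide)
    then show ?thesis using c1 k i by (auto simp: c1'_def c2'_def sgn_if split: if_splits)
  next
    assume i: "i = 2" "j = 1"
    have "alpha (X, Y) + 1 = (\<beta> - \<mu>) / \<beta>"
      using ne i by (simp add: alpha_def \<mu>_def \<beta>_def field_simps)
    then have "c = sgn (\<beta> - \<mu>)" using pos by (simp add: c_def sgn_divide)
    then show ?thesis using c1 k i by (auto simp: c1'_def c2'_def sgn_if split: if_splits)
  qed
  have nf: "normal_form (sgn (X 0 $ 1)) (sgn (Y 0 $ 1)) c = (\<lambda>p. pt i e (- e), \<lambda>p. pt i (e * c1') (e * c2'))"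
    using ij
  proof (elim disjE conjE)
    assume i: "i = 1" "j = 2"
    have "sgn (X 0 $ 1) = e" "sgn (Y 0 $ 1) = e"
      using e signs unfolding i by (elim disjE; simp)+
    then show ?thesis
      unfolding normal_form_def vector_eq_pt(1) i c1'_def c2'_def k1_def k2_def by simp
  next
    assume i: "i = 2" "j = 1"
    have "sgn (X 0 $ 1) = - e" "sgn (Y 0 $ 1) = e"
      using e signs unfolding i by (elim disjE; simp)+
    then show ?thesis
      unfolding normal_form_def vector_eq_pt(2) i c1'_def c2'_def k1_def k2_def by simp
  qed
  have "Ck_on_closed r (\<lambda>p. q) K" for q K
    unfolding Ck_on_closed_def using Ck_on_const[of r q UNIV] by (intro exI[of _ UNIV] exI[of _ "\<lambda>p. q"]) auto
  then have \<Omega>': "(\<lambda>p. pt i e (- e), \<lambda>p. pt i (e * c1') (e * c2')) \<in> Omega r U" by (simp add: Omega_def)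
  have "c1' > 0" "c2' > 0" using kpos by (auto simp: c1'_def c2'_def)
  from equivalent_to_constant[OF assms(1,2,4,5,6) e signs this \<sigma>[unfolded \<mu>_def \<beta>_def] \<Omega>']
  show ?thesis unfolding c_def[symmetric] nf .
qed

end
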